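(* Suppose that: (1) for all $t=0,\dots,T-1$, $\boldsymbol\Gamma_t$ is a closed convex valued set-valued mapping; (2) for all $t=0,\dots,T-1$, $f_t$ and $L_t$ are continuously differentiable with respect to their first two arguments (state and control); $K$ is continuously differentiable; $L_t$ and $f_t$ are normal integrands; the derivatives of $f_t$, $L_t$ and $K$ are square integrable (in the sense given in the context); (3) (Markovian case) $\mathcal G_t=\mathcal F_t$ for all $t=0,\dots,T$; the random variables $\mathbf w_0,\dots,\mathbf w_T$ are independent; and for all $t=0,\dots,T-1$ there is a set $\Gamma_t\subset\mathbb U_t$ with $\boldsymbol\Gamma_t(\omega)=\Gamma_t$ $\mathbb P$-a.s. Assume that there exist two random processes $(\mathbf u_t)_{t=0,\dots,T-1}\in\mathcal U$ and $(\mathbf x_t)_{t=0,\dots,T}\in\mathcal X$ solution of the problem $$\min_{(\mathbf u,\mathbf x)\in\mathcal U\times\mathcal X}\ \mathbb E\Big(\sum_{t=0}^{T-1}L_t(\mathbf x_t,\mathbf u_t,\mathbf w_{t+1})+K(\mathbf x_T)\Big)$$ subject to $\mathbf x_0=\mathbf w_0$, $\mathbf x_{t+1}=f_t(\mathbf x_t,\mathbf u_t,\mathbf w_{t+1})$ $\mathbb P$-a.s. and $\mathbf u_t\in\mathcal U^{\rm as}_t\cap\mathcal U^{\rm me}_t$ for all $t=0,\dots,T-1$. Then there exists a process $(\boldsymbol\lambda_t)_{t=0,\dots,T}\in\mathcal X$ satisfying, for all $t=0,\dots,T-1$, \begin{align*} &\mathbf x_0=\mathbf w_0,\qquad \mathbf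 x_{t+1}=f_t(\mathbf x_t,\mathbf u_t,\mathbf w_{t+1}),\\ &\boldsymbol\lambda_T=K'^\top(\mathbf x_T),\qquad \boldsymbol\lambda_t=(L_t)'^\top_x(\mathbf x_t,\mathbf u_t,\mathbf w_{t+1})+(f_t)'^\top_x(\mathbf x_t,\mathbf u_t,\mathbf w_{t+1})\boldsymbol\lambda_{t+1},\\ &\mathbb E\big((L_t)'_u(\mathbf x_t,\mathbf u_t,\mathbf w_{t+1})+\boldsymbol\lambda_{t+1}^\top(f_t)'_u(\mathbf x_t,\mathbf u_t,\mathbf w_{t+1})\,\big|\,\mathcal G_t\big)\in-\partial\chi_{\mathcal U^{\rm as}_t}(\mathbf u_t), \end{align*} and such that, for all $t=0,\dots,T-1$, (a) $\boldsymbol\lambda_{t+1}\preceq(\mathbf x_{t+1},\mathbf w_{t+2},\dots,\mathbf w_T)$; (b) $\mathbf u_t\preceq\mathbf x_t$; (c) $\mathbb P$-a.s., $$\mathbb E\big((L_t)'_u(\mathbf x_t,\mathbf u_t,\mathbf w_{t+1})+\boldsymbol\lambda_{t+1}^\top(f_t)'_u(\mathbf x_t,\mathbf u_t,\mathbf w_{t+1})\,\big|\,\mathcal F_t\big)=\mathbb E\big((L_t)'_u(\mathbf x_t,\mathbf u_t,\mathbf w_{t+1})+\boldsymbol\lambda_{t+1}^\top(f_t)'_u(\mathbf x_t,\mathbf u_t,\mathbf w_{t+1})\,\big|\,\mathbf x_t\big).$$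
   Context: $(\Omega,\mathcal A,\mathbb P)$ is a probability space and $T\ge 1$ an integer. $\mathbb W_t=\mathbb R^{d_{w_t}}$, $\mathbb X_t=\mathbb R^{d_{x_t}}$, $\mathbb Y_t=\mathbb R^{d_{y_t}}$ ($t=0,\dots,T$) and $\mathbb U_t=\mathbb R^{d_{u_t}}$ ($t=0,\dots,T-1$) are the noise, state, observation and control spaces. $\mathcal X_t$ is the set of $\mathbb X_t$-valued random variables on $(\Omega,\mathcal A,\mathbb P)$ and $\mathcal X=\mathcal X_0\times\dots\times\mathcal X_T$; $\mathcal U_t=L^2(\Omega,\mathcal A,\mathbb P;\mathbb U_t)$ and $\mathcal U=\mathcal U_0\times\dots\times\mathcal U_{T-1}$. The noise process is $\mathbf w=(\mathbf w_0,\dots,\mathbf w_T)$ with $\mathbf w_t$ a $\mathbb W_t$-valued random variable (and $\mathbb W_0=\mathbb X_0$). Dynamics: $f_t:\mathbb X_t\times\mathbb U_t\times\mathbb W_{t+1}\to\mathbb X_{t+1}$; costs: $L_t:\mathbb X_t\times\mathbb U_t\times\mathbb W_{t+1}\to\mathbb R$ and $K:\mathbb X_T\to\mathbb R$. Observations: $\mathbf y_t=\widetilde h_t(\mathbf w_0,\dots,\mathbf w_T)$ $\mathbb P$-a.s. with $\widetilde h_t:\mathbb W_0\times\dots\times\mathbb W_T\to\mathbb Y_t$ measurable; $\mathcal G_t=\sigma(\mathbf y_t)$; $\mathcal F_t=\sigma(\mathbf w_0,\dots,\mathbf w_t)$. $\boldsymbol\Gamma_t:\Omega\rightrightarrows\mathbb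 U_t$ are set-valued mappings, and $$\mathcal U^{\rm as}_t=\{\mathbf u_t\in\mathcal U_t:\mathbf u_t(\omega)\in\boldsymbol\Gamma_t(\omega)\ \mathbb P\text{-a.s.}\},\quad \mathcal U^{\rm me}_t=\{\mathbf u_t\in\mathcal U_t:\mathbf u_t\text{ is }\mathcal G_t\text{-measurable}\}.$$ For random variables, $\mathbf y_1\preceq\mathbf y_2$ means that $\mathbf y_1$ is measurable with respect to $\mathbf y_2$, i.e. $\sigma(\mathbf y_1)\subset\sigma(\mathbf y_2)$, equivalently $\mathbf y_1=\phi\circ\mathbf y_2$ for a measurable mapping $\phi$. For $t=T-1$, the tuple $(\mathbf x_{t+1},\mathbf w_{t+2},\dots,\mathbf w_T)$ is $\mathbf x_T$. Normal integrands are in the sense of Rockafellar–Wets, Definition 14.27 ((state, control) being the decision argument, the noise the measurable parameter; componentwise for $f_t$). Derivatives with respect to $x$ and $u$ are row vectors/Jacobian matrices, $\top$ denotes transpose; row vectors are identified with their transposes via the inner product. For a convex subset $C$ of a Hilbert space and $u\in C$, $\chi_C$ is the indicator function ($0$ on $C$, $+\infty$ elsewhere) and $\partial\chi_C(u)=\{r:\langle r,v-u\rangle\le0\ \forall v\in C\}$ (here in $\mathcal U_t$). Meaning of "the derivatives are square integrable": the assumption permits all integration and differentiation operations. Namely, writing $j(u,w)$ for the total cost $\sum_t L_t(x_t,u_t,w_{t+1})+K(x_T)$ as a function of $(u,w)$ after elimination of the state by the dynamics, $J(\mathbf u)=\mathbb E(j(\mathbf u,\mathbf w))$ is finite on $\mathcal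 U$, and for every $\mathbf u\in\mathcal U$, along the corresponding state trajectory, the derivatives in $x$ and $u$ of $f_t,L_t,K$, the co-states defined by $\boldsymbol\lambda_T=K'^\top(\mathbf x_T)$, $\boldsymbol\lambda_t=(L_t)'^\top_x+(f_t)'^\top_x\boldsymbol\lambda_{t+1}$, and the derivative $j'_u(\mathbf u,\mathbf w)$ are square integrable.
   Formalization: (b) fails for some solutions. Proved: each solution (u,x) has λ satisfying the state, co-state and conditional-expectation conditions, with (a),(c) if it satisfies (b); and some, possibly different, solution has λ satisfying everything including (a),(b),(c). *)

theory Defs
  imports "HOL-Probability.Probability"
begin

section \<open>Random variables with values in a subset of a Euclidean space\<close>

definition rv :: "'a measure \<Rightarrow> 'e::euclidean_space set \<Rightarrow> ('a \<Rightarrow> 'e) set" where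
  "rv M S = {f \<in> borel_measurable M. \<forall>\<omega>\<in>space M. f \<omega> \<in> S}"

definition sq_integrable :: "'a measure \<Rightarrow> ('a \<Rightarrow> 'e::euclidean_space) \<Rightarrow> bool" where
  "sq_integrable M f \<longleftrightarrow> f \<in> borel_measurable M \<and> integrable M (\<lambda>\<omega>. (norm (f \<omega>))\<^sup>2)"

definition L2 :: "'a measure \<Rightarrow> 'e::euclidean_space set \<Rightarrow> ('a \<Rightarrow> 'e) set" where
  "L2 M S = {f \<in> rv M S. sq_integrable M f}"

definition sigma_gen :: "'a measure \<Rightarrow> 'b measure \<Rightarrow> ('a \<Rightarrow> 'b) \<Rightarrow> 'a measure" where
  "sigma_gen M N g = vimage_algebra (space M) g N"

text \<open>\<open>precedes M N f g\<close> is \<open>f \<preceq> g\<close>, for a random element \<open>g\<close> of the measurable space \<open>N\<close>.\<close>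

definition precedes :: "'a measure \<Rightarrow> 'b measure \<Rightarrow> ('a \<Rightarrow> 'e::euclidean_space) \<Rightarrow> ('a \<Rightarrow> 'b) \<Rightarrow> bool" where
  "precedes M N f g \<longleftrightarrow> f \<in> borel_measurable (sigma_gen M N g)"

text \<open>Componentwise conditional expectation of a vector with coordinates indexed by \<open>B \<subseteq> Basis\<close>,
  i.e. of a random variable with values in \<open>span B\<close>. It is a particular version, as is
  \<^const>\<open>real_cond_exp\<close>.\<close>

definition vec_cond_exp ::
  "'a measure \<Rightarrow> 'a measure \<Rightarrow> 'e::euclidean_space set \<Rightarrow> ('a \<Rightarrow> 'e) \<Rightarrow> 'a \<Rightarrow> 'e" where
  "vec_cond_exp M F B f \<omega> = (\<Sum>b\<in>B. real_cond_exp M F (\<lambda>\<omega>'. f \<omega>' \<bullet> b) \<omega> *\<^sub>R b)"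

text \<open>The subdifferential at \<open>u\<close> of the indicator function of \<open>C\<close>, in the Hilbert space
  \<open>L2 M S\<close> with inner product \<open>E(r \<bullet> v)\<close>.\<close>

definition subdiff_indicator ::
  "'a measure \<Rightarrow> 'e::euclidean_space set \<Rightarrow> ('a \<Rightarrow> 'e) set \<Rightarrow> ('a \<Rightarrow> 'e) \<Rightarrow> ('a \<Rightarrow> 'e) set" where
  "subdiff_indicator M S C u =
     {r \<in> L2 M S. \<forall>v\<in>C. (\<integral>\<omega>. r \<omega> \<bullet> (v \<omega> - u \<omega>) \<partial>M) \<le> 0}"


section \<open>Derivatives on a linear subspace\<close>

text \<open>The Jacobian at \<open>x\<close> of a map defined on the linear subspace \<open>S\<close>, as a linear map on the
  ambient space that vanishes on the orthogonal complement of \<open>S\<close> (\<^term>\<open>closest_point S\<close> is the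
  orthogonal projection). The derivative within \<open>S\<close> is determined only on \<open>S\<close>; precomposing with
  the projection removes the ambiguity, and makes the \<^const>\<open>adjoint\<close> take its values in \<open>S\<close>, so
  that it is the transpose of the Jacobian matrix. For real-valued \<open>g\<close>, \<open>grad_on\<close> is the
  transpose of the row vector \<open>g'(x)\<close>.\<close>

definition deriv_on ::
  "'b::euclidean_space set \<Rightarrow> ('b \<Rightarrow> 'c::euclidean_space) \<Rightarrow> 'b \<Rightarrow> 'b \<Rightarrow> 'c" where
  "deriv_on S g x = (\<lambda>h. frechet_derivative g (at x within S) (closest_point S h))"

definition grad_on :: "'b::euclidean_space set \<Rightarrow> ('b \<Rightarrow> real) \<Rightarrow> 'b \<Rightarrow> 'b" where
  "grad_on S g x = adjoint (deriv_on S g x) 1"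

definition C1_on :: "'b::euclidean_space set \<Rightarrow> ('b \<Rightarrow> 'c::euclidean_space) \<Rightarrow> bool" where
  "C1_on S g \<longleftrightarrow> g differentiable_on S \<and> (\<forall>h. continuous_on S (\<lambda>x. deriv_on S g x h))"


section \<open>Normal integrands\<close>

text \<open>Rockafellar--Wets, Definition 14.27, for real-valued integrands: the epigraphical mapping
  \<open>p \<mapsto> epi g(p, \<cdot>)\<close> is closed-valued and measurable. The parameter space is the measurable
  space \<open>N\<close>, the decision space is \<open>S\<close>.\<close>

definition normal_integrand ::
  "'p measure \<Rightarrow> 'b::euclidean_space set \<Rightarrow> ('p \<Rightarrow> 'b \<Rightarrow> real) \<Rightarrow> bool" where
  "normal_integrand N S g \<longleftrightarrow>
     (\<forall>p\<in>space N. closed (epigraph S (g p))) \<and>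
     (\<forall>V. open V \<longrightarrow> {p \<in> space N. epigraph S (g p) \<inter> V \<noteq> {}} \<in> sets N)"


section \<open>The stochastic optimal control problem\<close>

text \<open>The dimensions of the spaces vary with time, so each space \<open>\<real>\<^sup>d\<close> is represented by a coordinate
  subspace \<open>span B\<close>, with \<open>B \<subseteq> Basis\<close> and \<open>card B = d\<close>, of one ambient Euclidean space \<open>'e\<close> of
  arbitrary dimension. Any finite family of dimensions is obtained for \<open>'e\<close> large enough.
  Processes are indexed by \<open>nat\<close>; only the values at times up to the horizon matter.\<close>

record ('a, 'e) control_problem =
  prob :: "'a measure"
  horizon :: nat
  Wcoord :: "nat \<Rightarrow> 'e set"
  Xcoord :: "nat \<Rightarrow> 'e set"
  Ycoord :: "nat \<Rightarrow> 'e set"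
  Ucoord :: "nat \<Rightarrow> 'e set"
  noise :: "nat \<Rightarrow> 'a \<Rightarrow> 'e"
  dyn :: "nat \<Rightarrow> 'e \<Rightarrow> 'e \<Rightarrow> 'e \<Rightarrow> 'e"
  cost :: "nat \<Rightarrow> 'e \<Rightarrow> 'e \<Rightarrow> 'e \<Rightarrow> real"
  final_cost :: "'e \<Rightarrow> real"
  obs_map :: "nat \<Rightarrow> (nat \<Rightarrow> 'e) \<Rightarrow> 'e"
  obs :: "nat \<Rightarrow> 'a \<Rightarrow> 'e"
  constr :: "nat \<Rightarrow> 'a \<Rightarrow> 'e set"

abbreviation Wsp :: "('a, 'e::euclidean_space) control_problem \<Rightarrow> nat \<Rightarrow> 'e set" where
  "Wsp P t \<equiv> span (Wcoord P t)"

abbreviation Xsp :: "('a, 'e::euclidean_space) control_problem \<Rightarrow> nat \<Rightarrow> 'e set" where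
  "Xsp P t \<equiv> span (Xcoord P t)"

abbreviation Ysp :: "('a, 'e::euclidean_space) control_problem \<Rightarrow> nat \<Rightarrow> 'e set" where
  "Ysp P t \<equiv> span (Ycoord P t)"

abbreviation Usp :: "('a, 'e::euclidean_space) control_problem \<Rightarrow> nat \<Rightarrow> 'e set" where
  "Usp P t \<equiv> span (Ucoord P t)"

definition control_setting :: "('a, 'e::euclidean_space) control_problem \<Rightarrow> bool" where
  "control_setting P \<longleftrightarrow>
     prob_space (prob P) \<and> horizon P \<ge> 1 \<and>
     (\<forall>t\<le>horizon P. Wcoord P t \<subseteq> Basis \<and> Xcoord P t \<subseteq> Basis \<and> Ycoord P t \<subseteq> Basis) \<and>
     (\<forall>t<horizon P. Ucoord P t \<subseteq> Basis) \<and>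
     Wcoord P 0 = Xcoord P 0 \<and>
     (\<forall>t\<le>horizon P. noise P t \<in> rv (prob P) (Wsp P t)) \<and>
     (\<forall>t<horizon P. \<forall>x\<in>Xsp P t. \<forall>u\<in>Usp P t. \<forall>w\<in>Wsp P (Suc t). dyn P t x u w \<in> Xsp P (Suc t)) \<and>
     (\<forall>t\<le>horizon P.
        obs P t \<in> rv (prob P) (Ysp P t) \<and>
        obs_map P t \<in> (PiM {..horizon P} (\<lambda>s. restrict_space borel (Wsp P s)))
                        \<rightarrow>\<^sub>M restrict_space borel (Ysp P t) \<and>
        (AE \<omega> in prob P. obs P t \<omega> = obs_map P t (\<lambda>s\<in>{..horizon P}. noise P s \<omega>))) \<and>
     (\<forall>t<horizon P. \<forall>\<omega>\<in>space (prob P). constr P t \<omega> \<subseteq> Usp P t)"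

definition obs_alg :: "('a, 'e::euclidean_space) control_problem \<Rightarrow> nat \<Rightarrow> 'a measure" where
  "obs_alg P t = sigma_gen (prob P) borel (obs P t)"

definition noise_alg :: "('a, 'e::euclidean_space) control_problem \<Rightarrow> nat \<Rightarrow> 'a measure" where
  "noise_alg P t =
     sigma_gen (prob P) (PiM {..t} (\<lambda>_. borel)) (\<lambda>\<omega>. \<lambda>s\<in>{..t}. noise P s \<omega>)"

definition Uas :: "('a, 'e::euclidean_space) control_problem \<Rightarrow> nat \<Rightarrow> ('a \<Rightarrow> 'e) set" where
  "Uas P t = {v \<in> L2 (prob P) (Usp P t). AE \<omega> in prob P. v \<omega> \<in> constr P t \<omega>}"

definition Ume :: "('a, 'e::euclidean_space) control_problem \<Rightarrow> nat \<Rightarrow> ('a \<Rightarrow> 'e) set" where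
  "Ume P t = {v \<in> L2 (prob P) (Usp P t). v \<in> borel_measurable (obs_alg P t)}"

definition controls :: "('a, 'e::euclidean_space) control_problem \<Rightarrow> (nat \<Rightarrow> 'a \<Rightarrow> 'e) set" where
  "controls P = {u. \<forall>t<horizon P. u t \<in> L2 (prob P) (Usp P t)}"

definition states :: "('a, 'e::euclidean_space) control_problem \<Rightarrow> (nat \<Rightarrow> 'a \<Rightarrow> 'e) set" where
  "states P = {x. \<forall>t\<le>horizon P. x t \<in> rv (prob P) (Xsp P t)}"

definition state_eqs ::
  "('a, 'e::euclidean_space) control_problem \<Rightarrow> (nat \<Rightarrow> 'a \<Rightarrow> 'e) \<Rightarrow> (nat \<Rightarrow> 'a \<Rightarrow> 'e) \<Rightarrow> bool" where
  "state_eqs P u x \<longleftrightarrow>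
     (AE \<omega> in prob P. x 0 \<omega> = noise P 0 \<omega>) \<and>
     (\<forall>t<horizon P. AE \<omega> in prob P. x (Suc t) \<omega> = dyn P t (x t \<omega>) (u t \<omega>) (noise P (Suc t) \<omega>))"

definition feasible ::
  "('a, 'e::euclidean_space) control_problem \<Rightarrow> (nat \<Rightarrow> 'a \<Rightarrow> 'e) \<Rightarrow> (nat \<Rightarrow> 'a \<Rightarrow> 'e) \<Rightarrow> bool" where
  "feasible P u x \<longleftrightarrow>
     u \<in> controls P \<and> x \<in> states P \<and> state_eqs P u x \<and>
     (\<forall>t<horizon P. u t \<in> Uas P t \<inter> Ume P t)"

definition expected_cost ::
  "('a, 'e::euclidean_space) control_problem \<Rightarrow> (nat \<Rightarrow> 'a \<Rightarrow> 'e) \<Rightarrow> (nat \<Rightarrow> 'a \<Rightarrow> 'e) \<Rightarrow> real" where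
  "expected_cost P u x =
     (\<integral>\<omega>. (\<Sum>t<horizon P. cost P t (x t \<omega>) (u t \<omega>) (noise P (Suc t) \<omega>))
          + final_cost P (x (horizon P) \<omega>) \<partial>(prob P))"

definition solution ::
  "('a, 'e::euclidean_space) control_problem \<Rightarrow> (nat \<Rightarrow> 'a \<Rightarrow> 'e) \<Rightarrow> (nat \<Rightarrow> 'a \<Rightarrow> 'e) \<Rightarrow> bool" where
  "solution P u x \<longleftrightarrow>
     feasible P u x \<and>
     (\<forall>u' x'. feasible P u' x' \<longrightarrow> expected_cost P u x \<le> expected_cost P u' x')"


section \<open>Co-states and integrability of the derivatives\<close>

definition costate_eqs ::
  "('a, 'e::euclidean_space) control_problem \<Rightarrow>
     (nat \<Rightarrow> 'a \<Rightarrow> 'e) \<Rightarrow> (nat \<Rightarrow> 'a \<Rightarrow> 'e) \<Rightarrow> (nat \<Rightarrow> 'a \<Rightarrow> 'e) \<Rightarrow> bool" where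
  "costate_eqs P u x l \<longleftrightarrow>
     (AE \<omega> in prob P. l (horizon P) \<omega> =
        grad_on (Xsp P (horizon P)) (final_cost P) (x (horizon P) \<omega>)) \<and>
     (\<forall>t<horizon P. AE \<omega> in prob P. l t \<omega> =
        grad_on (Xsp P t) (\<lambda>\<xi>. cost P t \<xi> (u t \<omega>) (noise P (Suc t) \<omega>)) (x t \<omega>)
        + adjoint (deriv_on (Xsp P t) (\<lambda>\<xi>. dyn P t \<xi> (u t \<omega>) (noise P (Suc t) \<omega>)) (x t \<omega>))
            (l (Suc t) \<omega>))"

text \<open>The (transposed) row vector \<open>(L\<^sub>t)'\<^sub>u + \<lambda>\<^sub>t\<^sub>+\<^sub>1\<^sup>T (f\<^sub>t)'\<^sub>u\<close> along the trajectory.\<close>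

definition control_grad ::
  "('a, 'e::euclidean_space) control_problem \<Rightarrow>
     (nat \<Rightarrow> 'a \<Rightarrow> 'e) \<Rightarrow> (nat \<Rightarrow> 'a \<Rightarrow> 'e) \<Rightarrow> (nat \<Rightarrow> 'a \<Rightarrow> 'e) \<Rightarrow> nat \<Rightarrow> 'a \<Rightarrow> 'e" where
  "control_grad P u x l t \<omega> =
     grad_on (Usp P t) (\<lambda>v. cost P t (x t \<omega>) v (noise P (Suc t) \<omega>)) (u t \<omega>)
     + adjoint (deriv_on (Usp P t) (\<lambda>v. dyn P t (x t \<omega>) v (noise P (Suc t) \<omega>)) (u t \<omega>))
         (l (Suc t) \<omega>)"

text \<open>Elimination of the state for fixed sequences of controls and noises; \<open>reduced_cost P u w\<close>
  is \<open>j(u, w)\<close>.\<close>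

primrec trajectory ::
  "('a, 'e::euclidean_space) control_problem \<Rightarrow> (nat \<Rightarrow> 'e) \<Rightarrow> (nat \<Rightarrow> 'e) \<Rightarrow> nat \<Rightarrow> 'e" where
  "trajectory P u w 0 = w 0"
| "trajectory P u w (Suc t) = dyn P t (trajectory P u w t) (u t) (w (Suc t))"

definition reduced_cost ::
  "('a, 'e::euclidean_space) control_problem \<Rightarrow> (nat \<Rightarrow> 'e) \<Rightarrow> (nat \<Rightarrow> 'e) \<Rightarrow> real" where
  "reduced_cost P u w =
     (\<Sum>t<horizon P. cost P t (trajectory P u w t) (u t) (w (Suc t)))
     + final_cost P (trajectory P u w (horizon P))"

text \<open>Jacobian matrices are square integrable entrywise, i.e. column by column. The derivative
  \<open>j'\<^sub>u\<close> is the tuple of its blocks, the gradients in the single controls \<open>u\<^sub>t\<close>.\<close>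

definition sq_integrable_derivatives :: "('a, 'e::euclidean_space) control_problem \<Rightarrow> bool" where
  "sq_integrable_derivatives P \<longleftrightarrow>
     (\<forall>u\<in>controls P.
        integrable (prob P) (\<lambda>\<omega>. reduced_cost P (\<lambda>s. u s \<omega>) (\<lambda>s. noise P s \<omega>)) \<and>
        (\<forall>t<horizon P. sq_integrable (prob P) (\<lambda>\<omega>.
           grad_on (Usp P t)
             (\<lambda>v. reduced_cost P ((\<lambda>s. u s \<omega>)(t := v)) (\<lambda>s. noise P s \<omega>)) (u t \<omega>))) \<and>
        (\<forall>x\<in>states P. state_eqs P u x \<longrightarrow>
           sq_integrable (prob P) (\<lambda>\<omega>.
             grad_on (Xsp P (horizon P)) (final_cost P) (x (horizon P) \<omega>)) \<and>
           (\<forall>t<horizon P.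
              sq_integrable (prob P) (\<lambda>\<omega>.
                grad_on (Xsp P t) (\<lambda>\<xi>. cost P t \<xi> (u t \<omega>) (noise P (Suc t) \<omega>)) (x t \<omega>)) \<and>
              sq_integrable (prob P) (\<lambda>\<omega>.
                grad_on (Usp P t) (\<lambda>v. cost P t (x t \<omega>) v (noise P (Suc t) \<omega>)) (u t \<omega>)) \<and>
              (\<forall>b\<in>Basis.
                 sq_integrable (prob P) (\<lambda>\<omega>.
                   deriv_on (Xsp P t) (\<lambda>\<xi>. dyn P t \<xi> (u t \<omega>) (noise P (Suc t) \<omega>)) (x t \<omega>) b) \<and>
                 sq_integrable (prob P) (\<lambda>\<omega>.
                   deriv_on (Usp P t) (\<lambda>v. dyn P t (x t \<omega>) v (noise P (Suc t) \<omega>)) (u t \<omega>) b))) \<and>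
           (\<forall>l\<in>states P. costate_eqs P u x l \<longrightarrow>
              (\<forall>t\<le>horizon P. sq_integrable (prob P) (l t)))))"


section \<open>Hypotheses and optimality conditions\<close>

definition closed_convex_constraints :: "('a, 'e::euclidean_space) control_problem \<Rightarrow> bool" where
  "closed_convex_constraints P \<longleftrightarrow>
     (\<forall>t<horizon P. \<forall>\<omega>\<in>space (prob P). closed (constr P t \<omega>) \<and> convex (constr P t \<omega>))"

definition smooth_data :: "('a, 'e::euclidean_space) control_problem \<Rightarrow> bool" where
  "smooth_data P \<longleftrightarrow>
     (\<forall>t<horizon P.
        (\<forall>w\<in>Wsp P (Suc t). C1_on (Xsp P t \<times> Usp P t) (\<lambda>(x, u). dyn P t x u w)) \<and>
        (\<forall>w\<in>Wsp P (Suc t). C1_on (Xsp P t \<times> Usp P t) (\<lambda>(x, u). cost P t x u w)) \<and>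
        normal_integrand (restrict_space borel (Wsp P (Suc t))) (Xsp P t \<times> Usp P t)
          (\<lambda>w (x, u). cost P t x u w) \<and>
        (\<forall>b\<in>Xcoord P (Suc t).
           normal_integrand (restrict_space borel (Wsp P (Suc t))) (Xsp P t \<times> Usp P t)
             (\<lambda>w (x, u). dyn P t x u w \<bullet> b))) \<and>
     C1_on (Xsp P (horizon P)) (final_cost P)"

definition markovian :: "('a, 'e::euclidean_space) control_problem \<Rightarrow> bool" where
  "markovian P \<longleftrightarrow>
     (\<forall>t\<le>horizon P. sets (obs_alg P t) = sets (noise_alg P t)) \<and>
     prob_space.indep_vars (prob P) (\<lambda>_. borel) (noise P) {..horizon P} \<and>
     (\<forall>t<horizon P. \<exists>C\<subseteq>Usp P t. AE \<omega> in prob P. constr P t \<omega> = C)"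

definition optimality_conditions ::
  "('a, 'e::euclidean_space) control_problem \<Rightarrow>
     (nat \<Rightarrow> 'a \<Rightarrow> 'e) \<Rightarrow> (nat \<Rightarrow> 'a \<Rightarrow> 'e) \<Rightarrow> (nat \<Rightarrow> 'a \<Rightarrow> 'e) \<Rightarrow> bool" where
  "optimality_conditions P u x l \<longleftrightarrow>
     state_eqs P u x \<and> costate_eqs P u x l \<and>
     (\<forall>t<horizon P.
        (\<lambda>\<omega>. - vec_cond_exp (prob P) (obs_alg P t) (Ucoord P t) (control_grad P u x l t) \<omega>)
          \<in> subdiff_indicator (prob P) (Usp P t) (Uas P t) (u t))"

text \<open>The tuple \<open>(x\<^sub>t, w\<^sub>t\<^sub>+\<^sub>1, \<dots>, w\<^sub>T)\<close>, as a random element of the product indexed by \<open>{t..T}\<close>.\<close>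

definition state_and_future_noise ::
  "('a, 'e::euclidean_space) control_problem \<Rightarrow> (nat \<Rightarrow> 'a \<Rightarrow> 'e) \<Rightarrow> nat \<Rightarrow> 'a \<Rightarrow> nat \<Rightarrow> 'e" where
  "state_and_future_noise P x t \<omega> =
     (\<lambda>s\<in>{t..horizon P}. if s = t then x t \<omega> else noise P s \<omega>)"

definition costate_measurability ::
  "('a, 'e::euclidean_space) control_problem \<Rightarrow>
     (nat \<Rightarrow> 'a \<Rightarrow> 'e) \<Rightarrow> (nat \<Rightarrow> 'a \<Rightarrow> 'e) \<Rightarrow> nat \<Rightarrow> bool" where
  "costate_measurability P x l t \<longleftrightarrow>
     precedes (prob P) (PiM {Suc t..horizon P} (\<lambda>_. borel)) (l (Suc t))
       (state_and_future_noise P x (Suc t))"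

definition markov_cond_exp ::
  "('a, 'e::euclidean_space) control_problem \<Rightarrow>
     (nat \<Rightarrow> 'a \<Rightarrow> 'e) \<Rightarrow> (nat \<Rightarrow> 'a \<Rightarrow> 'e) \<Rightarrow> (nat \<Rightarrow> 'a \<Rightarrow> 'e) \<Rightarrow> nat \<Rightarrow> bool" where
  "markov_cond_exp P u x l t \<longleftrightarrow>
     (AE \<omega> in prob P.
        vec_cond_exp (prob P) (noise_alg P t) (Ucoord P t) (control_grad P u x l t) \<omega> =
        vec_cond_exp (prob P) (sigma_gen (prob P) borel (x t)) (Ucoord P t)
          (control_grad P u x l t) \<omega>)"

text \<open>Solutions need not be unique, and a given one need not satisfy \<open>u\<^sub>t \<preceq> x\<^sub>t\<close>: with zero costs and
  \<open>dyn P t x u w = w\<close> every feasible pair is a solution, e.g. one with \<open>u\<^sub>1 = w\<^sub>0\<close> while \<open>x\<^sub>1 = w\<^sub>1\<close> is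
  independent of \<open>w\<^sub>0\<close>. So the feedback property can only be claimed of a suitable solution,
  whereas the optimality conditions hold for each one.\<close>

end

theory Submission
  imports Defs
begin

text \<open>
  The gradient of the total cost in \<open>u\<^sub>t\<close> is the expression in the co-state, by the chain rule along the
  trajectory. Perturbing the optimal \<open>u\<^sub>t\<close> towards an \<open>\<F>\<^sub>t\<close>-measurable admissible \<open>v\<close> gives a variational
  inequality; conditioning extends it to all admissible \<open>v\<close>, because \<open>\<Gamma>\<^sub>t\<close> is deterministic, closed and
  convex and so contains the values of \<open>E(v | \<F>\<^sub>t)\<close>. For a feedback control the gradient is a function of
  \<open>x\<^sub>t\<close> and of the future noise, which is independent of \<open>\<F>\<^sub>t\<close>, whence the Markov property.

  A solution in feedback form is built backwards in time. If the controls after \<open>t\<close> are feedbacks, the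
  expected cost from \<open>t\<close> on is the mean of a function \<open>Q(x\<^sub>t, u\<^sub>t)\<close>. By optimality \<open>u\<^sub>t\<close> almost surely
  attains the best value of \<open>Q(x\<^sub>t, \<cdot>)\<close>, and a measurable selection from a set charged by the law of
  \<open>(x\<^sub>t, u\<^sub>t)\<close>, built on inner regularity, replaces \<open>u\<^sub>t\<close> by a function of \<open>x\<^sub>t\<close> with the same cost.
\<close>

section \<open>Derivatives on coordinate subspaces\<close>

text \<open>Two obstacles shape the proof. Integrability is scarce: only the total cost is known to
  be integrable, nothing dominates its difference quotients, and changing one control can push the
  later feedbacks out of L2. So differences of costs are integrated instead of costs, domination is
  extracted from the square integrability hypotheses themselves, and a second quantity, the
  conditional mean of the squared norms of all later controls, must be kept finite by every
  selection. Moreover, no value function is formed, because the infimum of \<open>Q(x, .)\<close>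
  need not be attained. The given solution is only compared with selections from countably many
  sets, each with a rational bound on the cost and an integer bound on the norm. The co-state
  recursion keeps the control value fixed, so one process has two descriptions: along open-loop
  controls it is the gradient of the cost, along a feedback it is a function of the state and the
  later noise. The first-order condition uses the former, (a) and (c) use the latter.\<close>

definition proj :: "'e::euclidean_space set \<Rightarrow> 'e \<Rightarrow> 'e" where
  "proj B x = (\<Sum>b\<in>B. (x \<bullet> b) *\<^sub>R b)"

lemma proj_in_span: "proj B x \<in> span B"
  unfolding proj_def by (intro span_sum span_scale span_base)

lemma proj_measurable [measurable]: "proj B \<in> borel_measurable borel"
  unfolding proj_def by measurable

lemma linear_proj: "linear (proj B)"
  by (auto intro!: linearI simp: proj_def inner_add_left scaleR_add_left sum.distrib scaleR_sum_right)

lemma proj_0 [simp]: "proj B 0 = 0"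
  using linear_0[OF linear_proj] .

lemma proj_add: "proj B (x + y) = proj B x + proj B y"
  using linear_add[OF linear_proj] .

lemma proj_scaleR: "proj B (c *\<^sub>R x) = c *\<^sub>R proj B x"
  using linear_cmul[OF linear_proj] .

lemma proj_diff: "proj B (x - y) = proj B x - proj B y"
  using linear_diff[OF linear_proj] .

lemma inner_proj:
  assumes "B \<subseteq> Basis" "b \<in> Basis"
  shows "proj B x \<bullet> b = (if b \<in> B then x \<bullet> b else 0)"
proof -
  have fin: "finite B" using assms finite_Basis finite_subset by blast
  have "proj B x \<bullet> b = (\<Sum>c\<in>B. if c = b then x \<bullet> c else 0)"
    unfolding proj_def inner_sum_left
    using assms by (intro sum.cong) (auto simp: inner_Basis subset_eq)
  then show ?thesis using fin by simp
qed

lemma proj_id: assumes "B \<subseteq> Basis" "x \<in> span B" shows "proj B x = x"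
  using assms(2)
proof (induction rule: span_induct)
  show "subspace {x. proj B x = x}"
    by (simp add: subspace_def proj_add proj_scaleR)
next
  fix b assume "b \<in> B"
  then show "proj B b = b"
    using assms(1) by (subst euclidean_eq_iff) (auto simp: inner_proj inner_Basis subset_eq)
qed

lemma proj_idem [simp]: "B \<subseteq> Basis \<Longrightarrow> proj B (proj B x) = proj B x"
  by (rule proj_id[OF _ proj_in_span])

lemma inner_proj_left:
  assumes "B \<subseteq> Basis" shows "proj B x \<bullet> y = x \<bullet> proj B y"
  unfolding proj_def inner_sum_left inner_sum_right
  by (intro sum.cong refl) (simp only: inner_scaleR_left inner_scaleR_right inner_commute mult.commute)

text \<open>The residual \<open>x - proj B x\<close> is orthogonal to \<open>span B\<close>, so
  Pythagoras makes \<open>proj B x\<close> the nearest point. This turns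
  \<open>closest_point\<close> in the definitions into an explicit linear and measurable
  map.\<close>

lemma closest_point_span: 
  assumes "B \<subseteq> Basis" shows "closest_point (span B) = proj B"
proof
  fix x
  have "proj B x = closest_point (span B) x"
  proof (rule closest_point_unique)
    show "convex (span B)" "closed (span B)" "proj B x \<in> span B"
      by (auto simp: subspace_imp_convex proj_in_span)
    show "\<forall>z\<in>span B. dist x (proj B x) \<le> dist x z"
    proof
      fix z assume z: "z \<in> span B"
      have "(x - proj B x) \<bullet> (proj B x - z) = 0"
      proof -
        have "(x - proj B x) \<bullet> proj B y = 0" for y
          using inner_proj_left[OF assms, of "x - proj B x" y]
            assms by (simp add: proj_diff)
        from this[of "x - z"] show ?thesis
          using z assms by (simp add: proj_id proj_diff)
      qed
      then have "(norm (x - z))\<^sup>2 = (norm (x - proj B x))\<^sup>2 + (norm (proj B x - z))\<^sup>2"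
        using norm_add_Pythagorean[of "x - proj B x" "proj B x - z"]
        by (simp add: orthogonal_def)
      then have "(norm (x - proj B x))\<^sup>2 \<le> (norm (x - z))\<^sup>2" by simp
      then show "dist x (proj B x) \<le> dist x z"
        unfolding dist_norm by (rule power2_le_imp_le) simp
    qed
  qed
  then show "closest_point (span B) x = proj B x" by simp
qed

text \<open>A proper subspace has empty interior, so a derivative within it is not unique on the
  ambient space. Along a line inside \<open>S\<close> it becomes an ordinary derivative in one real
  variable, which is unique.\<close>

lemma has_derivative_along_line:
  fixes g :: "'b::euclidean_space \<Rightarrow> 'c::euclidean_space"
  assumes "(g has_derivative g') (at x within S)" "subspace S" "x \<in> S" "h \<in> S"
  shows "((\<lambda>r. g (x + r *\<^sub>R h)) has_vector_derivative g' h) (at 0)"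
proof -
  have sub: "range (\<lambda>r. x + r *\<^sub>R h) \<subseteq> S"
    using assms by (auto intro: subspace_add subspace_scale)
  have "((\<lambda>r. g (x + r *\<^sub>R h)) has_derivative (\<lambda>r. g' (r *\<^sub>R h))) (at 0)"
  proof (rule has_derivative_in_compose[where f = "\<lambda>r. x + r *\<^sub>R h"])
    show "((\<lambda>r. x + r *\<^sub>R h) has_derivative (\<lambda>r. r *\<^sub>R h)) (at 0)"
      by (auto intro!: derivative_eq_intros)
    show "(g has_derivative g') (at (x + 0 *\<^sub>R h) within range (\<lambda>r. x + r *\<^sub>R h))"
      using has_derivative_subset[OF assms(1) sub] by simp
  qed
  moreover have "g' (r *\<^sub>R h) = r *\<^sub>R g' h" for r
    using assms(1) has_derivative_linear linear_cmul by blast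
  ultimately show ?thesis by (simp add: has_vector_derivative_def)
qed

text \<open>\<open>frechet_derivative\<close> is a choice among derivatives that may differ off
  \<open>span B\<close>; all of them agree along lines inside \<open>span B\<close>, and
  \<open>proj B h\<close> is such a direction.\<close>

lemma deriv_on_eq:
  fixes g :: "'b::euclidean_space \<Rightarrow> 'c::euclidean_space"
  assumes "(g has_derivative g') (at x within span B)" "B \<subseteq> Basis" "x \<in> span B"
  shows "deriv_on (span B) g x h = g' (proj B h)"
proof -
  have "(g has_derivative frechet_derivative g (at x within span B)) (at x within span B)"
    using assms(1) frechet_derivative_works differentiableI by blast
  then have "frechet_derivative g (at x within span B) (proj B h) = g' (proj B h)"
    using has_derivative_along_line[OF _ subspace_span assms(3) proj_in_span] assms(1)
    by (meson vector_derivative_unique_at)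
  then show ?thesis
    by (simp only: deriv_on_def closest_point_span[OF assms(2)])
qed

text \<open>Precomposing with \<open>proj B\<close> is harmless because \<open>g\<close> and its
  composite with \<open>proj B\<close> coincide on \<open>span B\<close>.\<close>

lemma has_derivative_deriv_on:
  fixes g :: "'b::euclidean_space \<Rightarrow> 'c::euclidean_space"
  assumes "g differentiable (at x within span B)" "B \<subseteq> Basis" "x \<in> span B"
  shows "(g has_derivative deriv_on (span B) g x) (at x within span B)"
proof -
  have *: "(g has_derivative frechet_derivative g (at x within span B)) (at x within span B)"
    using assms(1) frechet_derivative_works by blast
  have "((\<lambda>y. g (proj B y)) has_derivative (\<lambda>h. frechet_derivative g (at x within span B) (proj B h)))
      (at x within span B)"
  proof (rule has_derivative_in_compose[where f = "proj B"])
    show "(proj B has_derivative proj B) (at x within span B)"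
      by (rule linear_imp_has_derivative[OF linear_proj])
    have "proj B ` span B \<subseteq> span B" using proj_in_span by blast
    then show "(g has_derivative frechet_derivative g (at x within span B))
        (at (proj B x) within proj B ` span B)"
      unfolding proj_id[OF assms(2,3)] by (rule has_derivative_subset[OF *])
  qed
  then have "(g has_derivative (\<lambda>h. frechet_derivative g (at x within span B) (proj B h)))
      (at x within span B)"
    by (rule has_derivative_transform[OF assms(3), rotated]) (simp add: proj_id[OF assms(2)])
  then show ?thesis
    unfolding deriv_on_def closest_point_span[OF assms(2)] .
qed

lemma linear_deriv_on:
  assumes "g differentiable (at x within span B)" "B \<subseteq> Basis" "x \<in> span B"
  shows "linear (deriv_on (span B) g x)"
  using has_derivative_deriv_on[OF assms] has_derivative_linear by blast

lemma has_vector_derivative_LIMSEQ: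
  fixes f :: "real \<Rightarrow> 'c::real_normed_vector"
  assumes "(f has_vector_derivative d) (at 0)"
  shows "(\<lambda>n. real (Suc n) *\<^sub>R (f (1 / real (Suc n)) - f 0)) \<longlonglongrightarrow> d"
proof -
  have "((\<lambda>y. (f y - f 0 - y *\<^sub>R d) /\<^sub>R \<bar>y\<bar>) \<longlongrightarrow> 0) (at 0)"
    using assms by (simp add: has_vector_derivative_def has_derivative_at_within)
  moreover have "filterlim (\<lambda>n. 1 / real (Suc n)) (at 0) sequentially"
    by (rule filterlim_atI) (use LIMSEQ_inverse_real_of_nat in \<open>auto simp: inverse_eq_divide\<close>)
  ultimately have "(\<lambda>n. (f (1 / real (Suc n)) - f 0 - (1 / real (Suc n)) *\<^sub>R d) /\<^sub>R \<bar>1 / real (Suc n)\<bar>) \<longlonglongrightarrow> 0"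
    by (rule filterlim_compose)
  then have "(\<lambda>n. (f (1 / real (Suc n)) - f 0 - (1 / real (Suc n)) *\<^sub>R d) /\<^sub>R \<bar>1 / real (Suc n)\<bar> + d) \<longlonglongrightarrow> 0 + d"
    by (intro tendsto_intros)
  moreover have "(f (1 / real (Suc n)) - f 0 - (1 / real (Suc n)) *\<^sub>R d) /\<^sub>R \<bar>1 / real (Suc n)\<bar> + d
      = real (Suc n) *\<^sub>R (f (1 / real (Suc n)) - f 0)" for n
    by (simp add: scaleR_diff_right)
  ultimately show ?thesis by simp
qed

text \<open>Exhibits a directional derivative as the limit of a sequence of difference quotients,
  which is how derivatives are later shown to be measurable in a parameter.\<close>

lemma deriv_on_LIMSEQ:
  fixes g :: "'b::euclidean_space \<Rightarrow> 'c::euclidean_space"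
  assumes "g differentiable (at x within span B)" "B \<subseteq> Basis" "x \<in> span B"
  shows "(\<lambda>n. real (Suc n) *\<^sub>R (g (x + (1 / real (Suc n)) *\<^sub>R proj B h) - g x))
    \<longlonglongrightarrow> deriv_on (span B) g x h"
proof -
  have "((\<lambda>r. g (x + r *\<^sub>R proj B h)) has_vector_derivative deriv_on (span B) g x (proj B h)) (at 0)"
    by (rule has_derivative_along_line[OF has_derivative_deriv_on[OF assms] _ assms(3)])
      (auto simp: proj_in_span)
  moreover have "deriv_on (span B) g x (proj B h) = deriv_on (span B) g x h"
    using assms(2) by (simp add: deriv_on_def closest_point_span)
  ultimately show ?thesis
    using has_vector_derivative_LIMSEQ[of "\<lambda>r. g (x + r *\<^sub>R proj B h)" "deriv_on (span B) g x h"]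
    by simp
qed

lemma adjoint_eq_sum:
  fixes A :: "'b::euclidean_space \<Rightarrow> 'c::euclidean_space"
  assumes "linear A" shows "adjoint A y = (\<Sum>b\<in>Basis. (y \<bullet> A b) *\<^sub>R b)"
  using assms by (subst euclidean_eq_iff) (simp add: adjoint_works adjoint_clauses)

lemma grad_on_eq_sum:
  assumes "g differentiable (at x within span B)" "B \<subseteq> Basis" "x \<in> span B"
  shows "grad_on (span B) g x = (\<Sum>b\<in>Basis. deriv_on (span B) g x b *\<^sub>R b)"
  unfolding grad_on_def adjoint_eq_sum[OF linear_deriv_on[OF assms]] by simp

lemma grad_on_eqI:
  assumes "(g has_derivative (\<lambda>h. c \<bullet> h)) (at x within span B)" "B \<subseteq> Basis" "x \<in> span B" "c \<in> span B"
  shows "grad_on (span B) g x = c"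
proof -
  have "g differentiable (at x within span B)" using assms(1) by (rule differentiableI)
  then show ?thesis
    using assms(2-) inner_proj_left[OF assms(2), of c, symmetric]
    by (simp add: grad_on_eq_sum deriv_on_eq[OF assms(1)] proj_id euclidean_representation)
qed

text \<open>A basis vector outside \<open>B\<close> is projected to \<open>0\<close>, so the
  Jacobian annihilates it and the adjoint has no component along it.\<close>

lemma adjoint_deriv_on_in_span:
  fixes g :: "'b::euclidean_space \<Rightarrow> 'c::euclidean_space"
  assumes "g differentiable (at x within span B)" "B \<subseteq> Basis" "x \<in> span B"
  shows "adjoint (deriv_on (span B) g x) y \<in> span B"
proof -
  have "adjoint (deriv_on (span B) g x) y \<bullet> b = 0" if "b \<in> Basis" "b \<notin> B" for b
  proof -
    have "proj B b = 0" using that assms(2)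
      by (subst euclidean_eq_iff) (auto simp: inner_proj inner_Basis)
    then show ?thesis using that assms deriv_on_eq[OF has_derivative_deriv_on[OF assms] assms(2,3), of b]
        linear_0[OF linear_deriv_on[OF assms]]
      by (simp add: adjoint_eq_sum[OF linear_deriv_on[OF assms]])
  qed
  then have "proj B (adjoint (deriv_on (span B) g x) y) = adjoint (deriv_on (span B) g x) y"
    using assms by (subst euclidean_eq_iff) (auto simp: inner_proj)
  then show ?thesis by (metis proj_in_span)
qed

lemma grad_on_in_span:
  assumes "g differentiable (at x within span B)" "B \<subseteq> Basis" "x \<in> span B"
  shows "grad_on (span B) g x \<in> span B"
  unfolding grad_on_def by (rule adjoint_deriv_on_in_span[OF assms])

text \<open>Strict superlevel sets are countable unions of measurable rectangles:
  \<open>g p y > a\<close> iff, for some basic open \<open>U\<close> around \<open>y\<close> and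
  some rational \<open>c > a\<close>, the epigraph of \<open>g p\<close> misses
  \<open>U \<times> {..<c}\<close>. Such a miss is a measurable condition on \<open>p\<close>,
  because hitting an open set is one.\<close>

lemma normal_integrand_measurable:
  fixes g :: "'p \<Rightarrow> 'b::euclidean_space \<Rightarrow> real"
  assumes "normal_integrand N S g"
  shows "(\<lambda>(p, y). g p y) \<in> borel_measurable (N \<Otimes>\<^sub>M restrict_space borel S)"
proof -
  obtain \<B> :: "'b set set" where B: "countable \<B>" "topological_basis \<B>"
    using ex_countable_basis by blast
  show ?thesis
  proof (rule borel_measurable_iff_greater[THEN iffD2], intro allI)
    fix a :: real
    let ?E = "\<lambda>U c. {p\<in>space N. epigraph S (g p) \<inter> U \<times> {..<c} \<noteq> {}}"
    let ?L = "\<lambda>U c. (space N - ?E U c) \<times> (S \<inter> U)"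
    have "{z \<in> space (N \<Otimes>\<^sub>M restrict_space borel S). a < (case z of (p, y) \<Rightarrow> g p y)} =
        (\<Union>U\<in>\<B>. \<Union>c\<in>{c\<in>\<rat>. c > a}. ?L U c)"
    proof (intro equalityI subsetI)
      fix z assume z: "z \<in> {z \<in> space (N \<Otimes>\<^sub>M restrict_space borel S). a < (case z of (p, y) \<Rightarrow> g p y)}"
      obtain p y where py: "z = (p, y)" "p \<in> space N" "y \<in> S" "a < g p y"
        using z by (auto simp: space_pair_measure space_restrict_space)
      obtain c where c: "c \<in> \<rat>" "a < c" "c < g p y"
        using Rats_dense_in_real[OF py(4)] by blast
      have "closed (epigraph S (g p))"
        using assms py(2) by (simp add: normal_integrand_def)
      moreover have "(y, c) \<notin> epigraph S (g p)" using c by (simp add: epigraph_def)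
      ultimately obtain U V where UV: "open U" "open V" "y \<in> U" "c \<in> V" "U \<times> V \<subseteq> - epigraph S (g p)"
        by (metis open_Compl open_prod_elim ComplI mem_Sigma_iff)
      obtain U' where U': "U' \<in> \<B>" "y \<in> U'" "U' \<subseteq> U"
        using B UV topological_basisE by metis
      \<comment> \<open>A point of the epigraph over \<open>U'\<close> below height \<open>c\<close>
        could be raised to height \<open>c\<close>, since epigraphs are closed upwards, and would
        then lie in the forbidden box \<open>U \<times> V\<close>.\<close>
      have "epigraph S (g p) \<inter> U' \<times> {..<c} = {}"
      proof (intro equals0I)
        fix q assume "q \<in> epigraph S (g p) \<inter> U' \<times> {..<c}"
        then have "(fst q, c) \<in> epigraph S (g p) \<inter> U \<times> V"
          using UV U' by (auto simp: epigraph_def)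
        then show False using UV by blast
      qed
      then show "z \<in> (\<Union>U\<in>\<B>. \<Union>c\<in>{c\<in>\<rat>. c > a}. ?L U c)"
        using py c U' by blast
    next
      fix z assume "z \<in> (\<Union>U\<in>\<B>. \<Union>c\<in>{c\<in>\<rat>. c > a}. ?L U c)"
      moreover obtain p y where "z = (p, y)" by (cases z)
      ultimately obtain U c where z: "z = (p, y)" "p \<in> space N" "y \<in> S" "y \<in> U" "a < c"
          "epigraph S (g p) \<inter> U \<times> {..<c} = {}"
        by blast
      have "(y, g p y) \<in> epigraph S (g p)" using z(3) by (simp add: epigraph_def)
      then have "c \<le> g p y" using z(4,6) by (meson IntI SigmaI disjoint_iff lessThan_iff not_less)
      then show "z \<in> {z \<in> space (N \<Otimes>\<^sub>M restrict_space borel S). a < (case z of (p, y) \<Rightarrow> g p y)}"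
        using z by (simp add: space_pair_measure space_restrict_space)
    qed
    also have "\<dots> \<in> sets (N \<Otimes>\<^sub>M restrict_space borel S)"
    proof (intro sets.countable_UN'' B countable_subset[OF _ countable_rat] pair_measureI)
      fix U c assume "U \<in> \<B>"
      then have "open U" using B topological_basis_open by blast
      then show "space N - ?E U c \<in> sets N"
        using assms by (auto simp: normal_integrand_def open_Times)
      show "S \<inter> U \<in> sets (restrict_space borel S)"
        using \<open>open U\<close> by (auto simp: sets_restrict_space)
    qed auto
    finally show "{z \<in> space (N \<Otimes>\<^sub>M restrict_space borel S). a < (case z of (p, y) \<Rightarrow> g p y)}
        \<in> sets (N \<Otimes>\<^sub>M restrict_space borel S)" .
  qed
qed

section \<open>Measurable selection, factorization and independence\<close>

text \<open>For compact \<open>K\<close> every set that has to be measurable is assembled from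
  countably many projections of compact sets, so no analytic sets occur. Compactness also keeps the
  intersection of the shrinking sections nonempty.\<close>

lemma measurable_selection_compact:
  fixes K :: "('a::euclidean_space \<times> 'b::euclidean_space) set"
  assumes "compact K"
  obtains \<phi> where "\<phi> \<in> borel_measurable borel" "\<And>x. x \<in> fst ` K \<Longrightarrow> (x, \<phi> x) \<in> K"
proof -
  obtain D :: "'b set" where D: "countable D" "\<And>U. open U \<Longrightarrow> U \<noteq> {} \<Longrightarrow> \<exists>d\<in>D. d \<in> U"
    using countable_dense_setE by blast
  have "D \<noteq> {}" using D(2)[of UNIV] by auto
  define d where "d = from_nat_into D"
  have dense: "\<exists>j. y \<in> cball (d j) e" if "e > 0" for y e
  proof -
    have "ball y e \<noteq> {}" using that by simp
    then obtain z where z: "z \<in> D" "z \<in> ball y e" using D(2)[OF open_ball] by blast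
    obtain j where "d j = z" using from_nat_into_surj[OF D(1) z(1)] by (auto simp: d_def)
    then have "y \<in> cball (d j) e" using z(2) by (simp add: dist_commute less_imp_le)
    then show ?thesis ..
  qed
  \<comment> \<open>The section of \<open>K\<close> over \<open>x\<close> is cut down to nested compact sets by balls of radius \<open>2\<^sup>-\<^sup>n\<close>
    around the points of a dense sequence; the first admissible point of the sequence is chosen each time.\<close>
  define J where "J C n x = (LEAST j. \<exists>y. (x, y) \<in> K \<and> y \<in> C \<inter> cball (d j) ((1/2)^n))"
    for C :: "'b set" and n :: nat and x
  define C where "C n x = rec_nat UNIV (\<lambda>n C. C \<inter> cball (d (J C n x)) ((1/2)^n)) n" for n x
  define j where "j n x = J (C n x) n x" for n x
  have C0: "C 0 x = UNIV" and CS: "C (Suc n) x = C n x \<inter> cball (d (j n x)) ((1/2)^n)" for n x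
    by (simp_all add: C_def j_def)
  have closedC: "closed (C n x)" for n x
    by (induction n) (auto simp: C0 CS)
  \<comment> \<open>Measurability of the hitting sets of stage \<open>n\<close> gives measurability
    of the index \<open>j n\<close>, and that index gives the hitting sets of the next stage. The
    first implication is stated separately so that the induction for \<open>meas\<close> can use
    it.\<close>
  have jm_if: "j n \<in> measurable borel (count_space UNIV)"
    if "\<And>F. closed F \<Longrightarrow> {x. \<exists>y\<in>F. (x, y) \<in> K \<and> y \<in> C n x} \<in> sets borel" for n
  proof -
    have [measurable]: "Measurable.pred borel (\<lambda>x. \<exists>y. (x, y) \<in> K \<and> y \<in> C n x \<inter> cball (d i) ((1/2)^n))" for i
    proof -
      have "{x. \<exists>y\<in>cball (d i) ((1/2)^n). (x, y) \<in> K \<and> y \<in> C n x} \<in> sets borel"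
        by (rule that) simp
      also have "{x. \<exists>y\<in>cball (d i) ((1/2)^n). (x, y) \<in> K \<and> y \<in> C n x}
        = {x\<in>space borel. \<exists>y. (x, y) \<in> K \<and> y \<in> C n x \<inter> cball (d i) ((1/2)^n)}" by auto
      finally show ?thesis by (simp add: pred_def)
    qed
    show ?thesis unfolding j_def J_def by measurable
  qed
  have meas: "{x. \<exists>y\<in>F. (x, y) \<in> K \<and> y \<in> C n x} \<in> sets borel" if "closed F" for n F
    using that
  proof (induction n arbitrary: F)
    case 0
    have "{x. \<exists>y\<in>F. (x, y) \<in> K \<and> y \<in> C 0 x} = fst ` (K \<inter> UNIV \<times> F)"
      by (force simp: C0)
    moreover have "compact (fst ` (K \<inter> UNIV \<times> F))"
      using 0 assms by (intro compact_continuous_image continuous_on_fst continuous_on_id compact_Int_closed closed_Times) auto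
    ultimately show ?case by (simp add: borel_compact)
  next
    case (Suc n)
    have [measurable]: "j n \<in> measurable borel (count_space UNIV)" by (rule jm_if[OF Suc.IH])
    have *: "(\<exists>y\<in>F. (x, y) \<in> K \<and> y \<in> C (Suc n) x) \<longleftrightarrow>
        (\<exists>y\<in>F \<inter> cball (d (j n x)) ((1/2)^n). (x, y) \<in> K \<and> y \<in> C n x)" for x
      unfolding CS by blast
    have **: "{x. \<exists>y\<in>F. (x, y) \<in> K \<and> y \<in> C (Suc n) x} =
        {x \<in> space borel. x \<in> {x. \<exists>y\<in>F \<inter> cball (d (j n x)) ((1/2)^n). (x, y) \<in> K \<and> y \<in> C n x}}"
      unfolding * by simp
    have [measurable]: "{x. \<exists>y\<in>F \<inter> cball (d i) ((1/2)^n). (x, y) \<in> K \<and> y \<in> C n x} \<in> sets borel" for i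
      using Suc.prems by (intro Suc.IH closed_Int) auto
    \<comment> \<open>Beyond \<open>C n x\<close>, the set \<open>C (Suc n) x\<close> depends on
      \<open>x\<close> only through the index \<open>j n x\<close>. Splitting over its countably
      many values leaves the induction hypothesis for a smaller closed set.\<close>
    have "Measurable.pred borel (\<lambda>x. \<exists>i. j n x = i \<and> x \<in> {x. \<exists>y\<in>F \<inter> cball (d i) ((1/2)^n). (x, y) \<in> K \<and> y \<in> C n x})"
      by measurable
    then show ?case unfolding ** by (simp add: pred_def)
  qed
  have [measurable]: "j n \<in> measurable borel (count_space UNIV)" for n by (rule jm_if[OF meas])
  define \<phi> where "\<phi> x = lim (\<lambda>n. d (j n x))" for x
  have "\<phi> \<in> borel_measurable borel"
    unfolding \<phi>_def by measurable
  moreover have "(x, \<phi> x) \<in> K" if x: "x \<in> fst ` K" for x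
  proof -
    have ne: "{y. (x, y) \<in> K} \<inter> C n x \<noteq> {}" for n
    proof (induction n)
      case 0
      then show ?case using x by (auto simp: C0)
    next
      case (Suc n)
      then obtain y where y: "(x, y) \<in> K" "y \<in> C n x" by blast
      obtain i where "y \<in> cball (d i) ((1/2)^n)" using dense[of "(1/2)^n" y] by auto
      then have "\<exists>i. \<exists>y. (x, y) \<in> K \<and> y \<in> C n x \<inter> cball (d i) ((1/2)^n)"
        using y by blast
      then have "\<exists>y. (x, y) \<in> K \<and> y \<in> C n x \<inter> cball (d (j n x)) ((1/2)^n)"
        unfolding j_def J_def by (rule LeastI_ex)
      then show ?case by (auto simp: CS)
    qed
    have "compact {y. (x, y) \<in> K}"
    proof -
      have "{y. (x, y) \<in> K} = snd ` (K \<inter> {x} \<times> UNIV)" by force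
      moreover have "compact \<dots>"
        using assms by (intro compact_continuous_image continuous_on_snd continuous_on_id compact_Int_closed closed_Times) auto
      ultimately show ?thesis by simp
    qed
    then have "compact ({y. (x, y) \<in> K} \<inter> C n x)" for n
      using closedC by (rule compact_Int_closed)
    moreover have "C n x \<subseteq> C m x" if "m \<le> n" for m n
      using that by (induction rule: dec_induct) (auto simp: CS)
    ultimately have "\<Inter>(range (\<lambda>n. {y. (x, y) \<in> K} \<inter> C n x)) \<noteq> {}"
      using ne by (intro compact_nest) blast+
    then obtain y where y: "(x, y) \<in> K" "\<And>n. y \<in> C n x" by blast
    have le: "dist (d (j n x)) y \<le> (1/2)^n" for n
      using y(2)[of "Suc n"] by (simp add: CS)
    have "\<forall>\<^sub>F n in sequentially. 0 \<le> dist (d (j n x)) y"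
      by (rule always_eventually[OF allI[OF zero_le_dist]])
    moreover have "\<forall>\<^sub>F n in sequentially. dist (d (j n x)) y \<le> (1/2)^n"
      by (rule always_eventually[OF allI[OF le]])
    moreover have "(\<lambda>n. (1/2::real)^n) \<longlonglongrightarrow> 0" by (rule LIMSEQ_realpow_zero) auto
    ultimately have "(\<lambda>n. dist (d (j n x)) y) \<longlonglongrightarrow> 0"
      by (rule tendsto_sandwich[OF _ _ tendsto_const])
    then have "(\<lambda>n. d (j n x)) \<longlonglongrightarrow> y" by (rule tendsto_dist_iff[THEN iffD2])
    then show ?thesis using y(1) by (simp add: \<phi>_def limI)
  qed
  ultimately show ?thesis using that by blast
qed

text \<open>Inner regularity exhausts \<open>S\<close> by compact sets up to a
  \<open>\<mu>\<close>-null set, and each of them admits a selection. The base set \<open>A\<close>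
  is the union of their projections; the projection of \<open>S\<close> itself need not be
  Borel.\<close>

lemma measurable_selection_AE:
  fixes S :: "('a::euclidean_space \<times> 'b::euclidean_space) set"
  assumes "finite_measure \<mu>" "sets \<mu> = sets borel" "S \<in> sets borel"
  obtains A \<phi> where "A \<in> sets borel" "\<phi> \<in> borel_measurable borel"
    "\<And>x. x \<in> A \<Longrightarrow> (x, \<phi> x) \<in> S" "AE p in \<mu>. p \<in> S \<longrightarrow> fst p \<in> A"
proof -
  interpret finite_measure \<mu> by fact
  have S: "S \<in> sets \<mu>" using assms by simp
  have "\<exists>K. compact K \<and> K \<subseteq> S \<and> measure \<mu> S - 1 / real (Suc n) < measure \<mu> K" for n
  proof -
    have SUP: "emeasure \<mu> S = (SUP K \<in> {K. K \<subseteq> S \<and> compact K}. emeasure \<mu> K)"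
      using assms by (intro inner_regular) auto
    show ?thesis
    \<comment> \<open>\<open>ennreal\<close> sends negative numbers to \<open>0\<close>, so for a
      null set the strict inequality used in the other case would fail; the empty set serves
      there.\<close>
    proof (cases "measure \<mu> S = 0")
      case True
      then show ?thesis by (intro exI[of _ "{}"]) simp
    next
      case False
      then have "ennreal (measure \<mu> S - 1 / real (Suc n)) < ennreal (measure \<mu> S)"
        by (intro ennreal_lessI) (simp_all add: zero_less_measure_iff)
      then have "ennreal (measure \<mu> S - 1 / real (Suc n)) < (SUP K \<in> {K. K \<subseteq> S \<and> compact K}. emeasure \<mu> K)"
        using SUP by (simp add: emeasure_eq_measure)
      then obtain K where "K \<subseteq> S" "compact K" "ennreal (measure \<mu> S - 1 / real (Suc n)) < emeasure \<mu> K"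
        by (auto simp: less_SUP_iff)
      then show ?thesis
        by (intro exI[of _ K]) (metis emeasure_eq_measure ennreal_leI not_le)
    qed
  qed
  then obtain K where K: "\<And>n. compact (K n)" "\<And>n. K n \<subseteq> S"
      "\<And>n. measure \<mu> S - 1 / real (Suc n) < measure \<mu> (K n)" by metis
  have "\<exists>\<phi>. \<phi> \<in> borel_measurable borel \<and> (\<forall>x\<in>fst ` K n. (x, \<phi> x) \<in> K n)" for n
    using measurable_selection_compact[OF K(1)] by metis
  then obtain \<psi> where \<psi>: "\<And>n. \<psi> n \<in> borel_measurable borel"
    "\<And>n x. x \<in> fst ` K n \<Longrightarrow> (x, \<psi> n x) \<in> K n" by metis
  have [measurable]: "fst ` K n \<in> sets borel" for n
    by (intro borel_compact compact_continuous_image continuous_on_fst continuous_on_id K)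
  have [measurable]: "K n \<in> sets \<mu>" for n using K assms by (simp add: borel_compact)
  note \<psi>(1)[measurable]
  define \<phi> where "\<phi> x = \<psi> (LEAST n. x \<in> fst ` K n) x" for x
  show thesis
  proof (rule that)
    show "(\<Union>n. fst ` K n) \<in> sets borel" by measurable
    show "\<phi> \<in> borel_measurable borel" unfolding \<phi>_def by measurable
    show "(x, \<phi> x) \<in> S" if "x \<in> (\<Union>n. fst ` K n)" for x
    proof -
      have "\<exists>n. x \<in> fst ` K n" using that by blast
      then have "x \<in> fst ` K (LEAST n. x \<in> fst ` K n)" by (rule LeastI_ex)
      then have "(x, \<phi> x) \<in> K (LEAST n. x \<in> fst ` K n)" unfolding \<phi>_def by (rule \<psi>(2))
      then show ?thesis using K(2) by blast
    qed
    have "measure \<mu> (S - (\<Union>n. K n)) \<le> 1 / real (Suc n)" for n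
    proof -
      have "measure \<mu> (S - (\<Union>n. K n)) \<le> measure \<mu> (S - K n)"
        using S by (intro finite_measure_mono) auto
      also have "\<dots> = measure \<mu> S - measure \<mu> (K n)"
        using S K by (intro finite_measure_Diff) auto
      finally show ?thesis using K(3)[of n] by simp
    qed
    then have "measure \<mu> (S - (\<Union>n. K n)) \<le> 0"
      using LIMSEQ_inverse_real_of_nat
      by (intro LIMSEQ_le_const[of "\<lambda>n. 1 / real (Suc n)"]) (auto simp: inverse_eq_divide)
    then have "emeasure \<mu> (S - (\<Union>n. K n)) = 0"
      by (simp add: emeasure_eq_measure measure_le_0_iff)
    then have "AE p in \<mu>. p \<notin> S - (\<Union>n. K n)"
      using S by (intro AE_not_in) (auto simp: null_sets_def)
    then show "AE p in \<mu>. p \<in> S \<longrightarrow> fst p \<in> (\<Union>n. fst ` K n)"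
      by eventually_elim blast
  qed
qed

text \<open>Doob-Dynkin: the sublevel sets of \<open>f\<close> are preimages under \<open>g\<close>,
  and \<open>f\<close> is recovered from them as the infimum of the rational levels above
  it.\<close>

lemma real_factor_through:
  fixes f :: "'a \<Rightarrow> real"
  assumes "f \<in> borel_measurable (vimage_algebra \<Omega> g N)" "g \<in> \<Omega> \<rightarrow> space N"
  obtains h where "h \<in> borel_measurable N" "\<And>\<omega>. \<omega> \<in> \<Omega> \<Longrightarrow> f \<omega> = h (g \<omega>)"
proof -
  have "\<exists>A. A \<in> sets N \<and> {\<omega>\<in>\<Omega>. f \<omega> < q} = g -` A \<inter> \<Omega>" for q
  proof -
    have "{\<omega>\<in>space (vimage_algebra \<Omega> g N). f \<omega> < q} \<in> sets (vimage_algebra \<Omega> g N)"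
      using assms(1) by measurable
    then show ?thesis using sets_vimage_algebra2[OF assms(2)] by auto
  qed
  then obtain A where A: "\<And>q. A q \<in> sets N" "\<And>q. {\<omega>\<in>\<Omega>. f \<omega> < q} = g -` A q \<inter> \<Omega>"
    by metis
  note A(1)[measurable]
  \<comment> \<open>Off the range of \<open>g\<close> this infimum is arbitrary and possibly
    infinite, hence the extended reals; on the range it equals \<open>f\<close>.\<close>
  define h where "h y = (INF q\<in>\<rat>. if y \<in> A q then ereal q else \<infinity>)" for y
  show ?thesis
  proof (rule that)
    show "(\<lambda>y. real_of_ereal (h y)) \<in> borel_measurable N"
      unfolding h_def using countable_rat by measurable
    fix \<omega> assume \<omega>: "\<omega> \<in> \<Omega>"
    have iff: "g \<omega> \<in> A q \<longleftrightarrow> f \<omega> < q" for q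
      using A(2)[of q] \<omega> by blast
    have "h (g \<omega>) = ereal (f \<omega>)"
    proof (rule antisym)
      show "ereal (f \<omega>) \<le> h (g \<omega>)"
        unfolding h_def by (intro INF_greatest) (auto simp: iff)
      show "h (g \<omega>) \<le> ereal (f \<omega>)"
      proof (rule ccontr)
        assume "\<not> h (g \<omega>) \<le> ereal (f \<omega>)"
        then have "ereal (f \<omega>) < h (g \<omega>)" by simp
        then obtain r :: rat where r: "ereal (f \<omega>) < real_of_rat r" "real_of_rat r < h (g \<omega>)"
          using ereal_dense3 by blast
        have "h (g \<omega>) \<le> (if g \<omega> \<in> A (real_of_rat r) then ereal (real_of_rat r) else \<infinity>)"
          unfolding h_def by (rule INF_lower) simp
        with r show False by (simp add: iff)
      qed
    qed
    then show "f \<omega> = real_of_ereal (h (g \<omega>))" by simp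
  qed
qed

lemma factor_through:
  fixes f :: "'a \<Rightarrow> 'e::euclidean_space"
  assumes "f \<in> borel_measurable (vimage_algebra \<Omega> g N)" "g \<in> \<Omega> \<rightarrow> space N"
  obtains h where "h \<in> borel_measurable N" "\<And>\<omega>. \<omega> \<in> \<Omega> \<Longrightarrow> f \<omega> = h (g \<omega>)"
proof -
  have "\<exists>h. h \<in> borel_measurable N \<and> (\<forall>\<omega>\<in>\<Omega>. f \<omega> \<bullet> b = h (g \<omega>))" for b
  proof -
    have "(\<lambda>\<omega>. f \<omega> \<bullet> b) \<in> borel_measurable (vimage_algebra \<Omega> g N)"
      using assms(1) by measurable
    then show ?thesis by (rule real_factor_through[OF _ assms(2)]) blast
  qed
  then obtain h where h: "\<And>b. h b \<in> borel_measurable N" "\<And>b \<omega>. \<omega> \<in> \<Omega> \<Longrightarrow> f \<omega> \<bullet> b = h b (g \<omega>)"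
    by metis
  note h(1)[measurable]
  show ?thesis
  proof (rule that)
    show "(\<lambda>y. \<Sum>b\<in>Basis. h b y *\<^sub>R b) \<in> borel_measurable N" by measurable
    show "f \<omega> = (\<Sum>b\<in>Basis. h b (g \<omega>) *\<^sub>R b)" if "\<omega> \<in> \<Omega>" for \<omega>
      using h(2)[OF that] euclidean_representation[of "f \<omega>"] by simp
  qed
qed

text \<open>Unlike \<^const>\<open>prob_space.indep_var\<close>, this allows the two random elements to have different
  types; \<open>F\<close> may be a sub-\<open>\<sigma>\<close>-algebra of \<open>M\<close>, with \<open>X\<close> the identity.\<close>

definition indep_pair :: "'a measure \<Rightarrow> 'b measure \<Rightarrow> ('a \<Rightarrow> 'b) \<Rightarrow> 'c measure \<Rightarrow> ('a \<Rightarrow> 'c) \<Rightarrow> bool" where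
  "indep_pair M F X K Z \<longleftrightarrow> X \<in> M \<rightarrow>\<^sub>M F \<and> Z \<in> M \<rightarrow>\<^sub>M K \<and>
     (\<forall>A\<in>sets F. \<forall>B\<in>sets K. measure M (X -` A \<inter> Z -` B \<inter> space M) =
        measure M (X -` A \<inter> space M) * measure M (Z -` B \<inter> space M))"

section \<open>Integrating out an independent random element\<close>

context prob_space begin

lemma indep_pairD_distr:
  assumes "indep_pair M F X K Z"
  shows "X \<in> M \<rightarrow>\<^sub>M F" "Z \<in> M \<rightarrow>\<^sub>M K"
    "distr M (F \<Otimes>\<^sub>M K) (\<lambda>\<omega>. (X \<omega>, Z \<omega>)) = distr M F X \<Otimes>\<^sub>M distr M K Z"
proof -
  show [measurable]: "X \<in> M \<rightarrow>\<^sub>M F" "Z \<in> M \<rightarrow>\<^sub>M K"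
    using assms by (auto simp: indep_pair_def)
  interpret Z: prob_space "distr M K Z" by (rule prob_space_distr) measurable
  interpret X: prob_space "distr M F X" by (rule prob_space_distr) measurable
  show "distr M (F \<Otimes>\<^sub>M K) (\<lambda>\<omega>. (X \<omega>, Z \<omega>)) = distr M F X \<Otimes>\<^sub>M distr M K Z"
  proof (rule pair_measure_eqI[symmetric])
    show "sigma_finite_measure (distr M F X)" "sigma_finite_measure (distr M K Z)" ..
    show "sets (distr M F X \<Otimes>\<^sub>M distr M K Z) = sets (distr M (F \<Otimes>\<^sub>M K) (\<lambda>\<omega>. (X \<omega>, Z \<omega>)))"
      by (simp cong: sets_pair_measure_cong)
    fix A B assume AB: "A \<in> sets (distr M F X)" "B \<in> sets (distr M K Z)"
    then have [measurable]: "A \<in> sets F" "B \<in> sets K" by auto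
    have "(\<lambda>\<omega>. (X \<omega>, Z \<omega>)) -` (A \<times> B) \<inter> space M = X -` A \<inter> Z -` B \<inter> space M" by auto
    then show "emeasure (distr M F X) A * emeasure (distr M K Z) B
        = emeasure (distr M (F \<Otimes>\<^sub>M K) (\<lambda>\<omega>. (X \<omega>, Z \<omega>))) (A \<times> B)"
      using assms by (simp add: emeasure_distr emeasure_eq_measure indep_pair_def ennreal_mult)
  qed
qed

lemma indep_pair_if_indep_var:
  assumes "indep_var F X K Z" shows "indep_pair M F X K Z"
proof -
  have [measurable]: "X \<in> M \<rightarrow>\<^sub>M F" "Z \<in> M \<rightarrow>\<^sub>M K"
    using assms by (auto dest: indep_var_rv1 indep_var_rv2)
  have "indep_set (sigma_sets (space M) {X -` A \<inter> space M |A. A \<in> sets F})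
      (sigma_sets (space M) {Z -` A \<inter> space M |A. A \<in> sets K})"
    using assms by (simp add: indep_var_eq)
  then have "prob ((X -` A \<inter> space M) \<inter> (Z -` B \<inter> space M)) = prob (X -` A \<inter> space M) * prob (Z -` B \<inter> space M)"
    if "A \<in> sets F" "B \<in> sets K" for A B
    by (rule indep_setD) (use that in auto)
  moreover have "(X -` A \<inter> space M) \<inter> (Z -` B \<inter> space M) = X -` A \<inter> Z -` B \<inter> space M" for A B
    by blast
  ultimately show ?thesis by (simp add: indep_pair_def)
qed

text \<open>The joint law is a product, so Tonelli integrates \<open>Z\<close> out with
  \<open>X\<close> frozen. It is applied to tail norms, whose integrability is not known in
  advance.\<close>

lemma freezing_nn_integral:
  assumes ind: "indep_pair M F X K Z" and h [measurable]: "h \<in> borel_measurable (F \<Otimes>\<^sub>M K)"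
  shows "(\<integral>\<^sup>+\<omega>. h (X \<omega>, Z \<omega>) \<partial>M) = (\<integral>\<^sup>+\<omega>. \<integral>\<^sup>+z. h (X \<omega>, z) \<partial>distr M K Z \<partial>M)"
proof -
  have [measurable]: "X \<in> M \<rightarrow>\<^sub>M F" "Z \<in> M \<rightarrow>\<^sub>M K"
    using indep_pairD_distr[OF ind] by simp_all
  interpret Z: prob_space "distr M K Z" by (rule prob_space_distr) measurable
  have "(\<integral>\<^sup>+\<omega>. h (X \<omega>, Z \<omega>) \<partial>M) = (\<integral>\<^sup>+p. h p \<partial>distr M (F \<Otimes>\<^sub>M K) (\<lambda>\<omega>. (X \<omega>, Z \<omega>)))"
    by (subst nn_integral_distr) auto
  also have "\<dots> = (\<integral>\<^sup>+p. h p \<partial>(distr M F X \<Otimes>\<^sub>M distr M K Z))"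
    using indep_pairD_distr[OF ind] by simp
  also have "\<dots> = (\<integral>\<^sup>+x. \<integral>\<^sup>+z. h (x, z) \<partial>distr M K Z \<partial>distr M F X)"
    by (subst Z.nn_integral_fst[symmetric]) auto
  also have "\<dots> = (\<integral>\<^sup>+\<omega>. \<integral>\<^sup>+z. h (X \<omega>, z) \<partial>distr M K Z \<partial>M)"
    by (subst nn_integral_distr) auto
  finally show ?thesis .
qed

lemma freezing_integral:
  fixes h :: "'b \<times> 'c \<Rightarrow> real"
  assumes ind: "indep_pair M F X K Z" and h [measurable]: "h \<in> borel_measurable (F \<Otimes>\<^sub>M K)"
    and int: "integrable M (\<lambda>\<omega>. h (X \<omega>, Z \<omega>))"
  shows "AE \<omega> in M. integrable (distr M K Z) (\<lambda>z. h (X \<omega>, z))"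
    and "integrable M (\<lambda>\<omega>. \<integral>z. h (X \<omega>, z) \<partial>distr M K Z)"
    and "(\<integral>\<omega>. h (X \<omega>, Z \<omega>) \<partial>M) = (\<integral>\<omega>. \<integral>z. h (X \<omega>, z) \<partial>distr M K Z \<partial>M)"
proof -
  have [measurable]: "X \<in> M \<rightarrow>\<^sub>M F" "Z \<in> M \<rightarrow>\<^sub>M K"
    using indep_pairD_distr[OF ind] by simp_all
  interpret Z: prob_space "distr M K Z" by (rule prob_space_distr) measurable
  interpret X: prob_space "distr M F X" by (rule prob_space_distr) measurable
  interpret XZ: pair_prob_space "distr M F X" "distr M K Z" ..
  have eq: "distr M (F \<Otimes>\<^sub>M K) (\<lambda>\<omega>. (X \<omega>, Z \<omega>)) = distr M F X \<Otimes>\<^sub>M distr M K Z"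
    using indep_pairD_distr[OF ind] by simp
  have I: "integrable (distr M F X \<Otimes>\<^sub>M distr M K Z) h"
    using int unfolding eq[symmetric] by (subst integrable_distr_eq) auto
  have "AE x in distr M F X. integrable (distr M K Z) (\<lambda>z. h (x, z))"
    using XZ.AE_integrable_fst'[OF I] .
  then show "AE \<omega> in M. integrable (distr M K Z) (\<lambda>z. h (X \<omega>, z))"
    by (subst (asm) AE_distr_iff) auto
  show "integrable M (\<lambda>\<omega>. \<integral>z. h (X \<omega>, z) \<partial>distr M K Z)"
    using XZ.integrable_fst'[OF I] by (subst (asm) integrable_distr_eq) auto
  have "(\<integral>\<omega>. h (X \<omega>, Z \<omega>) \<partial>M) = (\<integral>p. h p \<partial>distr M (F \<Otimes>\<^sub>M K) (\<lambda>\<omega>. (X \<omega>, Z \<omega>)))"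
    by (subst integral_distr) auto
  also have "\<dots> = (\<integral>x. \<integral>z. h (x, z) \<partial>distr M K Z \<partial>distr M F X)"
    unfolding eq using XZ.integral_fst'[OF I] by simp
  also have "\<dots> = (\<integral>\<omega>. \<integral>z. h (X \<omega>, z) \<partial>distr M K Z \<partial>M)"
    by (subst integral_distr) auto
  finally show "(\<integral>\<omega>. h (X \<omega>, Z \<omega>) \<partial>M) = (\<integral>\<omega>. \<integral>z. h (X \<omega>, z) \<partial>distr M K Z \<partial>M)" .
qed

lemma subalgebra_sigma_gen: "X \<in> M \<rightarrow>\<^sub>M N \<Longrightarrow> subalgebra M (sigma_gen M N X)"
  unfolding subalgebra_def sigma_gen_def
  using sets_vimage_algebra2[of X "space M" N] measurable_sets[of X M N] measurable_space[of X M N]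
  by auto

text \<open>Events of \<open>sigma_gen M N X\<close> are preimages under \<open>X\<close>, so
  independence of \<open>X\<close> becomes independence of the identity map into that sigma-algebra,
  which is the form needed for conditioning on it.\<close>

lemma indep_pair_sigma_gen:
  assumes "indep_pair M N X K Z"
  shows "indep_pair M (sigma_gen M N X) (\<lambda>\<omega>. \<omega>) K Z"
proof -
  have X: "X \<in> M \<rightarrow>\<^sub>M N" using assms by (auto simp: indep_pair_def)
  then have *: "X \<in> space M \<rightarrow> space N" by (auto dest: measurable_space)
  have "(\<lambda>\<omega>. \<omega>) \<in> M \<rightarrow>\<^sub>M sigma_gen M N X"
    using subalgebra_sigma_gen[OF X] by (auto intro!: measurableI simp: subalgebra_def)
  moreover have "X -` A \<inter> space M \<inter> Z -` B \<inter> space M = X -` A \<inter> Z -` B \<inter> space M" for A B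
    by blast
  ultimately show ?thesis
    using assms by (auto simp: indep_pair_def sigma_gen_def sets_vimage_algebra2[OF *])
qed

lemma indep_pair_compose:
  assumes "indep_pair M N X K Z" "f \<in> N \<rightarrow>\<^sub>M L"
  shows "indep_pair M L (\<lambda>\<omega>. f (X \<omega>)) K Z"
proof -
  have X: "X \<in> M \<rightarrow>\<^sub>M N" using assms by (auto simp: indep_pair_def)
  have eq: "(\<lambda>\<omega>. f (X \<omega>)) -` A \<inter> space M = X -` (f -` A \<inter> space N) \<inter> space M"
    "(\<lambda>\<omega>. f (X \<omega>)) -` A \<inter> Z -` B \<inter> space M = X -` (f -` A \<inter> space N) \<inter> Z -` B \<inter> space M" for A B
    using measurable_space[OF X] by auto
  have "f -` A \<inter> space N \<in> sets N" if "A \<in> sets L" for A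
    using assms(2) that by (rule measurable_sets)
  moreover have "(\<lambda>\<omega>. f (X \<omega>)) \<in> M \<rightarrow>\<^sub>M L" using measurable_compose[OF X assms(2)] .
  ultimately show ?thesis
    using assms(1) unfolding indep_pair_def eq by blast
qed

text \<open>Serves to pass from the adapted trajectory to a given state process, which agrees with
  it only almost surely.\<close>

lemma indep_pair_cong_AE:
  assumes "indep_pair M N X K Z" "X' \<in> M \<rightarrow>\<^sub>M N" "AE \<omega> in M. X' \<omega> = X \<omega>"
  shows "indep_pair M N X' K Z"
proof -
  have [measurable]: "X \<in> M \<rightarrow>\<^sub>M N" "Z \<in> M \<rightarrow>\<^sub>M K"
    using assms by (auto simp: indep_pair_def)
  note assms(2)[measurable]
  have "measure M (X' -` A \<inter> space M) = measure M (X -` A \<inter> space M)" if "A \<in> sets N" for A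
    using assms(3) that by (intro measure_eq_AE measurable_sets) (auto simp: eventually_mono)
  moreover have "measure M (X' -` A \<inter> Z -` B \<inter> space M) = measure M (X -` A \<inter> Z -` B \<inter> space M)"
    if [measurable]: "A \<in> sets N" "B \<in> sets K" for A B
  proof (rule measure_eq_AE)
    show "AE \<omega> in M. (\<omega> \<in> X' -` A \<inter> Z -` B \<inter> space M) = (\<omega> \<in> X -` A \<inter> Z -` B \<inter> space M)"
      using assms(3) by eventually_elim auto
    have "Y -` A \<inter> Z -` B \<inter> space M \<in> sets M" if "Y \<in> M \<rightarrow>\<^sub>M N" for Y
    proof -
      have "Y -` A \<inter> Z -` B \<inter> space M = (Y -` A \<inter> space M) \<inter> (Z -` B \<inter> space M)" by blast
      then show ?thesis using that by simp
    qed
    then show "X' -` A \<inter> Z -` B \<inter> space M \<in> sets M" "X -` A \<inter> Z -` B \<inter> space M \<in> sets M"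
      by simp_all
  qed
  ultimately show ?thesis
    using assms(1) by (simp add: indep_pair_def)
qed

lemma real_cond_exp_freezing:
  fixes h :: "'a \<times> 'c \<Rightarrow> real"
  assumes sub: "subalgebra M F" and ind: "indep_pair M F (\<lambda>\<omega>. \<omega>) K Z"
    and h [measurable]: "h \<in> borel_measurable (F \<Otimes>\<^sub>M K)"
    and int: "integrable M (\<lambda>\<omega>. h (\<omega>, Z \<omega>))"
  shows "AE \<omega> in M. real_cond_exp M F (\<lambda>\<omega>. h (\<omega>, Z \<omega>)) \<omega> = (\<integral>z. h (\<omega>, z) \<partial>distr M K Z)"
proof -
  interpret sigma_finite_subalgebra M F
    using sub by (intro finite_measure_subalgebra_is_sigma_finite)
      (simp add: finite_measure_subalgebra_def finite_measure_subalgebra_axioms_def finite_measure_axioms)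
  have [measurable]: "Z \<in> M \<rightarrow>\<^sub>M K" using indep_pairD_distr[OF ind] by simp
  interpret Z: prob_space "distr M K Z" by (rule prob_space_distr) measurable
  show ?thesis
  proof (rule real_cond_exp_charact)
    show "integrable M (\<lambda>\<omega>. h (\<omega>, Z \<omega>))" by fact
    show "integrable M (\<lambda>\<omega>. \<integral>z. h (\<omega>, z) \<partial>distr M K Z)"
      using freezing_integral(2)[OF ind h int] .
    show "(\<lambda>\<omega>. \<integral>z. h (\<omega>, z) \<partial>distr M K Z) \<in> borel_measurable F"
      by (rule Z.borel_measurable_lebesgue_integral) measurable
    fix A assume A [measurable]: "A \<in> sets F"
    have "A \<in> sets M" using A sub by (auto simp: subalgebra_def)
    let ?h = "\<lambda>(\<omega>, z). indicator A \<omega> * h (\<omega>, z)"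
    have "integrable M (\<lambda>\<omega>. ?h (\<omega>, Z \<omega>))"
      using integrable_real_mult_indicator[OF \<open>A \<in> sets M\<close> int] by (simp add: mult.commute)
    from freezing_integral(3)[OF ind _ this]
    show "(\<integral> x \<in> A. h (x, Z x) \<partial>M) = (\<integral> x \<in> A. (\<integral>z. h (x, z) \<partial>distr M K Z) \<partial>M)"
      by (simp add: set_lebesgue_integral_def)
  qed
qed

end

section \<open>Square integrability and conditional expectation\<close>

lemma sq_integrable_bound:
  assumes "sq_integrable M g" "f \<in> borel_measurable M" "AE \<omega> in M. norm (f \<omega>) \<le> norm (g \<omega>)"
  shows "sq_integrable M f"
  unfolding sq_integrable_def
proof
  show "integrable M (\<lambda>\<omega>. (norm (f \<omega>))\<^sup>2)"
  proof (rule Bochner_Integration.integrable_bound)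
    show "integrable M (\<lambda>\<omega>. (norm (g \<omega>))\<^sup>2)" using assms by (simp add: sq_integrable_def)
    show "(\<lambda>\<omega>. (norm (f \<omega>))\<^sup>2) \<in> borel_measurable M" using assms(2) by measurable
    show "AE \<omega> in M. norm ((norm (f \<omega>))\<^sup>2) \<le> norm ((norm (g \<omega>))\<^sup>2)"
      using assms(3) by eventually_elim (simp add: power_mono)
  qed
qed fact

lemma sq_integrable_add:
  fixes f g :: "'a \<Rightarrow> 'e::euclidean_space"
  assumes "sq_integrable M f" "sq_integrable M g"
  shows "sq_integrable M (\<lambda>\<omega>. f \<omega> + g \<omega>)"
  unfolding sq_integrable_def
proof
  have m [measurable]: "f \<in> borel_measurable M" "g \<in> borel_measurable M"
    using assms by (simp_all add: sq_integrable_def)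
  show "(\<lambda>\<omega>. f \<omega> + g \<omega>) \<in> borel_measurable M" by measurable
  show "integrable M (\<lambda>\<omega>. (norm (f \<omega> + g \<omega>))\<^sup>2)"
  proof (rule Bochner_Integration.integrable_bound)
    show "integrable M (\<lambda>\<omega>. 2 * (norm (f \<omega>))\<^sup>2 + 2 * (norm (g \<omega>))\<^sup>2)"
      using assms by (simp add: sq_integrable_def)
    have "(norm (a + b))\<^sup>2 \<le> 2 * (norm a)\<^sup>2 + 2 * (norm b)\<^sup>2" for a b :: 'e
    proof -
      have "(norm (a + b))\<^sup>2 \<le> (norm a + norm b)\<^sup>2"
        by (intro power_mono norm_triangle_ineq) simp
      also have "\<dots> \<le> 2 * (norm a)\<^sup>2 + 2 * (norm b)\<^sup>2"
        using zero_le_power2[of "norm a - norm b"] by (simp add: power2_eq_square algebra_simps)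
      finally show ?thesis .
    qed
    then show "AE \<omega> in M. norm ((norm (f \<omega> + g \<omega>))\<^sup>2) \<le> norm (2 * (norm (f \<omega>))\<^sup>2 + 2 * (norm (g \<omega>))\<^sup>2)"
      by simp
  qed measurable
qed

lemma sq_integrable_scaleR:
  assumes "sq_integrable M f" shows "sq_integrable M (\<lambda>\<omega>. c *\<^sub>R f \<omega>)"
  using assms by (auto simp: sq_integrable_def power_mult_distrib)

lemma sq_integrable_uminus:
  assumes "sq_integrable M f" shows "sq_integrable M (\<lambda>\<omega>. - f \<omega>)"
  using assms by (auto simp: sq_integrable_def)

lemma sq_integrable_diff:
  assumes "sq_integrable M f" "sq_integrable M g"
  shows "sq_integrable M (\<lambda>\<omega>. f \<omega> - g \<omega>)"
  using sq_integrable_add[OF assms(1) sq_integrable_uminus[OF assms(2)]] by simp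

lemma sq_integrable_sum:
  assumes "\<And>i. i \<in> I \<Longrightarrow> sq_integrable M (f i)"
  shows "sq_integrable M (\<lambda>\<omega>. \<Sum>i\<in>I. f i \<omega>)"
proof -
  have "sq_integrable M (\<lambda>\<omega>. 0)" by (simp add: sq_integrable_def)
  then show ?thesis using assms
    by (induction I rule: infinite_finite_induct) (auto intro: sq_integrable_add)
qed

lemma sq_integrable_inner:
  fixes f g :: "'a \<Rightarrow> 'e::euclidean_space"
  assumes "sq_integrable M f" "sq_integrable M g"
  shows "integrable M (\<lambda>\<omega>. f \<omega> \<bullet> g \<omega>)"
proof (rule Bochner_Integration.integrable_bound)
  have [measurable]: "f \<in> borel_measurable M" "g \<in> borel_measurable M"
    using assms by (simp_all add: sq_integrable_def)
  show "(\<lambda>\<omega>. f \<omega> \<bullet> g \<omega>) \<in> borel_measurable M" by measurable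
  show "integrable M (\<lambda>\<omega>. (norm (f \<omega>))\<^sup>2 + (norm (g \<omega>))\<^sup>2)"
    using assms by (simp add: sq_integrable_def)
  have "\<bar>a \<bullet> b\<bar> \<le> (norm a)\<^sup>2 + (norm b)\<^sup>2" for a b :: 'e
  proof -
    have "\<bar>a \<bullet> b\<bar> \<le> norm a * norm b" by (rule Cauchy_Schwarz_ineq2)
    also have "\<dots> \<le> (norm a)\<^sup>2 + (norm b)\<^sup>2"
      using zero_le_power2[of "norm a - norm b"] zero_le_power2[of "norm a + norm b"]
      unfolding power2_diff power2_sum by linarith
    finally show ?thesis .
  qed
  then show "AE \<omega> in M. norm (f \<omega> \<bullet> g \<omega>) \<le> norm ((norm (f \<omega>))\<^sup>2 + (norm (g \<omega>))\<^sup>2)"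
    by simp
qed

lemma sq_integrable_component:
  assumes "sq_integrable M f" shows "sq_integrable M (\<lambda>\<omega>. f \<omega> \<bullet> b)"
proof (rule sq_integrable_bound)
  show "sq_integrable M (\<lambda>\<omega>. norm b *\<^sub>R f \<omega>)" using assms by (rule sq_integrable_scaleR)
  have [measurable]: "f \<in> borel_measurable M" using assms by (simp add: sq_integrable_def)
  show "(\<lambda>\<omega>. f \<omega> \<bullet> b) \<in> borel_measurable M" by measurable
  show "AE \<omega> in M. norm (f \<omega> \<bullet> b) \<le> norm (norm b *\<^sub>R f \<omega>)"
    by (auto simp: mult.commute[of "norm b"] Cauchy_Schwarz_ineq2)
qed

lemma (in finite_measure) sq_integrable_imp_integrable_component:
  assumes "sq_integrable M f" shows "integrable M (\<lambda>\<omega>. f \<omega> \<bullet> b)"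
  using sq_integrable_component[OF assms, of b]
  by (auto simp: sq_integrable_def intro: square_integrable_imp_integrable)

section \<open>Conditional expectation of random vectors\<close>

locale prob_subalgebra = prob_space M + finite_measure_subalgebra M F for M F :: "'a measure"

lemma prob_subalgebraI: "prob_space M \<Longrightarrow> subalgebra M F \<Longrightarrow> prob_subalgebra M F"
  by (simp add: prob_subalgebra_def finite_measure_subalgebra_def finite_measure_subalgebra_axioms_def
      prob_space_def)

context prob_subalgebra begin

lemma vec_cond_exp_measurable_F [measurable]: "vec_cond_exp M F B f \<in> borel_measurable F"
  unfolding vec_cond_exp_def by measurable

lemma vec_cond_exp_measurable [measurable]: "vec_cond_exp M F B f \<in> borel_measurable M"
  using vec_cond_exp_measurable_F by (rule measurable_from_subalg[OF subalg])

lemma vec_cond_exp_in_span: "vec_cond_exp M F B f \<omega> \<in> span B"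
  unfolding vec_cond_exp_def by (intro span_sum span_scale span_base)

lemma real_cond_exp_sq_integrable:
  fixes f :: "'a \<Rightarrow> real"
  assumes "sq_integrable M f" shows "sq_integrable M (real_cond_exp M F f)"
proof -
  have [measurable]: "f \<in> borel_measurable M" and 2: "integrable M (\<lambda>\<omega>. (f \<omega>)\<^sup>2)"
    using assms by (simp_all add: sq_integrable_def)
  have "integrable M (\<lambda>x. (real_cond_exp M F f x)\<^sup>2)"
    by (rule integrable_convex_cond_exp[where I = UNIV])
      (use 2 square_integrable_imp_integrable[OF _ 2] in \<open>auto simp: convex_power2\<close>)
  then show ?thesis by (simp add: sq_integrable_def)
qed

lemma vec_cond_exp_L2:
  assumes "sq_integrable M f" shows "vec_cond_exp M F B f \<in> L2 M (span B)"
proof -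
  have "sq_integrable M (vec_cond_exp M F B f)"
    unfolding vec_cond_exp_def
  proof (rule sq_integrable_sum)
    fix b
    show "sq_integrable M (\<lambda>\<omega>. real_cond_exp M F (\<lambda>\<omega>'. f \<omega>' \<bullet> b) \<omega> *\<^sub>R b)"
      by (rule sq_integrable_bound[OF sq_integrable_scaleR[OF real_cond_exp_sq_integrable[OF sq_integrable_component[OF assms]], of "norm b" b]])
        (auto simp: mult.commute)
  qed
  then show ?thesis by (simp add: L2_def rv_def vec_cond_exp_in_span)
qed

text \<open>Conditional expectation is self-adjoint on L2: coordinatewise both sides equal the
  integral of the product of the two conditional expectations. This moves the conditioning from a
  test control to the gradient.\<close>

lemma integral_vec_cond_exp_inner:
  assumes f: "sq_integrable M f" and g: "sq_integrable M g"
  shows "(\<integral>\<omega>. vec_cond_exp M F B f \<omega> \<bullet> g \<omega> \<partial>M) = (\<integral>\<omega>. f \<omega> \<bullet> vec_cond_exp M F B g \<omega> \<partial>M)"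
proof -
  have [measurable]: "f \<in> borel_measurable M" "g \<in> borel_measurable M"
    using assms by (simp_all add: sq_integrable_def)
  let ?f = "\<lambda>b \<omega>. f \<omega> \<bullet> b" and ?g = "\<lambda>b \<omega>. g \<omega> \<bullet> b"
  let ?Ef = "\<lambda>b. real_cond_exp M F (?f b)" and ?Eg = "\<lambda>b. real_cond_exp M F (?g b)"
  have sq: "sq_integrable M (?f b)" "sq_integrable M (?g b)" "sq_integrable M (?Ef b)" "sq_integrable M (?Eg b)" for b
    by (intro sq_integrable_component real_cond_exp_sq_integrable f g)+
  have i1: "integrable M (\<lambda>\<omega>. ?Ef b \<omega> * ?g b \<omega>)" for b
    using sq_integrable_inner[OF sq(3) sq(2), of b b] by simp
  have i2: "integrable M (\<lambda>\<omega>. ?Eg b \<omega> * ?f b \<omega>)" for b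
    using sq_integrable_inner[OF sq(4) sq(1), of b b] by simp
  have eq: "(\<integral>\<omega>. ?Ef b \<omega> * ?g b \<omega> \<partial>M) = (\<integral>\<omega>. ?Eg b \<omega> * ?f b \<omega> \<partial>M)" for b
  proof -
    have "(\<integral>\<omega>. ?Ef b \<omega> * ?g b \<omega> \<partial>M) = (\<integral>\<omega>. ?Ef b \<omega> * ?Eg b \<omega> \<partial>M)"
      using real_cond_exp_intg(2)[OF i1[of b]] by simp
    also have "\<dots> = (\<integral>\<omega>. ?Eg b \<omega> * ?Ef b \<omega> \<partial>M)" by (simp add: mult.commute)
    also have "\<dots> = (\<integral>\<omega>. ?Eg b \<omega> * ?f b \<omega> \<partial>M)"
      using real_cond_exp_intg(2)[OF i2[of b]] by simp
    finally show ?thesis .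
  qed
  have "(\<integral>\<omega>. vec_cond_exp M F B f \<omega> \<bullet> g \<omega> \<partial>M) = (\<integral>\<omega>. (\<Sum>b\<in>B. ?Ef b \<omega> * ?g b \<omega>) \<partial>M)"
    unfolding vec_cond_exp_def inner_sum_left inner_scaleR_left by (simp only: inner_commute)
  also have "\<dots> = (\<integral>\<omega>. (\<Sum>b\<in>B. ?Eg b \<omega> * ?f b \<omega>) \<partial>M)"
    using i1 i2 eq by (simp add: Bochner_Integration.integral_sum)
  also have "\<dots> = (\<integral>\<omega>. f \<omega> \<bullet> vec_cond_exp M F B g \<omega> \<partial>M)"
    by (simp add: vec_cond_exp_def inner_sum_right)
  finally show ?thesis .
qed

text \<open>A Jensen inequality for the indicator function of \<open>C\<close>: a half-space
  inequality passes to the conditional expectation outside a null set, and countably many such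
  inequalities still share one null set.\<close>

lemma vec_cond_exp_in_closed_convex:
  assumes f: "sq_integrable M f" and fin: "finite B" and fB: "\<And>\<omega>. \<omega> \<in> space M \<Longrightarrow> (\<Sum>b\<in>B. (f \<omega> \<bullet> b) *\<^sub>R b) = f \<omega>"
    and C: "closed C" "convex C" "C \<noteq> {}" and fC: "AE \<omega> in M. f \<omega> \<in> C"
  shows "AE \<omega> in M. vec_cond_exp M F B f \<omega> \<in> C"
proof -
  obtain D :: "'b set" where D: "countable D" "\<And>U. open U \<Longrightarrow> U \<noteq> {} \<Longrightarrow> \<exists>d\<in>D. d \<in> U"
    using countable_dense_setE by blast
  have int: "integrable M (\<lambda>\<omega>. f \<omega> \<bullet> b)" for b
    using f by (rule sq_integrable_imp_integrable_component)
  \<comment> \<open>\<open>C\<close> is the intersection of the countably many half-spaces supporting it at the projections of \<open>D\<close>.\<close>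
  let ?a = "\<lambda>d. d - closest_point C d"
  have "AE \<omega> in M. ?a d \<bullet> (vec_cond_exp M F B f \<omega> - closest_point C d) \<le> 0" for d
  proof -
    let ?h = "\<lambda>\<omega>. \<Sum>b\<in>B. (b \<bullet> ?a d) * (f \<omega> \<bullet> b)"
    have h: "?h \<omega> = f \<omega> \<bullet> ?a d" if "\<omega> \<in> space M" for \<omega>
    proof -
      have "f \<omega> \<bullet> ?a d = (\<Sum>b\<in>B. (f \<omega> \<bullet> b) *\<^sub>R b) \<bullet> ?a d" using fB[OF that] by simp
      then show ?thesis by (simp only: inner_sum_left inner_scaleR_left mult.commute)
    qed
    have "AE \<omega> in M. real_cond_exp M F ?h \<omega> = (\<Sum>b\<in>B. real_cond_exp M F (\<lambda>\<omega>. (b \<bullet> ?a d) * (f \<omega> \<bullet> b)) \<omega>)"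
      using int by (intro real_cond_exp_sum) auto
    moreover have "AE \<omega> in M. \<forall>b\<in>B. real_cond_exp M F (\<lambda>\<omega>. (b \<bullet> ?a d) * (f \<omega> \<bullet> b)) \<omega>
        = (b \<bullet> ?a d) * real_cond_exp M F (\<lambda>\<omega>. f \<omega> \<bullet> b) \<omega>"
      using int fin by (intro AE_finite_allI real_cond_exp_cmult) auto
    moreover have "AE \<omega> in M. real_cond_exp M F ?h \<omega> \<le> closest_point C d \<bullet> ?a d"
    proof (rule real_cond_exp_le_c)
      show "integrable M ?h" using int by auto
      show "AE \<omega> in M. ?h \<omega> \<le> closest_point C d \<bullet> ?a d"
        using fC AE_space
      proof eventually_elim
        case (elim \<omega>)
        have "?a d \<bullet> (f \<omega> - closest_point C d) \<le> 0"
          using C elim by (intro closest_point_dot) auto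
        then show ?case using h[OF elim(2)] by (simp add: inner_diff_right inner_commute)
      qed
    qed
    ultimately show ?thesis
    proof eventually_elim
      case (elim \<omega>)
      have "vec_cond_exp M F B f \<omega> \<bullet> ?a d = real_cond_exp M F ?h \<omega>"
        using elim(1,2) by (simp add: vec_cond_exp_def inner_sum_left mult.commute)
      then show ?case using elim(3) by (simp add: inner_diff_right inner_commute)
    qed
  qed
  then have "AE \<omega> in M. \<forall>d\<in>D. ?a d \<bullet> (vec_cond_exp M F B f \<omega> - closest_point C d) \<le> 0"
    using D(1) by (simp add: AE_ball_countable)
  then show ?thesis
  proof eventually_elim
    case (elim \<omega>)
    define y where "y = vec_cond_exp M F B f \<omega>"
    show ?case
    proof (rule ccontr)
      assume "vec_cond_exp M F B f \<omega> \<notin> C"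
      then have pos: "setdist {y} C > 0"
        using C setdist_eq_0_closed[of C y] setdist_pos_le[of "{y}" C] by (auto simp: y_def less_le)
      \<comment> \<open>With \<open>d\<close> nearer to \<open>y\<close> than half the distance from
        \<open>y\<close> to \<open>C\<close>, the vector \<open>?a d\<close> is longer than
        \<open>y - d\<close>. Hence \<open>y\<close> lies strictly outside the half-space supporting
        \<open>C\<close> at the projection of \<open>d\<close>.\<close>
      have "ball y (setdist {y} C / 2) \<noteq> {}" using pos by simp
      then obtain d where "d \<in> D" "d \<in> ball y (setdist {y} C / 2)"
        using D(2)[OF open_ball] by blast
      then have d: "d \<in> D" "dist y d < setdist {y} C / 2" by simp_all
      have "setdist {y} C \<le> dist y (closest_point C d)"
        using C by (intro setdist_le_dist) (auto simp: closest_point_in_set)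
      also have "\<dots> \<le> dist y d + dist d (closest_point C d)" by (rule dist_triangle)
      finally have less: "norm (y - d) < norm (?a d)" using d by (simp add: dist_norm)
      have "?a d \<bullet> (y - closest_point C d) = ?a d \<bullet> (y - d) + (norm (?a d))\<^sup>2"
        by (simp add: power2_norm_eq_inner inner_diff_right)
      also have "\<dots> \<ge> (norm (?a d))\<^sup>2 - norm (?a d) * norm (y - d)"
        using Cauchy_Schwarz_ineq2[of "?a d" "y - d"] by linarith
      moreover have "(norm (?a d))\<^sup>2 - norm (?a d) * norm (y - d) > 0"
      proof -
        have "norm (?a d) > 0" using less norm_ge_zero[of "y - d"] by linarith
        then show ?thesis using less by (simp add: power2_eq_square)
      qed
      ultimately show False using elim d(1) by (fastforce simp: y_def)
    qed
  qed
qed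

end

text \<open>No domination is assumed. It follows from \<open>intg\<close>, applied to a random point \<open>\<theta>\<close> at which
  \<open>g \<omega>\<close> bounds all difference quotients of \<open>G \<omega>\<close> at \<open>0\<close> up to the constant \<open>1\<close>.\<close>

lemma (in finite_measure) integral_derivative_nonneg:
  fixes G g :: "'a \<Rightarrow> real \<Rightarrow> real"
  assumes deriv: "\<And>\<omega> r. \<omega> \<in> space M \<Longrightarrow> r \<in> {0..1} \<Longrightarrow> (G \<omega> has_real_derivative g \<omega> r) (at r within {0..1})"
    and cont: "\<And>\<omega>. \<omega> \<in> space M \<Longrightarrow> continuous_on {0..1} (g \<omega>)"
    and int: "\<And>r. r \<in> {0..1} \<Longrightarrow> integrable M (\<lambda>\<omega>. G \<omega> r)"
    and intg: "\<And>\<theta>. \<theta> \<in> borel_measurable M \<Longrightarrow> (\<And>\<omega>. \<theta> \<omega> \<in> {0..1}) \<Longrightarrow> integrable M (\<lambda>\<omega>. g \<omega> (\<theta> \<omega>))"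
    and min: "\<And>r. r \<in> {0..1} \<Longrightarrow> (\<integral>\<omega>. G \<omega> 0 \<partial>M) \<le> (\<integral>\<omega>. G \<omega> r \<partial>M)"
  shows "0 \<le> (\<integral>\<omega>. g \<omega> 0 \<partial>M)"
proof -
  define D where "D n \<omega> = real (Suc n) * (G \<omega> (1 / real (Suc n)) - G \<omega> 0)" for n \<omega>
  have in01: "1 / real (Suc n) \<in> {0..1}" for n by simp
  have intD: "integrable M (D n)" for n
    unfolding D_def using int[OF in01] int[of 0] by simp
  have [measurable]: "D n \<in> borel_measurable M" for n using intD by auto
  \<comment> \<open>The random point is sought among the rationals of the unit interval, so that it
    can be chosen measurably as the one of least index.\<close>
  define q where "q k = (from_nat_into (\<rat> \<inter> {0..1}) k :: real)" for k
  have "0 \<in> \<rat> \<inter> {0..1::real}" by simp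
  then have Q0: "\<rat> \<inter> {0..1::real} \<noteq> {}" by blast
  have q: "q k \<in> {0..1}" for k using from_nat_into[OF Q0] by (auto simp: q_def)
  have qsurj: "\<exists>k. q k = r" if "r \<in> \<rat>" "r \<in> {0..1}" for r
    using from_nat_into_surj[of "\<rat> \<inter> {0..1}" r] that countable_rat by (auto simp: q_def)
  have [measurable]: "(\<lambda>\<omega>. g \<omega> (q k)) \<in> borel_measurable M" for k
    using intg[of "\<lambda>_. q k"] q by auto
  have ex: "\<exists>k. \<forall>n. \<bar>D n \<omega>\<bar> \<le> \<bar>g \<omega> (q k)\<bar> + 1" if \<omega>: "\<omega> \<in> space M" for \<omega>
  proof -
    \<comment> \<open>By the mean value theorem the maximum of
      \<open>\<bar>g \<omega>\<bar>\<close>, attained at \<open>s\<close>, bounds every difference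
      quotient. A rational point close to \<open>s\<close> loses at most \<open>1\<close>, which is
      the constant in the bound.\<close>
    have "continuous_on {0..1} (\<lambda>r. \<bar>g \<omega> r\<bar>)" using cont[OF \<omega>] by (intro continuous_intros)
    then obtain s where s: "s \<in> {0..1}" "\<And>r. r \<in> {0..1} \<Longrightarrow> \<bar>g \<omega> r\<bar> \<le> \<bar>g \<omega> s\<bar>"
      using continuous_attains_sup[of "{0..1::real}" "\<lambda>r. \<bar>g \<omega> r\<bar>"] by auto
    obtain \<delta> where \<delta>: "\<delta> > 0" "\<And>r. r \<in> {0..1} \<Longrightarrow> dist r s < \<delta> \<Longrightarrow> dist (g \<omega> r) (g \<omega> s) < 1"
      using cont[OF \<omega>] s(1) unfolding continuous_on_iff by (metis zero_less_one)
    have "max 0 (s - \<delta>) < min 1 (s + \<delta>)" using s(1) \<delta>(1) by auto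
    then obtain r where r: "r \<in> \<rat>" "max 0 (s - \<delta>) < r" "r < min 1 (s + \<delta>)"
      using Rats_dense_in_real by blast
    then obtain k where k: "q k = r" using qsurj[of r] by auto
    have "dist (g \<omega> r) (g \<omega> s) < 1" using r by (intro \<delta>) (auto simp: dist_real_def)
    then have *: "\<bar>g \<omega> s\<bar> \<le> \<bar>g \<omega> r\<bar> + 1" by (auto simp: dist_real_def)
    have "\<bar>D n \<omega>\<bar> \<le> \<bar>g \<omega> s\<bar>" for n
    proof -
      have "\<exists>z\<in>{0<..<1 / real (Suc n)}. G \<omega> (1 / real (Suc n)) - G \<omega> 0 = g \<omega> z * (1 / real (Suc n) - 0)"
      proof (rule mvt_simple)
        fix z :: real assume z: "0 \<le> z" "z \<le> 1 / real (Suc n)"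
        have le1: "1 / real (Suc n) \<le> 1" by simp
        have "z \<in> {0..1}" using z(1) order_trans[OF z(2) le1] by simp
        moreover have "{0..1 / real (Suc n)} \<subseteq> {0..1}" using le1 by auto
        ultimately show "(G \<omega> has_derivative (*) (g \<omega> z)) (at z within {0..1 / real (Suc n)})"
          using deriv[OF \<omega>] has_derivative_subset by (metis has_field_derivative_def)
      qed simp
      then obtain z where z: "0 < z" "z < 1 / real (Suc n)" "D n \<omega> = g \<omega> z"
        by (auto simp: D_def)
      have "1 / real (Suc n) \<le> 1" by simp
      from less_le_trans[OF z(2) this] show ?thesis using z s(2)[of z] by simp
    qed
    then have "\<bar>D n \<omega>\<bar> \<le> \<bar>g \<omega> (q k)\<bar> + 1" for n
      using order_trans[OF _ *] unfolding k by blast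
    then show ?thesis by blast
  qed
  define k where "k \<omega> = (LEAST k. \<forall>n. \<bar>D n \<omega>\<bar> \<le> \<bar>g \<omega> (q k)\<bar> + 1)" for \<omega>
  have [measurable]: "k \<in> measurable M (count_space UNIV)" unfolding k_def by measurable
  have dom: "integrable M (\<lambda>\<omega>. \<bar>g \<omega> (q (k \<omega>))\<bar> + 1)"
    using intg[of "\<lambda>\<omega>. q (k \<omega>)"] q by auto
  have bound: "\<bar>D n \<omega>\<bar> \<le> \<bar>g \<omega> (q (k \<omega>))\<bar> + 1" if "\<omega> \<in> space M" for n \<omega>
    using LeastI_ex[OF ex[OF that]] by (auto simp: k_def)
  have lim: "(\<lambda>n. D n \<omega>) \<longlonglongrightarrow> g \<omega> 0" if \<omega>: "\<omega> \<in> space M" for \<omega>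
  proof -
    have "((\<lambda>r. (G \<omega> r - G \<omega> 0) / (r - 0)) \<longlongrightarrow> g \<omega> 0) (at 0 within {0..1})"
      using deriv[OF \<omega>, of 0] by (simp add: has_field_derivative_iff)
    moreover have "filterlim (\<lambda>n. 1 / real (Suc n)) (at 0 within {0..1}) sequentially"
      unfolding filterlim_at using LIMSEQ_inverse_real_of_nat by (auto simp: inverse_eq_divide)
    ultimately have "(\<lambda>n. (G \<omega> (1 / real (Suc n)) - G \<omega> 0) / (1 / real (Suc n) - 0)) \<longlonglongrightarrow> g \<omega> 0"
      by (rule filterlim_compose)
    then show ?thesis by (simp add: D_def mult.commute)
  qed
  have "(\<lambda>n. \<integral>\<omega>. D n \<omega> \<partial>M) \<longlonglongrightarrow> (\<integral>\<omega>. g \<omega> 0 \<partial>M)"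
    by (rule integral_dominated_convergence[where w = "\<lambda>\<omega>. \<bar>g \<omega> (q (k \<omega>))\<bar> + 1"])
      (use intg[of "\<lambda>_. 0"] dom bound lim in auto)
  moreover have "0 \<le> (\<integral>\<omega>. D n \<omega> \<partial>M)" for n
    unfolding D_def using int[OF in01[of n]] int[of 0] min[OF in01[of n]] by simp
  ultimately show ?thesis by (intro LIMSEQ_le_const) auto
qed

text \<open>Used to freeze one of two arguments of a C1 map. As \<open>E\<close> does not depend on
  the base point and maps \<open>span A\<close> into \<open>S\<close>, the derivative of the
  composite is \<open>deriv_on S g\<close> at \<open>e x\<close> in a fixed direction, hence
  continuous in \<open>x\<close>.\<close>

lemma C1_on_compose_embedding:
  fixes g :: "'b::euclidean_space \<Rightarrow> 'c::euclidean_space" and e :: "'d::euclidean_space \<Rightarrow> 'b"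
  assumes C1: "C1_on S g" and A: "A \<subseteq> Basis"
    and e: "\<And>x. x \<in> span A \<Longrightarrow> (e has_derivative E) (at x within span A)" "e ` span A \<subseteq> S"
    and E: "\<And>h. h \<in> span A \<Longrightarrow> E h \<in> S"
  shows "C1_on (span A) (\<lambda>\<xi>. g (e \<xi>))"
proof -
  have der: "((\<lambda>\<xi>. g (e \<xi>)) has_derivative (\<lambda>h. frechet_derivative g (at (e x) within S) (E h)))
      (at x within span A)" if x: "x \<in> span A" for x
  proof (rule has_derivative_in_compose[OF e(1)[OF x]])
    have "(g has_derivative frechet_derivative g (at (e x) within S)) (at (e x) within S)"
      using C1 x e(2) by (auto simp: C1_on_def differentiable_on_def simp flip: frechet_derivative_works)
    then show "(g has_derivative frechet_derivative g (at (e x) within S)) (at (e x) within e ` span A)"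
      using e(2) by (rule has_derivative_subset)
  qed
  have eq: "deriv_on (span A) (\<lambda>\<xi>. g (e \<xi>)) x h = deriv_on S g (e x) (E (proj A h))" if "x \<in> span A" for x h
    unfolding deriv_on_eq[OF der[OF that] A that] unfolding deriv_on_def
    by (simp add: closest_point_self E proj_in_span)
  have "continuous_on (span A) (\<lambda>x. deriv_on S g (e x) h)" for h
    using C1 by (intro continuous_on_compose2[OF _ has_derivative_continuous_on[OF e(1)] e(2)]) (simp add: C1_on_def)
  then show ?thesis
    using der by (auto simp: C1_on_def differentiable_on_def eq cong: continuous_on_cong intro: differentiableI)
qed

lemma C1_on_fst:
  fixes g :: "'b::euclidean_space \<times> 'd::euclidean_space \<Rightarrow> 'c::euclidean_space"
  assumes "C1_on (span A \<times> span B) g" "A \<subseteq> Basis" "u \<in> span B"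
  shows "C1_on (span A) (\<lambda>\<xi>. g (\<xi>, u))"
  by (rule C1_on_compose_embedding[OF assms(1,2), where E = "\<lambda>h. (h, 0)"])
    (use assms(3) in \<open>auto intro!: derivative_eq_intros simp: span_zero\<close>)

lemma C1_on_snd:
  fixes g :: "'b::euclidean_space \<times> 'd::euclidean_space \<Rightarrow> 'c::euclidean_space"
  assumes "C1_on (span A \<times> span B) g" "B \<subseteq> Basis" "x \<in> span A"
  shows "C1_on (span B) (\<lambda>v. g (x, v))"
  by (rule C1_on_compose_embedding[OF assms(1,2), where E = "\<lambda>h. (0, h)"])
    (use assms(3) in \<open>auto intro!: derivative_eq_intros simp: span_zero\<close>)

lemma C1_on_differentiable: "C1_on S g \<Longrightarrow> x \<in> S \<Longrightarrow> g differentiable (at x within S)"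
  by (simp add: C1_on_def differentiable_on_def)

lemma continuous_on_adjoint_deriv_on:
  fixes g :: "'b::euclidean_space \<Rightarrow> 'c::euclidean_space"
  assumes "C1_on (span B) g" "B \<subseteq> Basis" "continuous_on (span B) y"
  shows "continuous_on (span B) (\<lambda>x. adjoint (deriv_on (span B) g x) (y x))"
proof -
  have "continuous_on (span B) (\<lambda>x. \<Sum>b\<in>Basis. (y x \<bullet> deriv_on (span B) g x b) *\<^sub>R b)"
    using assms by (intro continuous_intros) (simp_all add: C1_on_def)
  then show ?thesis
    using assms by (simp add: adjoint_eq_sum linear_deriv_on C1_on_differentiable cong: continuous_on_cong)
qed

lemma continuous_on_grad_on:
  "C1_on (span B) g \<Longrightarrow> B \<subseteq> Basis \<Longrightarrow> continuous_on (span B) (grad_on (span B) g)"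
  unfolding grad_on_def by (rule continuous_on_adjoint_deriv_on) auto

text \<open>Each column of the Jacobian is a limit of difference quotients, hence the hypothesis of
  measurability at the shifted points \<open>x p + c *\<^sub>R proj B h\<close>.\<close>

lemma adjoint_deriv_on_measurable:
  fixes g :: "'p \<Rightarrow> 'b::euclidean_space \<Rightarrow> 'c::euclidean_space"
  assumes g: "\<And>p. g p differentiable (at (x p) within span B)" and B: "B \<subseteq> Basis" and x: "\<And>p. x p \<in> span B"
    and m: "\<And>c h. (\<lambda>p. g p (x p + c *\<^sub>R proj B h)) \<in> borel_measurable N"
    and [measurable]: "Y \<in> borel_measurable N"
  shows "(\<lambda>p. adjoint (deriv_on (span B) (g p) (x p)) (Y p)) \<in> borel_measurable N"
proof -
  have [measurable]: "(\<lambda>p. deriv_on (span B) (g p) (x p) h) \<in> borel_measurable N" for h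
  proof (rule borel_measurable_LIMSEQ_metric)
    show "(\<lambda>p. real (Suc n) *\<^sub>R (g p (x p + (1 / real (Suc n)) *\<^sub>R proj B h) - g p (x p))) \<in> borel_measurable N" for n
      using m[of "1 / real (Suc n)" h] m[of 0 h] by simp
    show "(\<lambda>n. real (Suc n) *\<^sub>R (g p (x p + (1 / real (Suc n)) *\<^sub>R proj B h) - g p (x p)))
        \<longlonglongrightarrow> deriv_on (span B) (g p) (x p) h" for p
      by (rule deriv_on_LIMSEQ[OF g B x])
  qed
  show ?thesis unfolding adjoint_eq_sum[OF linear_deriv_on[OF g B x]] by measurable
qed

lemma grad_on_measurable:
  fixes g :: "'p \<Rightarrow> 'b::euclidean_space \<Rightarrow> real"
  assumes "\<And>p. g p differentiable (at (x p) within span B)" "B \<subseteq> Basis" "\<And>p. x p \<in> span B"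
    and "\<And>c h. (\<lambda>p. g p (x p + c *\<^sub>R proj B h)) \<in> borel_measurable N"
  shows "(\<lambda>p. grad_on (span B) (g p) (x p)) \<in> borel_measurable N"
  unfolding grad_on_def by (intro adjoint_deriv_on_measurable assms) simp

lemma deriv_on_eq_grad_inner:
  fixes c :: "'b::euclidean_space \<Rightarrow> real"
  assumes "c differentiable (at x within span B)" "B \<subseteq> Basis" "x \<in> span B"
  shows "deriv_on (span B) c x h = grad_on (span B) c x \<bullet> h"
  using adjoint_works[OF linear_deriv_on[OF assms], of h 1]
  by (simp add: grad_on_def inner_commute)

text \<open>One backward step of the co-state recursion: if \<open>l\<close> is the gradient of the
  cost-to-go \<open>V\<close> at \<open>f x\<close>, the new gradient is the right-hand side of the
  co-state equation. It is applied both in the state and in the control.\<close>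

lemma has_derivative_cost_plus_compose:
  fixes c :: "'b::euclidean_space \<Rightarrow> real" and f :: "'b \<Rightarrow> 'c::euclidean_space"
  assumes B: "B \<subseteq> Basis" "x \<in> span B"
    and c: "c differentiable (at x within span B)" and f: "f differentiable (at x within span B)"
    and V: "(V has_derivative (\<lambda>h. l \<bullet> h)) (at (f x) within S)" "f ` span B \<subseteq> S"
  shows "((\<lambda>\<xi>. c \<xi> + V (f \<xi>)) has_derivative
    (\<lambda>h. (grad_on (span B) c x + adjoint (deriv_on (span B) f x) l) \<bullet> h)) (at x within span B)"
proof -
  have "((\<lambda>\<xi>. V (f \<xi>)) has_derivative (\<lambda>h. l \<bullet> deriv_on (span B) f x h)) (at x within span B)"
    by (rule has_derivative_in_compose[OF has_derivative_deriv_on[OF f B] has_derivative_subset[OF V]])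
  from has_derivative_add[OF has_derivative_deriv_on[OF c B] this]
  show ?thesis
    using deriv_on_eq_grad_inner[OF c B] adjoint_clauses(2)[OF linear_deriv_on[OF f B]]
    by (simp add: inner_add_left)
qed

section \<open>Cost-to-go and co-states\<close>

locale smooth_control =
  fixes P :: "('a, 'e::euclidean_space) control_problem"
  assumes setting: "control_setting P" and smooth: "smooth_data P"
begin

abbreviation "M \<equiv> prob P"
abbreviation "T \<equiv> horizon P"
abbreviation "pX t \<equiv> proj (Xcoord P t)"
abbreviation "pU t \<equiv> proj (Ucoord P t)"
abbreviation "pW t \<equiv> proj (Wcoord P t)"

sublocale prob_space M using setting by (simp add: control_setting_def)

lemma Xcoord_Basis: "t \<le> T \<Longrightarrow> Xcoord P t \<subseteq> Basis"
  and Wcoord_Basis: "t \<le> T \<Longrightarrow> Wcoord P t \<subseteq> Basis"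
  and Ucoord_Basis: "t < T \<Longrightarrow> Ucoord P t \<subseteq> Basis"
  and Wcoord_0: "Wcoord P 0 = Xcoord P 0"
  and noise_rv: "t \<le> T \<Longrightarrow> noise P t \<in> rv M (Wsp P t)"
  and dyn_in: "t < T \<Longrightarrow> x \<in> Xsp P t \<Longrightarrow> v \<in> Usp P t \<Longrightarrow> z \<in> Wsp P (Suc t) \<Longrightarrow> dyn P t x v z \<in> Xsp P (Suc t)"
  using setting by (simp_all add: control_setting_def)

lemma noise_measurable: "t \<le> T \<Longrightarrow> noise P t \<in> borel_measurable M"
  and noise_in: "t \<le> T \<Longrightarrow> \<omega> \<in> space M \<Longrightarrow> noise P t \<omega> \<in> Wsp P t"
  using noise_rv by (simp_all add: rv_def)

lemma pX_id: "t \<le> T \<Longrightarrow> x \<in> Xsp P t \<Longrightarrow> pX t x = x"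
  and pW_id: "t \<le> T \<Longrightarrow> x \<in> Wsp P t \<Longrightarrow> pW t x = x"
  and pU_id: "t < T \<Longrightarrow> x \<in> Usp P t \<Longrightarrow> pU t x = x"
  by (simp_all add: proj_id Xcoord_Basis Ucoord_Basis Wcoord_Basis)

text \<open>The data are constrained only on the coordinate subspaces. Precomposing with the projections
  makes them, and their gradients, Borel functions on the whole space.\<close>

definition pdyn :: "nat \<Rightarrow> 'e \<Rightarrow> 'e \<Rightarrow> 'e \<Rightarrow> 'e" where
  "pdyn t x v z = dyn P t (pX t x) (pU t v) (pW (Suc t) z)"
definition pcost :: "nat \<Rightarrow> 'e \<Rightarrow> 'e \<Rightarrow> 'e \<Rightarrow> real" where
  "pcost t x v z = cost P t (pX t x) (pU t v) (pW (Suc t) z)"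
definition pfinal :: "'e \<Rightarrow> real" where
  "pfinal x = final_cost P (pX T x)"
definition gX :: "nat \<Rightarrow> 'e \<Rightarrow> 'e \<Rightarrow> 'e \<Rightarrow> 'e" where
  "gX t x v z = grad_on (Xsp P t) (\<lambda>\<xi>. cost P t \<xi> (pU t v) (pW (Suc t) z)) (pX t x)"
definition jX :: "nat \<Rightarrow> 'e \<Rightarrow> 'e \<Rightarrow> 'e \<Rightarrow> 'e \<Rightarrow> 'e" where
  "jX t x v z = adjoint (deriv_on (Xsp P t) (\<lambda>\<xi>. dyn P t \<xi> (pU t v) (pW (Suc t) z)) (pX t x))"
definition gU :: "nat \<Rightarrow> 'e \<Rightarrow> 'e \<Rightarrow> 'e \<Rightarrow> 'e" where
  "gU t x v z = grad_on (Usp P t) (\<lambda>\<upsilon>. cost P t (pX t x) \<upsilon> (pW (Suc t) z)) (pU t v)"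
definition jU :: "nat \<Rightarrow> 'e \<Rightarrow> 'e \<Rightarrow> 'e \<Rightarrow> 'e \<Rightarrow> 'e" where
  "jU t x v z = adjoint (deriv_on (Usp P t) (\<lambda>\<upsilon>. dyn P t (pX t x) \<upsilon> (pW (Suc t) z)) (pU t v))"
definition gK :: "'e \<Rightarrow> 'e" where
  "gK x = grad_on (Xsp P T) (final_cost P) (pX T x)"

lemma C1_dyn: "t < T \<Longrightarrow> z \<in> Wsp P (Suc t) \<Longrightarrow> C1_on (Xsp P t \<times> Usp P t) (\<lambda>(x, u). dyn P t x u z)"
  and C1_cost: "t < T \<Longrightarrow> z \<in> Wsp P (Suc t) \<Longrightarrow> C1_on (Xsp P t \<times> Usp P t) (\<lambda>(x, u). cost P t x u z)"
  and C1_final: "C1_on (Xsp P T) (final_cost P)"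
  using smooth by (simp_all add: smooth_data_def)

lemma normal_cost: "t < T \<Longrightarrow> normal_integrand (restrict_space borel (Wsp P (Suc t))) (Xsp P t \<times> Usp P t)
    (\<lambda>w (x, u). cost P t x u w)"
  and normal_dyn: "t < T \<Longrightarrow> b \<in> Xcoord P (Suc t) \<Longrightarrow> normal_integrand (restrict_space borel (Wsp P (Suc t)))
    (Xsp P t \<times> Usp P t) (\<lambda>w (x, u). dyn P t x u w \<bullet> b)"
  using smooth by (simp_all add: smooth_data_def)

lemma differentiable_final: "x \<in> Xsp P T \<Longrightarrow> final_cost P differentiable (at x within Xsp P T)"
  using C1_final by (simp add: C1_on_def differentiable_on_def)

section \<open>Measurability and continuity of the data and their gradients\<close>

context
  fixes t assumes t: "t < T"
begin

lemma tX: "Xcoord P t \<subseteq> Basis" and tU: "Ucoord P t \<subseteq> Basis"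
  using t by (simp_all add: Xcoord_Basis Ucoord_Basis)

context
  fixes x v z assumes mem: "x \<in> Xsp P t" "v \<in> Usp P t" "z \<in> Wsp P (Suc t)"
begin

lemma C1_dyn_X: "C1_on (Xsp P t) (\<lambda>\<xi>. dyn P t \<xi> v z)"
  and C1_cost_X: "C1_on (Xsp P t) (\<lambda>\<xi>. cost P t \<xi> v z)"
  and C1_dyn_U: "C1_on (Usp P t) (\<lambda>\<upsilon>. dyn P t x \<upsilon> z)"
  and C1_cost_U: "C1_on (Usp P t) (\<lambda>\<upsilon>. cost P t x \<upsilon> z)"
  using C1_on_fst[OF C1_dyn[OF t mem(3)] tX mem(2)] C1_on_fst[OF C1_cost[OF t mem(3)] tX mem(2)]
    C1_on_snd[OF C1_dyn[OF t mem(3)] tU mem(1)] C1_on_snd[OF C1_cost[OF t mem(3)] tU mem(1)] by simp_all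

lemma differentiable_dyn_X: "(\<lambda>\<xi>. dyn P t \<xi> v z) differentiable (at x within Xsp P t)"
  and differentiable_cost_X: "(\<lambda>\<xi>. cost P t \<xi> v z) differentiable (at x within Xsp P t)"
  and differentiable_dyn_U: "(\<lambda>\<upsilon>. dyn P t x \<upsilon> z) differentiable (at v within Usp P t)"
  and differentiable_cost_U: "(\<lambda>\<upsilon>. cost P t x \<upsilon> z) differentiable (at v within Usp P t)"
  by (intro C1_on_differentiable C1_dyn_X C1_cost_X C1_dyn_U C1_cost_U mem)+

end

lemma pcost_measurable:
  assumes [measurable]: "X \<in> borel_measurable N" "V \<in> borel_measurable N" "Z \<in> borel_measurable N"
  shows "(\<lambda>p. pcost t (X p) (V p) (Z p)) \<in> borel_measurable N"
proof -
  have "(\<lambda>(z, x, u). cost P t x u z) \<in> borel_measurable (restrict_space borel (Wsp P (Suc t)) \<Otimes>\<^sub>M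
      restrict_space borel (Xsp P t \<times> Usp P t))"
    using normal_integrand_measurable[OF normal_cost[OF t]] .
  moreover have "(\<lambda>p. (pW (Suc t) (Z p), pX t (X p), pU t (V p))) \<in> N \<rightarrow>\<^sub>M
      (restrict_space borel (Wsp P (Suc t)) \<Otimes>\<^sub>M restrict_space borel (Xsp P t \<times> Usp P t))"
    by (intro measurable_Pair measurable_restrict_space2) (auto simp: proj_in_span)
  ultimately have "(\<lambda>p. (\<lambda>(z, x, u). cost P t x u z) (pW (Suc t) (Z p), pX t (X p), pU t (V p))) \<in> borel_measurable N"
    by (rule measurable_compose[rotated])
  then show ?thesis by (simp add: pcost_def)
qed

lemma pdyn_in: "pdyn t x v z \<in> Xsp P (Suc t)"
  using dyn_in[OF t] by (simp add: pdyn_def proj_in_span)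

text \<open>Normality is assumed for the components along \<open>Xcoord P (Suc t)\<close>; the
  remaining ones vanish because the values lie in that coordinate subspace.\<close>

lemma pdyn_measurable:
  assumes [measurable]: "X \<in> borel_measurable N" "V \<in> borel_measurable N" "Z \<in> borel_measurable N"
  shows "(\<lambda>p. pdyn t (X p) (V p) (Z p)) \<in> borel_measurable N"
proof -
  have "(\<lambda>p. pdyn t (X p) (V p) (Z p) \<bullet> b) \<in> borel_measurable N" if "b \<in> Basis" for b
  proof (cases "b \<in> Xcoord P (Suc t)")
    case True
    have "(\<lambda>(z, x, u). dyn P t x u z \<bullet> b) \<in> borel_measurable (restrict_space borel (Wsp P (Suc t)) \<Otimes>\<^sub>M
        restrict_space borel (Xsp P t \<times> Usp P t))"
      using normal_integrand_measurable[OF normal_dyn[OF t True]] .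
    moreover have "(\<lambda>p. (pW (Suc t) (Z p), pX t (X p), pU t (V p))) \<in> N \<rightarrow>\<^sub>M
        (restrict_space borel (Wsp P (Suc t)) \<Otimes>\<^sub>M restrict_space borel (Xsp P t \<times> Usp P t))"
      by (intro measurable_Pair measurable_restrict_space2) (auto simp: proj_in_span)
    ultimately have "(\<lambda>p. (\<lambda>(z, x, u). dyn P t x u z \<bullet> b) (pW (Suc t) (Z p), pX t (X p), pU t (V p))) \<in> borel_measurable N"
      by (rule measurable_compose[rotated])
    then show ?thesis by (simp add: pdyn_def)
  next
    case False
    have sub: "Xcoord P (Suc t) \<subseteq> Basis" using t by (simp add: Xcoord_Basis)
    have "pdyn t x v z \<bullet> b = 0" for x v z
      using proj_id[OF sub pdyn_in, of x v z] inner_proj[OF sub that, of "pdyn t x v z"] False by simp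
    then show ?thesis by simp
  qed
  then show ?thesis by (subst borel_measurable_euclidean_space) blast
qed

lemma gX_measurable:
  assumes [measurable]: "X \<in> borel_measurable N" "V \<in> borel_measurable N" "Z \<in> borel_measurable N"
  shows "(\<lambda>p. gX t (X p) (V p) (Z p)) \<in> borel_measurable N"
  unfolding gX_def
proof (rule grad_on_measurable[OF differentiable_cost_X])
  fix c h
  show "(\<lambda>p. cost P t (pX t (X p) + c *\<^sub>R pX t h) (pU t (V p)) (pW (Suc t) (Z p))) \<in> borel_measurable N"
    using pcost_measurable[of "\<lambda>p. pX t (X p) + c *\<^sub>R pX t h" N V Z]
    by (simp add: pcost_def proj_add proj_scaleR proj_in_span tX)
qed (auto simp: proj_in_span tX)

lemma gU_measurable:
  assumes [measurable]: "X \<in> borel_measurable N" "V \<in> borel_measurable N" "Z \<in> borel_measurable N"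
  shows "(\<lambda>p. gU t (X p) (V p) (Z p)) \<in> borel_measurable N"
  unfolding gU_def
proof (rule grad_on_measurable[OF differentiable_cost_U])
  fix c h
  show "(\<lambda>p. cost P t (pX t (X p)) (pU t (V p) + c *\<^sub>R pU t h) (pW (Suc t) (Z p))) \<in> borel_measurable N"
    using pcost_measurable[of X N "\<lambda>p. pU t (V p) + c *\<^sub>R pU t h" Z]
    by (simp add: pcost_def proj_add proj_scaleR proj_in_span tU)
qed (auto simp: proj_in_span tU)

lemma jX_measurable:
  assumes [measurable]: "X \<in> borel_measurable N" "V \<in> borel_measurable N" "Z \<in> borel_measurable N" "Y \<in> borel_measurable N"
  shows "(\<lambda>p. jX t (X p) (V p) (Z p) (Y p)) \<in> borel_measurable N"
  unfolding jX_def
proof (rule adjoint_deriv_on_measurable[OF differentiable_dyn_X])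
  fix c h
  show "(\<lambda>p. dyn P t (pX t (X p) + c *\<^sub>R pX t h) (pU t (V p)) (pW (Suc t) (Z p))) \<in> borel_measurable N"
    using pdyn_measurable[of "\<lambda>p. pX t (X p) + c *\<^sub>R pX t h" N V Z]
    by (simp add: pdyn_def proj_add proj_scaleR proj_in_span tX)
qed (auto simp: proj_in_span tX)

lemma jU_measurable:
  assumes [measurable]: "X \<in> borel_measurable N" "V \<in> borel_measurable N" "Z \<in> borel_measurable N" "Y \<in> borel_measurable N"
  shows "(\<lambda>p. jU t (X p) (V p) (Z p) (Y p)) \<in> borel_measurable N"
  unfolding jU_def
proof (rule adjoint_deriv_on_measurable[OF differentiable_dyn_U])
  fix c h
  show "(\<lambda>p. dyn P t (pX t (X p)) (pU t (V p) + c *\<^sub>R pU t h) (pW (Suc t) (Z p))) \<in> borel_measurable N"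
    using pdyn_measurable[of X N "\<lambda>p. pU t (V p) + c *\<^sub>R pU t h" Z]
    by (simp add: pdyn_def proj_add proj_scaleR proj_in_span tU)
qed (auto simp: proj_in_span tU)

lemma continuous_gX:
  assumes "v \<in> Usp P t" "z \<in> Wsp P (Suc t)"
  shows "continuous_on (Xsp P t) (\<lambda>x. gX t x v z)"
  using continuous_on_grad_on[OF C1_cost_X[OF span_zero assms(1,2)] tX] assms t
  by (simp add: gX_def pX_id pU_id pW_id cong: continuous_on_cong)

lemma continuous_jX:
  assumes "v \<in> Usp P t" "z \<in> Wsp P (Suc t)" "continuous_on (Xsp P t) y"
  shows "continuous_on (Xsp P t) (\<lambda>x. jX t x v z (y x))"
  using continuous_on_adjoint_deriv_on[OF C1_dyn_X[OF span_zero assms(1,2)] tX assms(3)] assms t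
  by (simp add: jX_def pX_id pU_id pW_id cong: continuous_on_cong)

lemma continuous_gU:
  assumes "x \<in> Xsp P t" "z \<in> Wsp P (Suc t)"
  shows "continuous_on (Usp P t) (\<lambda>v. gU t x v z)"
  using continuous_on_grad_on[OF C1_cost_U[OF assms(1) span_zero assms(2)] tU] assms t
  by (simp add: gU_def pX_id pU_id pW_id cong: continuous_on_cong)

lemma continuous_jU:
  assumes "x \<in> Xsp P t" "z \<in> Wsp P (Suc t)" "continuous_on (Usp P t) y"
  shows "continuous_on (Usp P t) (\<lambda>v. jU t x v z (y v))"
  using continuous_on_adjoint_deriv_on[OF C1_dyn_U[OF assms(1) span_zero assms(2)] tU assms(3)] assms t
  by (simp add: jU_def pX_id pU_id pW_id cong: continuous_on_cong)

end

lemma gK_in: "gK x \<in> Xsp P T"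
  unfolding gK_def by (intro grad_on_in_span differentiable_final) (auto simp: Xcoord_Basis proj_in_span)

lemma gX_in: "t < T \<Longrightarrow> gX t x v z \<in> Xsp P t"
  unfolding gX_def by (intro grad_on_in_span differentiable_cost_X) (auto simp: Xcoord_Basis proj_in_span)

lemma jX_in: "t < T \<Longrightarrow> jX t x v z y \<in> Xsp P t"
  unfolding jX_def by (intro adjoint_deriv_on_in_span differentiable_dyn_X) (auto simp: Xcoord_Basis proj_in_span)

lemma gU_in: "t < T \<Longrightarrow> gU t x v z \<in> Usp P t"
  unfolding gU_def by (intro grad_on_in_span differentiable_cost_U) (auto simp: Ucoord_Basis proj_in_span)

lemma jU_in: "t < T \<Longrightarrow> jU t x v z y \<in> Usp P t"
  unfolding jU_def by (intro adjoint_deriv_on_in_span differentiable_dyn_U) (auto simp: Ucoord_Basis proj_in_span)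

lemma continuous_final: "continuous_on (Xsp P T) (final_cost P)"
  using C1_final by (auto simp: C1_on_def intro: differentiable_imp_continuous_on)

lemma pfinal_measurable [measurable]: "pfinal \<in> borel_measurable borel"
proof -
  have "final_cost P \<in> borel_measurable (restrict_space borel (Xsp P T))"
    using continuous_final by (rule borel_measurable_continuous_on_restrict)
  moreover have "pX T \<in> borel \<rightarrow>\<^sub>M restrict_space borel (Xsp P T)"
    by (intro measurable_restrict_space2) (auto simp: proj_in_span)
  ultimately show ?thesis unfolding pfinal_def by (rule measurable_compose[rotated])
qed

lemma continuous_gK: "continuous_on (Xsp P T) gK"
  using continuous_on_grad_on[OF C1_final Xcoord_Basis]
  by (rule continuous_on_cong[THEN iffD1, rotated 2]) (simp_all add: gK_def pX_id)

lemma gK_measurable [measurable]: "gK \<in> borel_measurable borel"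
proof -
  have "gK \<in> borel_measurable (restrict_space borel (Xsp P T))"
    using continuous_gK by (rule borel_measurable_continuous_on_restrict)
  moreover have "pX T \<in> borel \<rightarrow>\<^sub>M restrict_space borel (Xsp P T)"
    by (intro measurable_restrict_space2) (auto simp: proj_in_span)
  ultimately have "(\<lambda>x. gK (pX T x)) \<in> borel_measurable borel" by (rule measurable_compose[rotated])
  then show ?thesis by (simp add: gK_def[abs_def] Xcoord_Basis)
qed

text \<open>The policy \<open>\<pi>\<close> maps time and state to a control. The co-state recursion differentiates with
  the control value held fixed, so \<open>costate\<close> is the gradient of \<open>cost_to_go\<close> only for open-loop policies.\<close>

function cost_to_go ::
  "(nat \<Rightarrow> 'e \<Rightarrow> 'e \<Rightarrow> 'e \<Rightarrow> real) \<Rightarrow> ('e \<Rightarrow> real) \<Rightarrow> (nat \<Rightarrow> 'e \<Rightarrow> 'e) \<Rightarrow> (nat \<Rightarrow> 'e) \<Rightarrow> nat \<Rightarrow> 'e \<Rightarrow> real" where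
  "cost_to_go L K \<pi> w t x =
     (if t < T then L t x (\<pi> t x) (w (Suc t)) + cost_to_go L K \<pi> w (Suc t) (pdyn t x (\<pi> t x) (w (Suc t)))
      else K x)"
  by pat_completeness auto
termination by (relation "Wellfounded.measure (\<lambda>(L, K, \<pi>, w, t, x). T - t)") auto

function costate :: "(nat \<Rightarrow> 'e \<Rightarrow> 'e) \<Rightarrow> (nat \<Rightarrow> 'e) \<Rightarrow> nat \<Rightarrow> 'e \<Rightarrow> 'e" where
  "costate \<pi> w t x =
     (if t < T then gX t x (\<pi> t x) (w (Suc t))
        + jX t x (\<pi> t x) (w (Suc t)) (costate \<pi> w (Suc t) (pdyn t x (\<pi> t x) (w (Suc t))))
      else gK x)"
  by pat_completeness auto
termination by (relation "Wellfounded.measure (\<lambda>(\<pi>, w, t, x). T - t)") auto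

declare cost_to_go.simps [simp del] costate.simps [simp del]

primrec state_path :: "(nat \<Rightarrow> 'e \<Rightarrow> 'e) \<Rightarrow> (nat \<Rightarrow> 'e) \<Rightarrow> nat \<Rightarrow> 'e" where
  "state_path \<pi> w 0 = w 0"
| "state_path \<pi> w (Suc t) = pdyn t (state_path \<pi> w t) (\<pi> t (state_path \<pi> w t)) (w (Suc t))"

abbreviation "open_loop u \<equiv> (\<lambda>s (_ :: 'e). u s)"

lemma cost_to_go_T [simp]: "cost_to_go L K \<pi> w T x = K x"
  by (simp add: cost_to_go.simps)

lemma costate_T [simp]: "costate \<pi> w T x = gK x"
  by (simp add: costate.simps)

lemma cost_to_go_step: "t < T \<Longrightarrow> cost_to_go L K \<pi> w t x =
    L t x (\<pi> t x) (w (Suc t)) + cost_to_go L K \<pi> w (Suc t) (pdyn t x (\<pi> t x) (w (Suc t)))"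
  by (subst cost_to_go.simps) simp

lemma costate_step: "t < T \<Longrightarrow> costate \<pi> w t x = gX t x (\<pi> t x) (w (Suc t))
    + jX t x (\<pi> t x) (w (Suc t)) (costate \<pi> w (Suc t) (pdyn t x (\<pi> t x) (w (Suc t))))"
  by (subst costate.simps) simp

text \<open>Neither the policy before \<open>t\<close> nor the noise up to \<open>t\<close> enters.
  This permits replacing the whole noise by \<open>future t\<close>, and a modified policy by its
  unmodified tail.\<close>

lemma cost_to_go_cong:
  assumes "t \<le> T" "\<And>s. t \<le> s \<Longrightarrow> s < T \<Longrightarrow> \<pi> s = \<pi>' s" "\<And>s. t < s \<Longrightarrow> s \<le> T \<Longrightarrow> w s = w' s"
  shows "cost_to_go L K \<pi> w t x = cost_to_go L K \<pi>' w' t x"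
  using assms by (induction arbitrary: x rule: inc_induct) (simp_all add: cost_to_go_step)

lemma costate_cong:
  assumes "t \<le> T" "\<And>s. t \<le> s \<Longrightarrow> s < T \<Longrightarrow> \<pi> s = \<pi>' s" "\<And>s. t < s \<Longrightarrow> s \<le> T \<Longrightarrow> w s = w' s"
  shows "costate \<pi> w t x = costate \<pi>' w' t x"
  using assms by (induction arbitrary: x rule: inc_induct) (simp_all add: costate_step)

text \<open>Agreement is demanded only at the states visited, so a feedback and the open-loop
  controls that it generates produce the same path.\<close>

lemma state_path_cong:
  assumes "\<And>s. s < t \<Longrightarrow> \<pi> s (state_path \<pi> w s) = \<pi>' s (state_path \<pi> w s)" "\<And>s. s \<le> t \<Longrightarrow> w s = w' s"
  shows "state_path \<pi> w t = state_path \<pi>' w' t"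
  using assms
proof (induction t)
  case (Suc t)
  have "state_path \<pi> w t = state_path \<pi>' w' t" using Suc by simp
  moreover have "\<pi> t (state_path \<pi> w t) = \<pi>' t (state_path \<pi> w t)" "w (Suc t) = w' (Suc t)"
    by (rule Suc.prems, simp)+
  ultimately show ?case by simp
qed simp

lemma state_path_in: "t \<le> T \<Longrightarrow> w 0 \<in> Wsp P 0 \<Longrightarrow> state_path \<pi> w t \<in> Xsp P t"
  by (cases t) (auto simp: pdyn_in Wcoord_0)

lemma cost_to_go_state_path:
  assumes "t \<le> T"
  shows "(\<Sum>s<T. L s (state_path \<pi> w s) (\<pi> s (state_path \<pi> w s)) (w (Suc s))) + K (state_path \<pi> w T) =
    (\<Sum>s<t. L s (state_path \<pi> w s) (\<pi> s (state_path \<pi> w s)) (w (Suc s))) + cost_to_go L K \<pi> w t (state_path \<pi> w t)"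
  using assms by (induction rule: inc_induct) (simp_all add: cost_to_go_step)

lemma trajectory_eq_path:
  assumes "t \<le> T" "\<And>s. s < t \<Longrightarrow> u s \<in> Usp P s" "\<And>s. s \<le> t \<Longrightarrow> w s \<in> Wsp P s"
  shows "trajectory P u w t = state_path (open_loop u) w t"
  using assms
proof (induction t)
  case (Suc t)
  have "state_path (open_loop u) w t \<in> Xsp P t" using Suc.prems by (intro state_path_in) auto
  then show ?case using Suc by (simp add: pdyn_def pX_id pU_id pW_id)
qed simp

lemma reduced_cost_eq:
  assumes "\<And>s. s < T \<Longrightarrow> u s \<in> Usp P s" "\<And>s. s \<le> T \<Longrightarrow> w s \<in> Wsp P s"
  shows "reduced_cost P u w = cost_to_go pcost pfinal (open_loop u) w 0 (w 0)"
proof -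
  have p: "state_path (open_loop u) w t \<in> Xsp P t" if "t \<le> T" for t using that assms by (intro state_path_in) auto
  have "reduced_cost P u w = (\<Sum>s<T. pcost s (state_path (open_loop u) w s) (u s) (w (Suc s))) + pfinal (state_path (open_loop u) w T)"
    using assms p by (simp add: reduced_cost_def trajectory_eq_path pcost_def pfinal_def pX_id pU_id pW_id)
  then show ?thesis using cost_to_go_state_path[of 0 pcost "open_loop u" w pfinal] by simp
qed

lemma pcost_eq: "t < T \<Longrightarrow> x \<in> Xsp P t \<Longrightarrow> v \<in> Usp P t \<Longrightarrow> z \<in> Wsp P (Suc t) \<Longrightarrow> pcost t x v z = cost P t x v z"
  and pdyn_eq: "t < T \<Longrightarrow> x \<in> Xsp P t \<Longrightarrow> v \<in> Usp P t \<Longrightarrow> z \<in> Wsp P (Suc t) \<Longrightarrow> pdyn t x v z = dyn P t x v z"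
  by (simp_all add: pcost_def pdyn_def pX_id pU_id pW_id)

lemma costate_in: "t \<le> T \<Longrightarrow> costate \<pi> w t x \<in> Xsp P t"
  by (cases "t = T") (auto simp: gK_in costate_step intro!: span_add gX_in jX_in)

text \<open>Backward chain rule: each step adds a stage cost and composes with the dynamics.
  Continuity of the gradient is carried along because the later domination of difference quotients
  rests on a maximum over a segment.\<close>

lemma cost_to_go_derivative:
  assumes "t \<le> T" "\<And>s. t \<le> s \<Longrightarrow> s < T \<Longrightarrow> u s \<in> Usp P s" "\<And>s. t < s \<Longrightarrow> s \<le> T \<Longrightarrow> w s \<in> Wsp P s"
  shows "(\<forall>x\<in>Xsp P t. (cost_to_go pcost pfinal (open_loop u) w t has_derivative
      (\<lambda>h. costate (open_loop u) w t x \<bullet> h)) (at x within Xsp P t)) \<and>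
    continuous_on (Xsp P t) (costate (open_loop u) w t)"
  using assms
proof (induction rule: inc_induct)
  case base
  have "(cost_to_go pcost pfinal (open_loop u) w T has_derivative
      (\<lambda>h. costate (open_loop u) w T x \<bullet> h)) (at x within Xsp P T)" if x: "x \<in> Xsp P T" for x
  proof -
    have "deriv_on (Xsp P T) (final_cost P) x = (\<lambda>h. gK x \<bullet> h)"
      using deriv_on_eq_grad_inner[OF differentiable_final[OF x] Xcoord_Basis x]
      by (simp add: gK_def pX_id x fun_eq_iff)
    then have "(final_cost P has_derivative (\<lambda>h. gK x \<bullet> h)) (at x within Xsp P T)"
      using has_derivative_deriv_on[OF differentiable_final[OF x] Xcoord_Basis x] by simp
    then show ?thesis
      unfolding costate_T by (rule has_derivative_transform[OF x, rotated]) (simp add: pfinal_def pX_id)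
  qed
  moreover have "costate (open_loop u) w T = gK" "cost_to_go pcost pfinal (open_loop u) w T = pfinal"
    by (simp_all add: fun_eq_iff)
  ultimately show ?case using continuous_gK by simp
next
  case (step t)
  have u: "u t \<in> Usp P t" and z: "w (Suc t) \<in> Wsp P (Suc t)" and t: "t < T"
    using step by auto
  let ?V = "cost_to_go pcost pfinal (open_loop u) w (Suc t)" and ?l = "costate (open_loop u) w (Suc t)"
  let ?f = "\<lambda>\<xi>. dyn P t \<xi> (u t) (w (Suc t))"
  have IH: "\<And>x. x \<in> Xsp P (Suc t) \<Longrightarrow> (?V has_derivative (\<lambda>h. ?l x \<bullet> h)) (at x within Xsp P (Suc t))"
    "continuous_on (Xsp P (Suc t)) ?l"
    using step by auto
  have f: "?f ` Xsp P t \<subseteq> Xsp P (Suc t)" using dyn_in[OF t _ u z] by blast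
  have pf: "pdyn t x (u t) (w (Suc t)) = ?f x" if "x \<in> Xsp P t" for x
    using that u z t by (simp add: pdyn_def pX_id pU_id pW_id)
  have "(cost_to_go pcost pfinal (open_loop u) w t has_derivative
      (\<lambda>h. costate (open_loop u) w t x \<bullet> h)) (at x within Xsp P t)" if x: "x \<in> Xsp P t" for x
  proof -
    have "((\<lambda>\<xi>. cost P t \<xi> (u t) (w (Suc t)) + ?V (?f \<xi>)) has_derivative
      (\<lambda>h. (grad_on (Xsp P t) (\<lambda>\<xi>. cost P t \<xi> (u t) (w (Suc t))) x + adjoint (deriv_on (Xsp P t) ?f x) (?l (?f x))) \<bullet> h))
      (at x within Xsp P t)"
      by (rule has_derivative_cost_plus_compose[OF tX[OF t] x differentiable_cost_X[OF t x u z]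
            differentiable_dyn_X[OF t x u z] IH(1) f])
        (use f x in blast)
    also have "grad_on (Xsp P t) (\<lambda>\<xi>. cost P t \<xi> (u t) (w (Suc t))) x + adjoint (deriv_on (Xsp P t) ?f x) (?l (?f x))
        = costate (open_loop u) w t x"
      using t x u z by (simp add: costate_step pf gX_def jX_def pX_id pU_id pW_id)
    finally show ?thesis
      by (rule has_derivative_transform[OF x, rotated])
        (use t u z in \<open>simp add: cost_to_go_step pcost_eq pdyn_eq\<close>)
  qed
  moreover have "continuous_on (Xsp P t) (costate (open_loop u) w t)"
  proof -
    have "continuous_on (Xsp P t) ?f"
      by (rule differentiable_imp_continuous_on)
        (simp add: differentiable_on_def differentiable_dyn_X[OF t _ u z])
    then have "continuous_on (Xsp P t) (\<lambda>x. ?l (?f x))"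
      by (rule continuous_on_compose2[OF IH(2) _ f])
    then have "continuous_on (Xsp P t) (\<lambda>x. gX t x (u t) (w (Suc t)) + jX t x (u t) (w (Suc t)) (?l (?f x)))"
      by (intro continuous_on_add continuous_gX continuous_jX t u z)
    then show ?thesis
      by (rule continuous_on_cong[THEN iffD1, rotated 2]) (simp_all add: costate_step t pf)
  qed
  ultimately show ?case by blast
qed

text \<open>The gradient of the total cost in the control at time \<open>t\<close>, as earlier costs
  do not depend on that control. Its value \<open>v\<close> is a separate argument because the
  gradient is needed along whole segments; \<open>u\<close> enters only after
  \<open>t\<close>.\<close>

definition cgrad :: "(nat \<Rightarrow> 'e) \<Rightarrow> (nat \<Rightarrow> 'e) \<Rightarrow> nat \<Rightarrow> 'e \<Rightarrow> 'e \<Rightarrow> 'e" where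
  "cgrad u w t x v = gU t x v (w (Suc t)) + jU t x v (w (Suc t)) (costate (open_loop u) w (Suc t) (pdyn t x v (w (Suc t))))"

lemma cgrad_in: "t < T \<Longrightarrow> cgrad u w t x v \<in> Usp P t"
  unfolding cgrad_def by (intro span_add gU_in jU_in)

lemma control_derivative:
  assumes t: "t < T" and x: "x \<in> Xsp P t" and v: "v \<in> Usp P t"
    and u: "\<And>s. t < s \<Longrightarrow> s < T \<Longrightarrow> u s \<in> Usp P s" and w: "\<And>s. t < s \<Longrightarrow> s \<le> T \<Longrightarrow> w s \<in> Wsp P s"
  shows "((\<lambda>v. pcost t x v (w (Suc t)) + cost_to_go pcost pfinal (open_loop u) w (Suc t) (pdyn t x v (w (Suc t))))
      has_derivative (\<lambda>h. cgrad u w t x v \<bullet> h)) (at v within Usp P t)"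
    and "continuous_on (Usp P t) (cgrad u w t x)"
proof -
  let ?V = "cost_to_go pcost pfinal (open_loop u) w (Suc t)" and ?l = "costate (open_loop u) w (Suc t)"
  let ?f = "\<lambda>v. dyn P t x v (w (Suc t))"
  have z: "w (Suc t) \<in> Wsp P (Suc t)" using w t by simp
  have IH: "\<And>x. x \<in> Xsp P (Suc t) \<Longrightarrow> (?V has_derivative (\<lambda>h. ?l x \<bullet> h)) (at x within Xsp P (Suc t))"
    "continuous_on (Xsp P (Suc t)) ?l"
    using cost_to_go_derivative[of "Suc t" u w] t u w by auto
  have f: "?f ` Usp P t \<subseteq> Xsp P (Suc t)" using dyn_in[OF t x _ z] by blast
  have pf: "pdyn t x v (w (Suc t)) = ?f v" if "v \<in> Usp P t" for v
    using that x z t by (simp add: pdyn_def pX_id pU_id pW_id)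
  have "((\<lambda>v. cost P t x v (w (Suc t)) + ?V (?f v)) has_derivative
      (\<lambda>h. (grad_on (Usp P t) (\<lambda>v. cost P t x v (w (Suc t))) v + adjoint (deriv_on (Usp P t) ?f v) (?l (?f v))) \<bullet> h))
      (at v within Usp P t)"
    by (rule has_derivative_cost_plus_compose[OF tU[OF t] v differentiable_cost_U[OF t x v z]
          differentiable_dyn_U[OF t x v z] IH(1) f])
      (use f v in blast)
  also have "grad_on (Usp P t) (\<lambda>v. cost P t x v (w (Suc t))) v + adjoint (deriv_on (Usp P t) ?f v) (?l (?f v))
      = cgrad u w t x v"
    using t x v z by (simp add: cgrad_def pf gU_def jU_def pX_id pU_id pW_id)
  finally show "((\<lambda>v. pcost t x v (w (Suc t)) + ?V (pdyn t x v (w (Suc t))))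
      has_derivative (\<lambda>h. cgrad u w t x v \<bullet> h)) (at v within Usp P t)"
    by (rule has_derivative_transform[OF v, rotated])
      (use t x z in \<open>simp add: pcost_eq pdyn_eq\<close>)
  have "continuous_on (Usp P t) ?f"
    by (rule differentiable_imp_continuous_on)
      (simp add: differentiable_on_def differentiable_dyn_U[OF t x _ z])
  then have "continuous_on (Usp P t) (\<lambda>v. ?l (?f v))"
    by (rule continuous_on_compose2[OF IH(2) _ f])
  then have "continuous_on (Usp P t) (\<lambda>v. gU t x v (w (Suc t)) + jU t x v (w (Suc t)) (?l (?f v)))"
    by (intro continuous_on_add continuous_gU continuous_jU t x z)
  then show "continuous_on (Usp P t) (cgrad u w t x)"
    by (rule continuous_on_cong[THEN iffD1, rotated 2]) (simp_all add: cgrad_def t pf)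
qed

text \<open>Isolates the bracketed part, the only one that depends on \<open>v\<close> and the one
  differentiated in \<open>control_derivative\<close>.\<close>

lemma reduced_cost_update:
  assumes t: "t < T" and u: "\<And>s. s < T \<Longrightarrow> u s \<in> Usp P s" and w: "\<And>s. s \<le> T \<Longrightarrow> w s \<in> Wsp P s"
    and v: "v \<in> Usp P t"
  shows "reduced_cost P (u(t := v)) w = (\<Sum>s<t. pcost s (trajectory P u w s) (u s) (w (Suc s)))
    + (pcost t (trajectory P u w t) v (w (Suc t))
       + cost_to_go pcost pfinal (open_loop u) w (Suc t) (pdyn t (trajectory P u w t) v (w (Suc t))))"
proof -
  define u' where "u' = u(t := v)"
  have u't: "u' t = v" and u's: "s \<noteq> t \<Longrightarrow> u' s = u s" for s by (simp_all add: u'_def)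
  have u': "u' s \<in> Usp P s" if "s < T" for s using u v that by (simp add: u'_def)
  have p: "state_path (open_loop u') w s = trajectory P u w s" if "s \<le> t" for s
  proof -
    have "trajectory P u w s = state_path (open_loop u) w s"
      using that t u w by (intro trajectory_eq_path) auto
    also have "\<dots> = state_path (open_loop u') w s" using that by (intro state_path_cong) (auto simp: u's)
    finally show ?thesis ..
  qed
  have "reduced_cost P u' w = (\<Sum>s<t. pcost s (state_path (open_loop u') w s) (u' s) (w (Suc s)))
      + cost_to_go pcost pfinal (open_loop u') w t (state_path (open_loop u') w t)"
    using reduced_cost_eq[of u' w] u' w cost_to_go_state_path[of t pcost "open_loop u'" w pfinal]
      cost_to_go_state_path[of 0 pcost "open_loop u'" w pfinal] t by simp
  also have "(\<Sum>s<t. pcost s (state_path (open_loop u') w s) (u' s) (w (Suc s)))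
      = (\<Sum>s<t. pcost s (trajectory P u w s) (u s) (w (Suc s)))"
    by (intro sum.cong) (auto simp: p u's)
  also have "cost_to_go pcost pfinal (open_loop u') w t (state_path (open_loop u') w t) =
      pcost t (trajectory P u w t) v (w (Suc t))
       + cost_to_go pcost pfinal (open_loop u') w (Suc t) (pdyn t (trajectory P u w t) v (w (Suc t)))"
    using t by (simp add: cost_to_go_step p u't)
  also have "cost_to_go pcost pfinal (open_loop u') w (Suc t) = cost_to_go pcost pfinal (open_loop u) w (Suc t)"
    using t by (intro ext cost_to_go_cong) (auto simp: u's)
  finally show ?thesis unfolding u'_def .
qed

section \<open>Measurable dependence of costs and co-states on a parameter\<close>

context
  fixes N :: "'p measure" and \<pi> :: "'p \<Rightarrow> nat \<Rightarrow> 'e \<Rightarrow> 'e" and w :: "'p \<Rightarrow> nat \<Rightarrow> 'e" and t :: nat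
  assumes pol: "\<And>s Y. t \<le> s \<Longrightarrow> s < T \<Longrightarrow> Y \<in> borel_measurable N \<Longrightarrow> (\<lambda>p. \<pi> p s (Y p)) \<in> borel_measurable N"
    and noi: "\<And>s. t < s \<Longrightarrow> s \<le> T \<Longrightarrow> (\<lambda>p. w p s) \<in> borel_measurable N"
begin

lemma cost_to_go_measurable:
  assumes L: "\<And>s X V Z. s < T \<Longrightarrow> X \<in> borel_measurable N \<Longrightarrow> V \<in> borel_measurable N \<Longrightarrow> Z \<in> borel_measurable N
      \<Longrightarrow> (\<lambda>p. L s (X p) (V p) (Z p)) \<in> borel_measurable N"
    and K [measurable]: "K \<in> borel_measurable borel" and "t \<le> s" "s \<le> T" "Y \<in> borel_measurable N"
  shows "(\<lambda>p. cost_to_go L K (\<pi> p) (w p) s (Y p)) \<in> borel_measurable N"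
  using assms(4,3,5)
proof (induction arbitrary: Y rule: inc_induct)
  case base
  then show ?case by simp
next
  case (step s)
  have [measurable]: "Y \<in> borel_measurable N" "(\<lambda>p. \<pi> p s (Y p)) \<in> borel_measurable N" "(\<lambda>p. w p (Suc s)) \<in> borel_measurable N"
    using step pol noi by auto
  have "(\<lambda>p. cost_to_go L K (\<pi> p) (w p) (Suc s) (pdyn s (Y p) (\<pi> p s (Y p)) (w p (Suc s)))) \<in> borel_measurable N"
    using step by (intro step.IH pdyn_measurable) auto
  moreover have "(\<lambda>p. L s (Y p) (\<pi> p s (Y p)) (w p (Suc s))) \<in> borel_measurable N"
    using step by (intro L) auto
  ultimately show ?case using step by (simp add: cost_to_go_step)
qed

text \<open>The policy may depend on the parameter. This covers open-loop controls, where the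
  parameter is the sample point, as well as deterministic feedbacks.\<close>

lemma costate_measurable:
  assumes "t \<le> s" "s \<le> T" "Y \<in> borel_measurable N"
  shows "(\<lambda>p. costate (\<pi> p) (w p) s (Y p)) \<in> borel_measurable N"
  using assms(2,1,3)
proof (induction arbitrary: Y rule: inc_induct)
  case base
  then show ?case by simp
next
  case (step s)
  have [measurable]: "Y \<in> borel_measurable N" "(\<lambda>p. \<pi> p s (Y p)) \<in> borel_measurable N" "(\<lambda>p. w p (Suc s)) \<in> borel_measurable N"
    using step pol noi by auto
  have "(\<lambda>p. costate (\<pi> p) (w p) (Suc s) (pdyn s (Y p) (\<pi> p s (Y p)) (w p (Suc s)))) \<in> borel_measurable N"
    using step by (intro step.IH pdyn_measurable) auto
  then have "(\<lambda>p. gX s (Y p) (\<pi> p s (Y p)) (w p (Suc s)) + jX s (Y p) (\<pi> p s (Y p)) (w p (Suc s))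
      (costate (\<pi> p) (w p) (Suc s) (pdyn s (Y p) (\<pi> p s (Y p)) (w p (Suc s))))) \<in> borel_measurable N"
    using step by (intro borel_measurable_add gX_measurable jX_measurable) auto
  then show ?case using step by (simp add: costate_step)
qed

end

lemma state_path_measurable:
  assumes pol: "\<And>s Y. s < t \<Longrightarrow> Y \<in> borel_measurable N \<Longrightarrow> (\<lambda>p. \<pi> p s (Y p)) \<in> borel_measurable N"
    and noi: "\<And>s. s \<le> t \<Longrightarrow> (\<lambda>p. w p s) \<in> borel_measurable N" and t: "t \<le> T"
  shows "(\<lambda>p. state_path (\<pi> p) (w p) t) \<in> borel_measurable N"
  using assms
proof (induction t)
  case (Suc t)
  then show ?case by (auto intro!: pdyn_measurable)
qed simp

end

section \<open>The Markovian problem\<close>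

locale markov_control = smooth_control P
  for P :: "('a, 'e::euclidean_space) control_problem" +
  assumes cc: "closed_convex_constraints P" and sqd: "sq_integrable_derivatives P" and markov: "markovian P"
begin

abbreviation "nz \<omega> \<equiv> (\<lambda>s. noise P s \<omega>)"
abbreviation "ctrl u \<omega> \<equiv> (\<lambda>s. u s \<omega>)"
abbreviation "traj u \<equiv> (\<lambda>t \<omega>. trajectory P (\<lambda>s. u s \<omega>) (\<lambda>s. noise P s \<omega>) t)"
abbreviation "grad_at u \<equiv> (\<lambda>t \<omega>. cgrad (\<lambda>s. u s \<omega>) (\<lambda>s. noise P s \<omega>) t
  (trajectory P (\<lambda>s. u s \<omega>) (\<lambda>s. noise P s \<omega>) t))"
abbreviation "future t \<omega> \<equiv> (\<lambda>s\<in>{Suc t..T}. noise P s \<omega>)"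
abbreviation "future_alg t \<equiv> PiM {Suc t..T} (\<lambda>_. borel :: 'e measure)"
abbreviation "future_law t \<equiv> distr M (future_alg t) (future t)"

lemma controlsD:
  assumes "u \<in> controls P" "t < T"
  shows "u t \<in> L2 M (Usp P t)" "u t \<in> borel_measurable M" "sq_integrable M (u t)"
    "\<And>\<omega>. \<omega> \<in> space M \<Longrightarrow> u t \<omega> \<in> Usp P t"
  using assms by (auto simp: controls_def L2_def rv_def)

lemma controls_update: "u \<in> controls P \<Longrightarrow> v \<in> L2 M (Usp P t) \<Longrightarrow> u(t := v) \<in> controls P"
  by (simp add: controls_def)

lemma statesD:
  assumes "x \<in> states P" "t \<le> T"
  shows "x t \<in> borel_measurable M" "\<And>\<omega>. \<omega> \<in> space M \<Longrightarrow> x t \<omega> \<in> Xsp P t"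
  using assms by (auto simp: states_def rv_def)

lemma trajectory_in:
  assumes "t < T" "\<omega> \<in> space M" "x \<in> states P" "u \<in> controls P"
  shows "x t \<omega> \<in> Xsp P t" "u t \<omega> \<in> Usp P t" "noise P (Suc t) \<omega> \<in> Wsp P (Suc t)"
  using statesD(2)[OF assms(3) _ assms(2)] controlsD(4)[OF assms(4,1,2)] noise_in[OF _ assms(2)] assms(1) by auto

lemma traj_eq_state_path:
  assumes "u \<in> controls P" "\<omega> \<in> space M" "t \<le> T"
  shows "traj u t \<omega> = state_path (open_loop (ctrl u \<omega>)) (nz \<omega>) t"
  using assms by (intro trajectory_eq_path) (auto simp: controlsD noise_in)

lemma traj_states: "u \<in> controls P \<Longrightarrow> traj u \<in> states P"
proof -
  assume u: "u \<in> controls P"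
  have "traj u t \<in> borel_measurable M" if "t \<le> T" for t
  proof -
    have "(\<lambda>\<omega>. state_path (open_loop (ctrl u \<omega>)) (nz \<omega>) t) \<in> borel_measurable M"
      using that by (intro state_path_measurable) (auto simp: controlsD[OF u] noise_measurable)
    then show ?thesis using traj_eq_state_path[OF u _ that] by (simp cong: measurable_cong)
  qed
  moreover have "traj u t \<omega> \<in> Xsp P t" if "t \<le> T" "\<omega> \<in> space M" for t \<omega>
    using traj_eq_state_path[OF u that(2,1)] state_path_in[OF that(1)] noise_in[of 0 \<omega>] that by simp
  ultimately show ?thesis by (auto simp: states_def rv_def)
qed

lemma traj_state_eqs: "state_eqs P u (traj u)"
  by (simp add: state_eqs_def)

text \<open>State processes for the same control agree almost surely with the recursion
  \<open>traj\<close>, which holds at every sample point. As the horizon is finite, one null set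
  serves all times.\<close>

lemma state_eqs_AE:
  assumes "state_eqs P u x"
  shows "AE \<omega> in M. \<forall>t\<le>T. x t \<omega> = traj u t \<omega>"
proof -
  have "AE \<omega> in M. x t \<omega> = traj u t \<omega>" if "t \<le> T" for t
    using that
  proof (induction t)
    case 0
    then show ?case using assms by (simp add: state_eqs_def)
  next
    case (Suc t)
    then have "AE \<omega> in M. x t \<omega> = traj u t \<omega>"
      "AE \<omega> in M. x (Suc t) \<omega> = dyn P t (x t \<omega>) (u t \<omega>) (noise P (Suc t) \<omega>)"
      using assms by (auto simp: state_eqs_def)
    then show ?case by eventually_elim simp
  qed
  then have "AE \<omega> in M. \<forall>t\<in>{..T}. x t \<omega> = traj u t \<omega>"
    by (intro AE_finite_allI) auto
  then show ?thesis by eventually_elim auto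
qed

lemma integrable_reduced_cost:
  "u \<in> controls P \<Longrightarrow> integrable M (\<lambda>\<omega>. reduced_cost P (ctrl u \<omega>) (nz \<omega>))"
  using sqd by (simp add: sq_integrable_derivatives_def)

lemma expected_cost_eq:
  assumes u: "u \<in> controls P" and x: "x \<in> states P" and eqs: "state_eqs P u x"
  shows "expected_cost P u x = (\<integral>\<omega>. reduced_cost P (ctrl u \<omega>) (nz \<omega>) \<partial>M)"
  unfolding expected_cost_def
proof (rule integral_cong_AE)
  show "AE \<omega> in M. (\<Sum>t<T. cost P t (x t \<omega>) (u t \<omega>) (noise P (Suc t) \<omega>)) + final_cost P (x T \<omega>)
      = reduced_cost P (ctrl u \<omega>) (nz \<omega>)"
    using state_eqs_AE[OF eqs] by eventually_elim (simp add: reduced_cost_def)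
  show "(\<lambda>\<omega>. reduced_cost P (ctrl u \<omega>) (nz \<omega>)) \<in> borel_measurable M"
    using integrable_reduced_cost[OF u] by simp
  have [measurable]: "x T \<in> borel_measurable M" using statesD[OF x] by simp
  have "(\<lambda>\<omega>. (\<Sum>t<T. pcost t (x t \<omega>) (u t \<omega>) (noise P (Suc t) \<omega>)) + pfinal (x T \<omega>)) \<in> borel_measurable M"
    by (intro borel_measurable_add borel_measurable_sum pcost_measurable)
      (auto simp: statesD[OF x] controlsD[OF u] noise_measurable)
  moreover have "(\<Sum>t<T. pcost t (x t \<omega>) (u t \<omega>) (noise P (Suc t) \<omega>)) + pfinal (x T \<omega>)
      = (\<Sum>t<T. cost P t (x t \<omega>) (u t \<omega>) (noise P (Suc t) \<omega>)) + final_cost P (x T \<omega>)" if "\<omega> \<in> space M" for \<omega>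
    using that by (simp add: pcost_eq statesD[OF x] controlsD[OF u] noise_in pfinal_def pX_id)
  ultimately show "(\<lambda>\<omega>. (\<Sum>t<T. cost P t (x t \<omega>) (u t \<omega>) (noise P (Suc t) \<omega>)) + final_cost P (x T \<omega>)) \<in> borel_measurable M"
    by (simp cong: measurable_cong)
qed

subsection \<open>Filtration and constraints\<close>

lemma noise_vector_measurable: "t \<le> T \<Longrightarrow> (\<lambda>\<omega>. \<lambda>s\<in>{..t}. noise P s \<omega>) \<in> M \<rightarrow>\<^sub>M PiM {..t} (\<lambda>_. borel)"
  by (intro measurable_restrict) (auto simp: noise_measurable)

lemma future_measurable [measurable]: "future t \<in> M \<rightarrow>\<^sub>M future_alg t"
  by (intro measurable_restrict) (auto simp: noise_measurable)

lemma subalgebra_noise_alg: "t \<le> T \<Longrightarrow> subalgebra M (noise_alg P t)"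
  unfolding noise_alg_def by (intro subalgebra_sigma_gen noise_vector_measurable)

lemma space_noise_alg [simp]: "space (noise_alg P t) = space M"
  by (simp add: noise_alg_def sigma_gen_def)

lemma noise_measurable_noise_alg:
  assumes "s \<le> t" shows "noise P s \<in> borel_measurable (noise_alg P t)"
proof -
  have "(\<lambda>\<omega>. \<lambda>s\<in>{..t}. noise P s \<omega>) \<in> noise_alg P t \<rightarrow>\<^sub>M PiM {..t} (\<lambda>_. borel)"
    unfolding noise_alg_def sigma_gen_def by (rule measurable_vimage_algebra1) (auto simp: space_PiM)
  then have "(\<lambda>\<omega>. (\<lambda>s\<in>{..t}. noise P s \<omega>) s) \<in> borel_measurable (noise_alg P t)"
    by (rule measurable_compose) (use assms in \<open>auto intro: measurable_component_singleton\<close>)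
  then show ?thesis using assms by simp
qed

lemma noise_alg_mono:
  assumes "f \<in> borel_measurable (noise_alg P s)" "s \<le> t"
  shows "f \<in> borel_measurable (noise_alg P t)"
proof -
  have "(\<lambda>\<omega>. \<omega>) \<in> noise_alg P t \<rightarrow>\<^sub>M noise_alg P s"
    unfolding noise_alg_def[of P s] sigma_gen_def
    by (rule measurable_vimage_algebra2)
      (use assms in \<open>auto intro!: measurable_restrict noise_measurable_noise_alg\<close>)
  then show ?thesis using assms(1) by (rule measurable_compose)
qed

lemma measurable_obs_alg: "t \<le> T \<Longrightarrow> borel_measurable (obs_alg P t) = (borel_measurable (noise_alg P t) :: ('a \<Rightarrow> 'b::topological_space) set)"
  using markov by (intro measurable_cong_sets) (auto simp: markovian_def)

lemma sets_obs_alg: "t \<le> T \<Longrightarrow> sets (obs_alg P t) = sets (noise_alg P t)"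
  using markov by (auto simp: markovian_def)

lemma subalgebra_obs_alg: "t \<le> T \<Longrightarrow> subalgebra M (obs_alg P t)"
  using subalgebra_noise_alg[of t] sets_obs_alg[of t] sets_eq_imp_space_eq[OF sets_obs_alg[of t]]
  by (simp add: subalgebra_def)

lemma indep_future:
  assumes "t \<le> T" shows "indep_pair M (noise_alg P t) (\<lambda>\<omega>. \<omega>) (future_alg t) (future t)"
proof -
  have "indep_vars (\<lambda>_. borel) (noise P) {..T}" using markov by (simp add: markovian_def)
  then have "indep_var (PiM {..t} (\<lambda>_. borel)) (\<lambda>\<omega>. restrict (\<lambda>s. noise P s \<omega>) {..t})
      (PiM {Suc t..T} (\<lambda>_. borel)) (\<lambda>\<omega>. restrict (\<lambda>s. noise P s \<omega>) {Suc t..T})"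
    by (rule indep_var_restrict) (use assms in auto)
  then show ?thesis
    unfolding noise_alg_def by (intro indep_pair_sigma_gen indep_pair_if_indep_var)
qed

lemma AE_exists: "AE \<omega> in M. Q \<omega> \<Longrightarrow> \<exists>\<omega>\<in>space M. Q \<omega>"
proof (rule ccontr)
  assume "AE \<omega> in M. Q \<omega>" and no: "\<not> (\<exists>\<omega>\<in>space M. Q \<omega>)"
  then have "AE \<omega> in M. Q \<omega> \<and> \<omega> \<in> space M" using AE_space by (intro AE_conjI)
  then have "AE \<omega> in M. False" by eventually_elim (use no in blast)
  then show False by simp
qed

definition Gam :: "nat \<Rightarrow> 'e set" where
  "Gam t = (SOME C. C \<subseteq> Usp P t \<and> (AE \<omega> in M. constr P t \<omega> = C))"

lemma Gam:
  assumes "t < T"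
  shows Gam_sub: "Gam t \<subseteq> Usp P t" and Gam_AE: "AE \<omega> in M. constr P t \<omega> = Gam t"
    and Gam_closed: "closed (Gam t)" and Gam_convex: "convex (Gam t)"
proof -
  have "\<exists>C. C \<subseteq> Usp P t \<and> (AE \<omega> in M. constr P t \<omega> = C)"
    using markov assms by (auto simp: markovian_def)
  from someI_ex[OF this] show "Gam t \<subseteq> Usp P t" and AE: "AE \<omega> in M. constr P t \<omega> = Gam t"
    unfolding Gam_def by blast+
  \<comment> \<open>An almost sure property holds at some sample point; there \<open>Gam t\<close>
    is an actual value of the constraint mapping and inherits its closedness and convexity.\<close>
  from AE_exists[OF AE] obtain \<omega> where "\<omega> \<in> space M" "constr P t \<omega> = Gam t" by blast
  then show "closed (Gam t)" "convex (Gam t)"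
    using cc assms by (metis closed_convex_constraints_def)+
qed

lemma Uas_iff:
  assumes "t < T" shows "v \<in> Uas P t \<longleftrightarrow> v \<in> L2 M (Usp P t) \<and> (AE \<omega> in M. v \<omega> \<in> Gam t)"
proof -
  have eq: "AE \<omega> in M. v \<omega> \<in> constr P t \<omega> \<longleftrightarrow> v \<omega> \<in> Gam t"
    using Gam_AE[OF assms] by eventually_elim simp
  have "(AE \<omega> in M. v \<omega> \<in> constr P t \<omega>) \<longleftrightarrow> (AE \<omega> in M. v \<omega> \<in> Gam t)"
  proof
    assume "AE \<omega> in M. v \<omega> \<in> constr P t \<omega>"
    then show "AE \<omega> in M. v \<omega> \<in> Gam t" using eq by eventually_elim simp
  next
    assume "AE \<omega> in M. v \<omega> \<in> Gam t"
    then show "AE \<omega> in M. v \<omega> \<in> constr P t \<omega>" using eq by eventually_elim simp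
  qed
  then show ?thesis by (simp add: Uas_def)
qed

lemma Ume_iff: "t < T \<Longrightarrow> v \<in> Ume P t \<longleftrightarrow> v \<in> L2 M (Usp P t) \<and> v \<in> borel_measurable (noise_alg P t)"
  by (simp add: Ume_def measurable_obs_alg)

lemma feasibleD:
  assumes "feasible P u x"
  shows "u \<in> controls P" "x \<in> states P" "state_eqs P u x"
    "\<And>t. t < T \<Longrightarrow> u t \<in> L2 M (Usp P t)" "\<And>t. t < T \<Longrightarrow> AE \<omega> in M. u t \<omega> \<in> Gam t"
    "\<And>t. t < T \<Longrightarrow> u t \<in> borel_measurable (noise_alg P t)"
  using assms by (auto simp: feasible_def Uas_iff Ume_iff)

lemma feasibleI:
  assumes "x \<in> states P" "state_eqs P u x" "\<And>t. t < T \<Longrightarrow> u t \<in> L2 M (Usp P t)"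
    "\<And>t. t < T \<Longrightarrow> AE \<omega> in M. u t \<omega> \<in> Gam t" "\<And>t. t < T \<Longrightarrow> u t \<in> borel_measurable (noise_alg P t)"
  shows "feasible P u x"
  using assms by (auto simp: feasible_def Uas_iff Ume_iff controls_def)

lemma solution_feasible: "solution P u x \<Longrightarrow> feasible P u x"
  by (simp add: solution_def)

text \<open>The noise algebra is not completed, so adaptedness is guaranteed for
  \<open>traj u t\<close> but not for a version \<open>x t\<close> that equals it only almost
  surely.\<close>

lemma traj_noise_alg:
  assumes "feasible P u x" "t \<le> T"
  shows "traj u t \<in> borel_measurable (noise_alg P t)"
proof -
  note u = feasibleD[OF assms(1)]
  have 1: "(\<lambda>\<omega>. state_path (open_loop (ctrl u \<omega>)) (nz \<omega>) t) \<in> borel_measurable (noise_alg P t)"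
    using assms(2) by (intro state_path_measurable) (auto intro: noise_alg_mono[OF u(6)] noise_measurable_noise_alg)
  have 2: "\<And>\<omega>. \<omega> \<in> space (noise_alg P t) \<Longrightarrow> traj u t \<omega> = state_path (open_loop (ctrl u \<omega>)) (nz \<omega>) t"
    using traj_eq_state_path[OF u(1) _ assms(2)] by simp
  show ?thesis by (rule measurable_cong[THEN iffD2, OF 2 1])
qed

subsection \<open>The variational inequality\<close>

lemma grad_reduced:
  assumes u: "u \<in> controls P" and t: "t < T" and \<omega>: "\<omega> \<in> space M" and v: "v \<in> Usp P t"
  shows "((\<lambda>v. reduced_cost P ((ctrl u \<omega>)(t := v)) (nz \<omega>)) has_derivative
      (\<lambda>h. grad_at u t \<omega> v \<bullet> h)) (at v within Usp P t)"
    and "continuous_on (Usp P t) (grad_at u t \<omega>)"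
proof -
  have x: "traj u t \<omega> \<in> Xsp P t" using statesD(2)[OF traj_states[OF u] _ \<omega>] t by simp
  have us: "\<And>s. s < T \<Longrightarrow> ctrl u \<omega> s \<in> Usp P s" and ws: "\<And>s. s \<le> T \<Longrightarrow> nz \<omega> s \<in> Wsp P s"
    using controlsD(4)[OF u _ \<omega>] noise_in[OF _ \<omega>] by auto
  note D = control_derivative[OF t x v, of "ctrl u \<omega>" "nz \<omega>"]
  show "continuous_on (Usp P t) (grad_at u t \<omega>)"
    using D(2) us ws by simp
  let ?past = "\<Sum>s<t. pcost s (traj u s \<omega>) (u s \<omega>) (noise P (Suc s) \<omega>)"
  have "((\<lambda>v. ?past + (pcost t (traj u t \<omega>) v (nz \<omega> (Suc t)) + cost_to_go pcost pfinal (open_loop (ctrl u \<omega>)) (nz \<omega>)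
      (Suc t) (pdyn t (traj u t \<omega>) v (nz \<omega> (Suc t))))) has_derivative
      (\<lambda>h. 0 + grad_at u t \<omega> v \<bullet> h)) (at v within Usp P t)"
    by (intro has_derivative_add has_derivative_const D) (use us ws in auto)
  then have "((\<lambda>v. ?past + (pcost t (traj u t \<omega>) v (nz \<omega> (Suc t)) + cost_to_go pcost pfinal (open_loop (ctrl u \<omega>)) (nz \<omega>)
      (Suc t) (pdyn t (traj u t \<omega>) v (nz \<omega> (Suc t))))) has_derivative
      (\<lambda>h. grad_at u t \<omega> v \<bullet> h)) (at v within Usp P t)" by simp
  then show "((\<lambda>v. reduced_cost P ((ctrl u \<omega>)(t := v)) (nz \<omega>)) has_derivative
      (\<lambda>h. grad_at u t \<omega> v \<bullet> h)) (at v within Usp P t)"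
    by (rule has_derivative_transform[OF v, rotated]) (rule reduced_cost_update[OF t us ws])
qed

text \<open>The control at \<open>t\<close> affects neither the trajectory up to \<open>t\<close>
  nor the later co-state as a function of the state.\<close>

lemma cgrad_update:
  assumes "t < T"
  shows "grad_at (u(t := v)) t \<omega> = grad_at u t \<omega>"
proof -
  have "traj (u(t := v)) s \<omega> = traj u s \<omega>" if "s \<le> t" for s
    using that by (induction s) auto
  moreover have "costate (open_loop (ctrl (u(t := v)) \<omega>)) (nz \<omega>) (Suc t) x = costate (open_loop (ctrl u \<omega>)) (nz \<omega>) (Suc t) x" for x
    using assms by (intro costate_cong) auto
  ultimately show ?thesis by (simp add: cgrad_def fun_eq_iff)
qed

text \<open>The hypothesis on the derivative of the reduced cost is applied to the control
  \<open>u(t := v)\<close>; since \<open>grad_at u t\<close> does not see \<open>u t\<close>, the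
  resulting gradient is \<open>grad_at u t\<close> at the point \<open>v\<close>.\<close>

lemma cgrad_sq_integrable:
  assumes u: "u \<in> controls P" and t: "t < T" and v: "v \<in> L2 M (Usp P t)"
  shows "sq_integrable M (\<lambda>\<omega>. grad_at u t \<omega> (v \<omega>))"
proof -
  let ?u = "u(t := v)"
  have u': "?u \<in> controls P" using u v by (rule controls_update)
  have vU: "v \<omega> \<in> Usp P t" if "\<omega> \<in> space M" for \<omega> using v that by (simp add: L2_def rv_def)
  have sq: "sq_integrable M (\<lambda>\<omega>. grad_on (Usp P t) (\<lambda>v. reduced_cost P ((\<lambda>s. ?u s \<omega>)(t := v)) (nz \<omega>)) (?u t \<omega>))"
    using sqd u' t unfolding sq_integrable_derivatives_def by blast
  have eq: "grad_on (Usp P t) (\<lambda>v. reduced_cost P ((\<lambda>s. ?u s \<omega>)(t := v)) (nz \<omega>)) (?u t \<omega>)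
      = grad_at u t \<omega> (v \<omega>)" if \<omega>: "\<omega> \<in> space M" for \<omega>
    using grad_on_eqI[OF grad_reduced(1)[OF u' t \<omega> vU[OF \<omega>]] tU[OF t] vU[OF \<omega>] cgrad_in[OF t]]
    unfolding cgrad_update[OF t] by simp
  have "(\<lambda>\<omega>. grad_at u t \<omega> (v \<omega>)) \<in> borel_measurable M"
    using sq eq unfolding sq_integrable_def by (simp cong: measurable_cong)
  with sq show ?thesis by (rule sq_integrable_bound) (use eq in \<open>auto intro!: AE_I2\<close>)
qed

lemma variational_inequality:
  assumes sol: "solution P u x" and t: "t < T"
    and v: "v \<in> L2 M (Usp P t)" "AE \<omega> in M. v \<omega> \<in> Gam t" "v \<in> borel_measurable (noise_alg P t)"
  shows "0 \<le> (\<integral>\<omega>. grad_at u t \<omega> (u t \<omega>) \<bullet> (v \<omega> - u t \<omega>) \<partial>M)"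
proof -
  note f = feasibleD[OF solution_feasible[OF sol]]
  let ?h = "\<lambda>\<omega>. v \<omega> - u t \<omega>"
  let ?c = "grad_at u t"
  have vU: "v \<omega> \<in> Usp P t" if "\<omega> \<in> space M" for \<omega> using v that by (simp add: L2_def rv_def)
  have uU: "u t \<omega> \<in> Usp P t" if "\<omega> \<in> space M" for \<omega> using controlsD(4)[OF f(1) t that] .
  have sq: "sq_integrable M v" "sq_integrable M (u t)" using v f(4)[OF t] by (simp_all add: L2_def)
  then have sqh: "sq_integrable M ?h" by (rule sq_integrable_diff)
  have segU: "u t \<omega> + r *\<^sub>R ?h \<omega> \<in> Usp P t" if "\<omega> \<in> space M" for r \<omega>
    using vU[OF that] uU[OF that] by (intro span_add span_scale span_diff)
  have [measurable]: "v \<in> borel_measurable M" "u t \<in> borel_measurable M"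
    using sq by (simp_all add: sq_integrable_def)
  \<comment> \<open>The step \<open>\<theta>\<close> is random, and not adapted, because the
    domination argument evaluates the gradient at a random point of the segment. The integrability
    hypotheses cover it, as \<open>controls P\<close> demands no adaptedness.\<close>
  have segL2: "(\<lambda>\<omega>. u t \<omega> + \<theta> \<omega> *\<^sub>R ?h \<omega>) \<in> L2 M (Usp P t)"
    if [measurable]: "\<theta> \<in> borel_measurable M" and \<theta>: "\<And>\<omega>. \<theta> \<omega> \<in> {0..1}" for \<theta>
  proof -
    have "sq_integrable M (\<lambda>\<omega>. \<theta> \<omega> *\<^sub>R ?h \<omega>)"
      by (rule sq_integrable_bound[OF sqh]) (use \<theta> in \<open>auto intro!: AE_I2 mult_left_le_one_le\<close>)
    then have "sq_integrable M (\<lambda>\<omega>. u t \<omega> + \<theta> \<omega> *\<^sub>R ?h \<omega>)" by (rule sq_integrable_add[OF sq(2)])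
    then show ?thesis using segU by (simp add: L2_def rv_def sq_integrable_def)
  qed
  have ctrl_eq: "ctrl (u(t := \<lambda>\<omega>. u t \<omega> + \<theta> \<omega> *\<^sub>R ?h \<omega>)) \<omega> = (ctrl u \<omega>)(t := u t \<omega> + \<theta> \<omega> *\<^sub>R ?h \<omega>)" for \<theta> \<omega>
    by auto
  have "0 \<le> (\<integral>\<omega>. ?c \<omega> (u t \<omega> + 0 *\<^sub>R ?h \<omega>) \<bullet> ?h \<omega> \<partial>M)"
  proof (rule integral_derivative_nonneg[where G = "\<lambda>\<omega> r. reduced_cost P ((ctrl u \<omega>)(t := u t \<omega> + r *\<^sub>R ?h \<omega>)) (nz \<omega>)"
        and g = "\<lambda>\<omega> r. ?c \<omega> (u t \<omega> + r *\<^sub>R ?h \<omega>) \<bullet> ?h \<omega>"])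
    fix \<omega> r assume \<omega>: "\<omega> \<in> space M"
    have img: "(\<lambda>r. u t \<omega> + r *\<^sub>R ?h \<omega>) ` {0..1} \<subseteq> Usp P t" using segU[OF \<omega>] by blast
    have "((\<lambda>r. reduced_cost P ((ctrl u \<omega>)(t := u t \<omega> + r *\<^sub>R ?h \<omega>)) (nz \<omega>)) has_derivative
        (\<lambda>s. ?c \<omega> (u t \<omega> + r *\<^sub>R ?h \<omega>) \<bullet> (s *\<^sub>R ?h \<omega>))) (at r within {0..1})"
      by (rule has_derivative_in_compose[OF _ has_derivative_subset[OF grad_reduced(1)[OF f(1) t \<omega> segU[OF \<omega>]] img]])
        (auto intro!: derivative_eq_intros)
    then show "((\<lambda>r. reduced_cost P ((ctrl u \<omega>)(t := u t \<omega> + r *\<^sub>R ?h \<omega>)) (nz \<omega>)) has_real_derivative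
        ?c \<omega> (u t \<omega> + r *\<^sub>R ?h \<omega>) \<bullet> ?h \<omega>) (at r within {0..1})"
      unfolding has_field_derivative_def by (simp add: mult_commute_abs)
    show "continuous_on {0..1} (\<lambda>r. ?c \<omega> (u t \<omega> + r *\<^sub>R ?h \<omega>) \<bullet> ?h \<omega>)"
      by (intro continuous_on_inner continuous_on_const
          continuous_on_compose2[OF grad_reduced(2)[OF f(1) t \<omega> uU[OF \<omega>]] _ img] continuous_intros)
  next
    fix r :: real assume r: "r \<in> {0..1}"
    let ?u = "u(t := \<lambda>\<omega>. u t \<omega> + r *\<^sub>R ?h \<omega>)"
    have L: "(\<lambda>\<omega>. u t \<omega> + r *\<^sub>R ?h \<omega>) \<in> L2 M (Usp P t)" using segL2[of "\<lambda>_. r"] r by simp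
    have u': "?u \<in> controls P" using f(1) L by (rule controls_update)
    show "integrable M (\<lambda>\<omega>. reduced_cost P ((ctrl u \<omega>)(t := u t \<omega> + r *\<^sub>R ?h \<omega>)) (nz \<omega>))"
      using integrable_reduced_cost[OF u'] ctrl_eq[of "\<lambda>_. r"] by simp
    have "feasible P ?u (traj ?u)"
    proof (rule feasibleI[OF traj_states[OF u'] traj_state_eqs])
      fix s assume s: "s < T"
      show "?u s \<in> L2 M (Usp P s)" using L f(4)[OF s] by simp
      have "AE \<omega> in M. u t \<omega> + r *\<^sub>R ?h \<omega> \<in> Gam t"
        using v(2) f(5)[OF t]
      proof eventually_elim
        case (elim \<omega>)
        have "u t \<omega> + r *\<^sub>R ?h \<omega> = (1 - r) *\<^sub>R u t \<omega> + r *\<^sub>R v \<omega>" by (simp add: algebra_simps)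
        then show ?case using elim r convexD[OF Gam_convex[OF t], of "u t \<omega>" "v \<omega>" "1 - r" r] by simp
      qed
      then show "AE \<omega> in M. ?u s \<omega> \<in> Gam s" using f(5)[OF s] by simp
      have [measurable]: "v \<in> borel_measurable (noise_alg P t)" "u t \<in> borel_measurable (noise_alg P t)"
        using v f(6)[OF t] by auto
      have "(\<lambda>\<omega>. u t \<omega> + r *\<^sub>R ?h \<omega>) \<in> borel_measurable (noise_alg P t)" by measurable
      then show "?u s \<in> borel_measurable (noise_alg P s)" using f(6)[OF s] by simp
    qed
    then have "expected_cost P u x \<le> expected_cost P ?u (traj ?u)" using sol by (simp add: solution_def)
    then show "(\<integral>\<omega>. reduced_cost P ((ctrl u \<omega>)(t := u t \<omega> + 0 *\<^sub>R ?h \<omega>)) (nz \<omega>) \<partial>M)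
        \<le> (\<integral>\<omega>. reduced_cost P ((ctrl u \<omega>)(t := u t \<omega> + r *\<^sub>R ?h \<omega>)) (nz \<omega>) \<partial>M)"
      unfolding expected_cost_eq[OF f(1-3)] expected_cost_eq[OF u' traj_states[OF u'] traj_state_eqs]
      using ctrl_eq[of "\<lambda>_. r"] by (simp add: fun_upd_idem)
  next
    fix \<theta> :: "'a \<Rightarrow> real" assume \<theta>: "\<theta> \<in> borel_measurable M" "\<And>\<omega>. \<theta> \<omega> \<in> {0..1}"
    show "integrable M (\<lambda>\<omega>. ?c \<omega> (u t \<omega> + \<theta> \<omega> *\<^sub>R ?h \<omega>) \<bullet> ?h \<omega>)"
      by (rule sq_integrable_inner[OF cgrad_sq_integrable[OF f(1) t segL2[OF \<theta>]] sqh])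
  qed
  then show ?thesis by simp
qed

subsection \<open>First-order optimality conditions\<close>

lemma costate_eqs_AE:
  assumes u: "u \<in> controls P" and eqs: "state_eqs P u x" and ls: "costate_eqs P u x l"
  shows "AE \<omega> in M. \<forall>t\<le>T. l t \<omega> = costate (open_loop (ctrl u \<omega>)) (nz \<omega>) t (traj u t \<omega>)"
proof -
  have "AE \<omega> in M. l t \<omega> = costate (open_loop (ctrl u \<omega>)) (nz \<omega>) t (traj u t \<omega>)" if "t \<le> T" for t
    using that
  proof (induction rule: inc_induct)
    case base
    have "AE \<omega> in M. l T \<omega> = grad_on (Xsp P T) (final_cost P) (x T \<omega>)"
      using ls by (simp add: costate_eqs_def)
    then show ?case using state_eqs_AE[OF eqs] AE_space
    proof eventually_elim
      case (elim \<omega>)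
      then show ?case using statesD(2)[OF traj_states[OF u], of T \<omega>] by (simp add: gK_def pX_id)
    qed
  next
    case (step t)
    have "AE \<omega> in M. l t \<omega> = grad_on (Xsp P t) (\<lambda>\<xi>. cost P t \<xi> (u t \<omega>) (noise P (Suc t) \<omega>)) (x t \<omega>)
        + adjoint (deriv_on (Xsp P t) (\<lambda>\<xi>. dyn P t \<xi> (u t \<omega>) (noise P (Suc t) \<omega>)) (x t \<omega>)) (l (Suc t) \<omega>)"
      using ls step by (simp add: costate_eqs_def)
    then show ?case using state_eqs_AE[OF eqs] step.IH AE_space
    proof eventually_elim
      case (elim \<omega>)
      then show ?case using step trajectory_in[OF step.hyps(2) elim(4) traj_states[OF u] u]
        by (simp add: costate_step pdyn_eq gX_def jX_def pX_id pU_id pW_id)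
    qed
  qed
  then have "AE \<omega> in M. \<forall>t\<in>{..T}. l t \<omega> = costate (open_loop (ctrl u \<omega>)) (nz \<omega>) t (traj u t \<omega>)"
    by (intro AE_finite_allI) auto
  then show ?thesis by eventually_elim auto
qed

lemma control_grad_eq:
  assumes "t < T" "\<omega> \<in> space M" "x \<in> states P" "u \<in> controls P"
  shows "control_grad P u x l t \<omega> = gU t (x t \<omega>) (u t \<omega>) (noise P (Suc t) \<omega>)
    + jU t (x t \<omega>) (u t \<omega>) (noise P (Suc t) \<omega>) (l (Suc t) \<omega>)"
  using assms trajectory_in[OF assms]
  by (simp add: control_grad_def gU_def jU_def pX_id pU_id pW_id)

lemma control_grad_AE:
  assumes "t < T" "u \<in> controls P" "x \<in> states P" "state_eqs P u x" "costate_eqs P u x l"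
  shows "AE \<omega> in M. control_grad P u x l t \<omega> = grad_at u t \<omega> (u t \<omega>)"
  using costate_eqs_AE[OF assms(2,4,5)] state_eqs_AE[OF assms(4)] AE_space
proof eventually_elim
  case (elim \<omega>)
  then show ?case
    using assms(1) trajectory_in[OF assms(1) elim(3) traj_states[OF assms(2)] assms(2)] control_grad_eq[OF assms(1) elim(3) assms(3,2), of l]
    by (simp add: cgrad_def pdyn_eq)
qed

text \<open>A product of square integrable factors, such as Jacobian and co-state, is in general
  only integrable. Square integrability comes instead from the almost sure identity with the
  gradient of the reduced cost, for which it is assumed.\<close>

lemma control_grad_sq_integrable:
  assumes t: "t < T" and u: "u \<in> controls P" and x: "x \<in> states P" and eqs: "state_eqs P u x"
    and l: "l \<in> states P" and ls: "costate_eqs P u x l"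
  shows "sq_integrable M (control_grad P u x l t)"
proof (rule sq_integrable_bound[OF cgrad_sq_integrable[OF u t controlsD(1)[OF u t]]])
  have "(\<lambda>\<omega>. gU t (x t \<omega>) (u t \<omega>) (noise P (Suc t) \<omega>)
    + jU t (x t \<omega>) (u t \<omega>) (noise P (Suc t) \<omega>) (l (Suc t) \<omega>)) \<in> borel_measurable M"
    using t statesD(1)[OF x] statesD(1)[OF l] controlsD(2)[OF u] noise_measurable
    by (intro borel_measurable_add gU_measurable jU_measurable) auto
  then show "control_grad P u x l t \<in> borel_measurable M"
    by (rule measurable_cong[THEN iffD2, rotated]) (rule control_grad_eq[OF t _ x u])
  show "AE \<omega> in M. norm (control_grad P u x l t \<omega>) \<le> norm (grad_at u t \<omega> (u t \<omega>))"
    using control_grad_AE[OF t u x eqs ls] by eventually_elim simp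
qed

text \<open>Let \<open>E\<close> be the conditional expectation given \<open>obs_alg P t\<close> and
  \<open>g\<close> the control gradient. Self-adjointness and measurability of \<open>u t\<close>
  turn the pairing of \<open>E g\<close> with \<open>v - u t\<close> into that of \<open>g\<close>
  with \<open>E v - u t\<close>. As \<open>E v\<close> is adapted and admissible, the variational
  inequality decides the sign.\<close>

lemma solution_optimality_conditions:
  assumes sol: "solution P u x" and l: "l \<in> states P" and ls: "costate_eqs P u x l"
  shows "optimality_conditions P u x l"
  unfolding optimality_conditions_def
proof (intro conjI allI impI)
  note f = feasibleD[OF solution_feasible[OF sol]]
  show "state_eqs P u x" "costate_eqs P u x l" by fact+
  fix t assume t: "t < T"
  interpret G: prob_subalgebra M "obs_alg P t"
    using t by (intro prob_subalgebraI prob_space_axioms subalgebra_obs_alg) simp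
  let ?B = "Ucoord P t" and ?g = "control_grad P u x l t"
  let ?E = "vec_cond_exp M (obs_alg P t) ?B"
  have sq: "sq_integrable M ?g" by (rule control_grad_sq_integrable[OF t f(1-3) l ls])
  have fin: "finite ?B" using tU[OF t] finite_Basis finite_subset by blast
  show "(\<lambda>\<omega>. - ?E ?g \<omega>) \<in> subdiff_indicator M (Usp P t) (Uas P t) (u t)"
    unfolding subdiff_indicator_def
  proof (intro CollectI conjI ballI)
    have "?E ?g \<in> L2 M (Usp P t)" by (rule G.vec_cond_exp_L2[OF sq])
    then show "(\<lambda>\<omega>. - ?E ?g \<omega>) \<in> L2 M (Usp P t)"
      by (auto simp: L2_def rv_def span_neg intro: sq_integrable_uminus)
    fix v assume "v \<in> Uas P t"
    then have v: "v \<in> L2 M (Usp P t)" "AE \<omega> in M. v \<omega> \<in> Gam t" using Uas_iff[OF t] by auto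
    then have sqv: "sq_integrable M v" and vU: "\<And>\<omega>. \<omega> \<in> space M \<Longrightarrow> v \<omega> \<in> Usp P t"
      by (auto simp: L2_def rv_def)
    have squ: "sq_integrable M (u t)" and uU: "\<And>\<omega>. \<omega> \<in> space M \<Longrightarrow> u t \<omega> \<in> Usp P t"
      using controlsD[OF f(1) t] by auto
    have AEne: "Gam t \<noteq> {}" using AE_exists[OF v(2)] by blast
    have EvL2: "?E v \<in> L2 M (Usp P t)" by (rule G.vec_cond_exp_L2[OF sqv])
    have "AE \<omega> in M. ?E v \<omega> \<in> Gam t"
      using vU proj_id[OF tU[OF t]] t
      by (intro G.vec_cond_exp_in_closed_convex[OF sqv fin _ Gam_closed Gam_convex AEne v(2)])
        (auto simp: proj_def)
    moreover have "?E v \<in> borel_measurable (noise_alg P t)"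
      using G.vec_cond_exp_measurable_F t by (simp add: measurable_obs_alg)
    ultimately have "0 \<le> (\<integral>\<omega>. grad_at u t \<omega> (u t \<omega>) \<bullet> (?E v \<omega> - u t \<omega>) \<partial>M)"
      by (rule variational_inequality[OF sol t EvL2])
    also have "\<dots> = (\<integral>\<omega>. ?g \<omega> \<bullet> (?E v \<omega> - u t \<omega>) \<partial>M)"
    proof (rule integral_cong_AE)
      have [measurable]: "?E v \<in> borel_measurable M" "u t \<in> borel_measurable M" "?g \<in> borel_measurable M"
        "(\<lambda>\<omega>. grad_at u t \<omega> (u t \<omega>)) \<in> borel_measurable M"
        using squ sq cgrad_sq_integrable[OF f(1) t f(4)[OF t]] by (auto simp: sq_integrable_def)
      show "(\<lambda>\<omega>. grad_at u t \<omega> (u t \<omega>) \<bullet> (?E v \<omega> - u t \<omega>)) \<in> borel_measurable M"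
        "(\<lambda>\<omega>. ?g \<omega> \<bullet> (?E v \<omega> - u t \<omega>)) \<in> borel_measurable M" by measurable
      show "AE \<omega> in M. grad_at u t \<omega> (u t \<omega>) \<bullet> (?E v \<omega> - u t \<omega>) = ?g \<omega> \<bullet> (?E v \<omega> - u t \<omega>)"
        using control_grad_AE[OF t f(1-3) ls] by eventually_elim simp
    qed
    also have "\<dots> = (\<integral>\<omega>. ?g \<omega> \<bullet> ?E (\<lambda>\<omega>. v \<omega> - u t \<omega>) \<omega> \<partial>M)"
    proof (rule integral_cong_AE)
      have int: "integrable M (\<lambda>\<omega>. v \<omega> \<bullet> b)" "integrable M (\<lambda>\<omega>. u t \<omega> \<bullet> b)" for b
        using sqv squ sq_integrable_imp_integrable_component by auto
      have [measurable]: "u t \<in> borel_measurable (obs_alg P t)" using f(6)[OF t] t by (simp add: measurable_obs_alg)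
      have "AE \<omega> in M. \<forall>b\<in>?B. real_cond_exp M (obs_alg P t) (\<lambda>\<omega>. v \<omega> \<bullet> b - u t \<omega> \<bullet> b) \<omega>
          = real_cond_exp M (obs_alg P t) (\<lambda>\<omega>. v \<omega> \<bullet> b) \<omega> - u t \<omega> \<bullet> b"
      proof (rule AE_finite_allI[OF fin])
        fix b
        have "AE \<omega> in M. real_cond_exp M (obs_alg P t) (\<lambda>\<omega>. u t \<omega> \<bullet> b) \<omega> = u t \<omega> \<bullet> b"
          by (rule G.real_cond_exp_F_meas[OF int(2)]) measurable
        with G.real_cond_exp_diff[OF int(1)[of b] int(2)[of b]]
        show "AE \<omega> in M. real_cond_exp M (obs_alg P t) (\<lambda>\<omega>. v \<omega> \<bullet> b - u t \<omega> \<bullet> b) \<omega>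
          = real_cond_exp M (obs_alg P t) (\<lambda>\<omega>. v \<omega> \<bullet> b) \<omega> - u t \<omega> \<bullet> b"
          by eventually_elim simp
      qed
      then show "AE \<omega> in M. ?g \<omega> \<bullet> (?E v \<omega> - u t \<omega>) = ?g \<omega> \<bullet> ?E (\<lambda>\<omega>. v \<omega> - u t \<omega>) \<omega>"
        using AE_space
      proof eventually_elim
        case (elim \<omega>)
        have "?E (\<lambda>\<omega>. v \<omega> - u t \<omega>) \<omega> = ?E v \<omega> - (\<Sum>b\<in>?B. (u t \<omega> \<bullet> b) *\<^sub>R b)"
          using elim by (simp add: vec_cond_exp_def inner_diff_left scaleR_diff_left sum_subtractf)
        also have "(\<Sum>b\<in>?B. (u t \<omega> \<bullet> b) *\<^sub>R b) = u t \<omega>"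
          using proj_id[OF tU[OF t] uU[OF elim(2)]] by (simp add: proj_def)
        finally show ?case by simp
      qed
      have [measurable]: "u t \<in> borel_measurable M" "?g \<in> borel_measurable M"
        using squ sq by (auto simp: sq_integrable_def)
      show "(\<lambda>\<omega>. ?g \<omega> \<bullet> (?E v \<omega> - u t \<omega>)) \<in> borel_measurable M"
        "(\<lambda>\<omega>. ?g \<omega> \<bullet> ?E (\<lambda>\<omega>. v \<omega> - u t \<omega>) \<omega>) \<in> borel_measurable M" by measurable
    qed
    also have "\<dots> = (\<integral>\<omega>. ?E ?g \<omega> \<bullet> (v \<omega> - u t \<omega>) \<partial>M)"
      by (rule G.integral_vec_cond_exp_inner[symmetric, OF sq sq_integrable_diff[OF sqv squ]])
    finally show "(\<integral>\<omega>. - ?E ?g \<omega> \<bullet> (v \<omega> - u t \<omega>) \<partial>M) \<le> 0" by simp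
  qed
qed

text \<open>Any measurable policy that reproduces \<open>u\<close> along \<open>x\<close> solves the
  co-state equations, because these freeze the control value and never differentiate the policy. An
  open-loop policy suits an arbitrary solution; a feedback exposes the dependence on state and
  noise.\<close>

lemma costate_process:
  fixes \<pi> :: "'a \<Rightarrow> nat \<Rightarrow> 'e \<Rightarrow> 'e"
  assumes u: "u \<in> controls P" and x: "x \<in> states P" and eqs: "state_eqs P u x"
    and pol: "\<And>s Y. s < T \<Longrightarrow> Y \<in> borel_measurable M \<Longrightarrow> (\<lambda>\<omega>. \<pi> \<omega> s (Y \<omega>)) \<in> borel_measurable M"
    and pu: "\<And>s \<omega>. s < T \<Longrightarrow> \<omega> \<in> space M \<Longrightarrow> \<pi> \<omega> s (x s \<omega>) = u s \<omega>"
  shows "(\<lambda>t \<omega>. costate (\<pi> \<omega>) (nz \<omega>) t (x t \<omega>)) \<in> states P" (is "?l \<in> _")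
    and "costate_eqs P u x (\<lambda>t \<omega>. costate (\<pi> \<omega>) (nz \<omega>) t (x t \<omega>))"
proof -
  have "?l t \<in> borel_measurable M" if "t \<le> T" for t
    using that by (intro costate_measurable[where t = 0] pol noise_measurable statesD(1)[OF x]) auto
  then show "?l \<in> states P" by (auto simp: states_def rv_def costate_in)
  show "costate_eqs P u x ?l"
    unfolding costate_eqs_def
  proof (intro conjI allI impI)
    show "AE \<omega> in M. ?l T \<omega> = grad_on (Xsp P T) (final_cost P) (x T \<omega>)"
      by (rule AE_I2) (simp add: gK_def pX_id statesD[OF x])
    fix t assume t: "t < T"
    have "AE \<omega> in M. x (Suc t) \<omega> = dyn P t (x t \<omega>) (u t \<omega>) (noise P (Suc t) \<omega>)"
      using eqs t by (simp add: state_eqs_def)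
    then show "AE \<omega> in M. ?l t \<omega> = grad_on (Xsp P t) (\<lambda>\<xi>. cost P t \<xi> (u t \<omega>) (noise P (Suc t) \<omega>)) (x t \<omega>)
        + adjoint (deriv_on (Xsp P t) (\<lambda>\<xi>. dyn P t \<xi> (u t \<omega>) (noise P (Suc t) \<omega>)) (x t \<omega>)) (?l (Suc t) \<omega>)"
      using AE_space
    proof eventually_elim
      case (elim \<omega>)
      then show ?case using t trajectory_in[OF t elim(2) x u]
        by (simp add: costate_step pu pdyn_eq gX_def jX_def pX_id pU_id pW_id)
    qed
  qed
qed

subsection \<open>Feedback controls\<close>

text \<open>The control gradient as a function of the present state and the later noise, so that the
  noise can be integrated out with the state frozen.\<close>

definition feedback_grad :: "(nat \<Rightarrow> 'e \<Rightarrow> 'e) \<Rightarrow> nat \<Rightarrow> 'e \<Rightarrow> (nat \<Rightarrow> 'e) \<Rightarrow> 'e" where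
  "feedback_grad \<phi> t x z = gU t x (\<phi> t x) (z (Suc t))
     + jU t x (\<phi> t x) (z (Suc t)) (costate \<phi> z (Suc t) (pdyn t x (\<phi> t x) (z (Suc t))))"

lemma feedback_grad_measurable:
  assumes \<phi>: "\<And>s. s < T \<Longrightarrow> \<phi> s \<in> borel_measurable borel" and t: "t < T"
    and X [measurable]: "X \<in> borel_measurable N"
  shows "(\<lambda>(\<omega>, z). feedback_grad \<phi> t (X \<omega>) z) \<in> borel_measurable (N \<Otimes>\<^sub>M future_alg t)"
proof -
  let ?N = "N \<Otimes>\<^sub>M future_alg t"
  have z [measurable]: "(\<lambda>p. snd p s) \<in> borel_measurable ?N" if "t < s" "s \<le> T" for s
    using that by (intro measurable_compose[OF measurable_snd] measurable_component_singleton) auto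
  have [measurable]: "(\<lambda>p. snd p (Suc t)) \<in> borel_measurable ?N" using t by (intro z) auto
  have p: "(\<lambda>p. \<phi> s (Y p)) \<in> borel_measurable ?N"
    if "s < T" "Y \<in> borel_measurable ?N" for s Y
    using measurable_compose[OF that(2) \<phi>[OF that(1)]] .
  have [measurable]: "(\<lambda>p. \<phi> t (X (fst p))) \<in> borel_measurable ?N"
    using t by (intro p) measurable
  have "(\<lambda>p. costate \<phi> (snd p) (Suc t) (pdyn t (X (fst p)) (\<phi> t (X (fst p))) (snd p (Suc t))))
      \<in> borel_measurable ?N"
    by (rule costate_measurable[where t = "Suc t"]) (use t p z in \<open>auto intro!: pdyn_measurable\<close>)
  then have "(\<lambda>p. feedback_grad \<phi> t (X (fst p)) (snd p)) \<in> borel_measurable ?N"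
    unfolding feedback_grad_def using t by (intro borel_measurable_add gU_measurable jU_measurable) auto
  then show ?thesis by (simp add: case_prod_beta')
qed

lemma feedback_costate_properties:
  assumes sol: "feasible P u x" and \<phi>: "\<And>s. s < T \<Longrightarrow> \<phi> s \<in> borel_measurable borel"
    and pu: "\<And>s \<omega>. s < T \<Longrightarrow> \<omega> \<in> space M \<Longrightarrow> \<phi> s (x s \<omega>) = u s \<omega>" and t: "t < T"
  defines "l \<equiv> \<lambda>t \<omega>. costate \<phi> (nz \<omega>) t (x t \<omega>)"
  shows "costate_measurability P x l t" and "markov_cond_exp P u x l t"
proof -
  note f = feasibleD[OF sol]
  have l: "l \<in> states P" "costate_eqs P u x l"
    unfolding l_def
    by (rule costate_process[OF f(1-3)]; use \<phi> pu in \<open>auto intro: measurable_compose\<close>)+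
  show "costate_measurability P x l t"
    unfolding costate_measurability_def precedes_def
  proof -
    let ?K = "PiM {Suc t..T} (\<lambda>_. borel :: 'e measure)" and ?S = "state_and_future_noise P x (Suc t)"
    have comp: "(\<lambda>y. y s) \<in> borel_measurable ?K" if "t < s" "s \<le> T" for s
      using that by (intro measurable_component_singleton) auto
    \<comment> \<open>The co-state at \<open>Suc t\<close> reads noise only from
      \<open>Suc (Suc t)\<close> on, so component \<open>Suc t\<close> of the tuple is free to carry
      the state.\<close>
    have "(\<lambda>y. costate \<phi> y (Suc t) (y (Suc t))) \<in> borel_measurable ?K"
      by (rule costate_measurable[where t = "Suc t"]) (use t comp \<phi> in \<open>auto intro: measurable_compose\<close>)
    moreover have "?S \<in> sigma_gen M ?K ?S \<rightarrow>\<^sub>M ?K"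
      unfolding sigma_gen_def
      by (rule measurable_vimage_algebra1) (auto simp: state_and_future_noise_def space_PiM)
    ultimately have "(\<lambda>\<omega>. costate \<phi> (?S \<omega>) (Suc t) (?S \<omega> (Suc t))) \<in> borel_measurable (sigma_gen M ?K ?S)"
      by (rule measurable_compose[rotated])
    moreover have "costate \<phi> (?S \<omega>) (Suc t) (?S \<omega> (Suc t)) = l (Suc t) \<omega>" for \<omega>
    proof -
      have "?S \<omega> (Suc t) = x (Suc t) \<omega>" using t by (simp add: state_and_future_noise_def)
      then show ?thesis unfolding l_def using t
        by (simp, intro costate_cong) (auto simp: state_and_future_noise_def)
    qed
    ultimately show "l (Suc t) \<in> borel_measurable (sigma_gen M ?K ?S)" by simp
  qed
  let ?g = "control_grad P u x l t"
  have sq: "sq_integrable M ?g" by (rule control_grad_sq_integrable[OF t f(1-3) l])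
  have "AE \<omega> in M. x (Suc t) \<omega> = dyn P t (x t \<omega>) (u t \<omega>) (noise P (Suc t) \<omega>)"
    using f(3) t by (simp add: state_eqs_def)
  then have g_x: "AE \<omega> in M. ?g \<omega> = feedback_grad \<phi> t (x t \<omega>) (future t \<omega>)"
    using AE_space
  proof eventually_elim
    case (elim \<omega>)
    have "costate \<phi> (nz \<omega>) (Suc t) y = costate \<phi> (future t \<omega>) (Suc t) y" for y
      using t by (intro costate_cong) auto
    then show ?case using elim t trajectory_in[OF t elim(2) f(2,1)]
      by (simp add: control_grad_eq[OF t elim(2) f(2,1)] feedback_grad_def pu l_def pdyn_eq)
  qed
  then have g_traj: "AE \<omega> in M. ?g \<omega> = feedback_grad \<phi> t (traj u t \<omega>) (future t \<omega>)"
    using state_eqs_AE[OF f(3)] by eventually_elim (use t in simp)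
  \<comment> \<open>Both conditional expectations are instances of this formula: \<open>F\<close> is
    the noise algebra and \<open>X\<close> the trajectory, or \<open>F\<close> is generated by
    \<open>x t\<close> and \<open>X\<close> is \<open>x t\<close>. The right-hand sides agree
    wherever the trajectory equals \<open>x t\<close>.\<close>
  have key: "AE \<omega> in M. \<forall>b\<in>Ucoord P t. real_cond_exp M F (\<lambda>\<omega>. ?g \<omega> \<bullet> b) \<omega>
      = (\<integral>z. feedback_grad \<phi> t (X \<omega>) z \<bullet> b \<partial>future_law t)"
    if sub: "subalgebra M F" and ind: "indep_pair M F (\<lambda>\<omega>. \<omega>) (future_alg t) (future t)"
      and X [measurable]: "X \<in> borel_measurable F" and g: "AE \<omega> in M. ?g \<omega> = feedback_grad \<phi> t (X \<omega>) (future t \<omega>)" for F X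
  proof (rule AE_finite_allI)
    interpret F: prob_subalgebra M F
      by (rule prob_subalgebraI[OF prob_space_axioms sub])
    show "finite (Ucoord P t)" using tU[OF t] finite_Basis finite_subset by blast
    fix b
    let ?h = "\<lambda>(\<omega>, z). feedback_grad \<phi> t (X \<omega>) z \<bullet> b"
    have m: "?h \<in> borel_measurable (F \<Otimes>\<^sub>M future_alg t)"
      using feedback_grad_measurable[OF \<phi> t X] by (simp add: case_prod_beta')
    have [measurable]: "(\<lambda>\<omega>. (\<omega>, future t \<omega>)) \<in> M \<rightarrow>\<^sub>M F \<Otimes>\<^sub>M future_alg t"
      using indep_pairD_distr(1)[OF ind] by measurable
    have [measurable]: "(\<lambda>\<omega>. feedback_grad \<phi> t (X \<omega>) (future t \<omega>) \<bullet> b) \<in> borel_measurable M"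
      using measurable_compose[OF \<open>(\<lambda>\<omega>. (\<omega>, future t \<omega>)) \<in> M \<rightarrow>\<^sub>M F \<Otimes>\<^sub>M future_alg t\<close> m] by simp
    have [measurable]: "?g \<in> borel_measurable M" using sq by (simp add: sq_integrable_def)
    have AEeq: "AE \<omega> in M. ?g \<omega> \<bullet> b = feedback_grad \<phi> t (X \<omega>) (future t \<omega>) \<bullet> b"
      using g by eventually_elim simp
    have "integrable M (\<lambda>\<omega>. ?g \<omega> \<bullet> b)" using sq by (rule sq_integrable_imp_integrable_component)
    then have "integrable M (\<lambda>\<omega>. ?h (\<omega>, future t \<omega>))"
      using AEeq by (subst (asm) integrable_cong_AE) auto
    from real_cond_exp_freezing[OF sub ind m this]
    have "AE \<omega> in M. real_cond_exp M F (\<lambda>\<omega>. feedback_grad \<phi> t (X \<omega>) (future t \<omega>) \<bullet> b) \<omega>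
      = (\<integral>z. feedback_grad \<phi> t (X \<omega>) z \<bullet> b \<partial>future_law t)" by (simp only: prod.case)
    moreover have "AE \<omega> in M. real_cond_exp M F (\<lambda>\<omega>. ?g \<omega> \<bullet> b) \<omega>
        = real_cond_exp M F (\<lambda>\<omega>. feedback_grad \<phi> t (X \<omega>) (future t \<omega>) \<bullet> b) \<omega>"
      using AEeq by (rule F.real_cond_exp_cong) measurable
    ultimately show "AE \<omega> in M. real_cond_exp M F (\<lambda>\<omega>. ?g \<omega> \<bullet> b) \<omega>
      = (\<integral>z. feedback_grad \<phi> t (X \<omega>) z \<bullet> b \<partial>future_law t)" by eventually_elim simp
  qed
  have tT: "t \<le> T" using t by simp
  note ind = indep_future[OF tT]
  have tr: "traj u t \<in> borel_measurable (noise_alg P t)" by (rule traj_noise_alg[OF sol tT])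
  have xM: "x t \<in> borel_measurable M" using statesD(1)[OF f(2) tT] .
  have AEx: "AE \<omega> in M. x t \<omega> = traj u t \<omega>"
    using state_eqs_AE[OF f(3)] by eventually_elim (use tT in simp)
  \<comment> \<open>Independence of the future is known for the adapted trajectory. It is
    transferred to \<open>x t\<close> before passing to the sigma-algebra that \<open>x t\<close>
    generates.\<close>
  have "indep_pair M borel (traj u t) (future_alg t) (future t)"
    using indep_pair_compose[OF ind tr] .
  then have "indep_pair M borel (x t) (future_alg t) (future t)"
    using xM AEx by (rule indep_pair_cong_AE)
  then have indx: "indep_pair M (sigma_gen M borel (x t)) (\<lambda>\<omega>. \<omega>) (future_alg t) (future t)"
    by (rule indep_pair_sigma_gen)
  have xs: "x t \<in> borel_measurable (sigma_gen M borel (x t))"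
    unfolding sigma_gen_def by (rule measurable_vimage_algebra1) simp
  show "markov_cond_exp P u x l t"
    unfolding markov_cond_exp_def
    using key[OF subalgebra_noise_alg[OF tT] ind tr g_traj]
      key[OF subalgebra_sigma_gen[OF xM] indx xs g_x] AEx
  proof eventually_elim
    case (elim \<omega>)
    then show ?case unfolding vec_cond_exp_def by (intro sum.cong refl) simp
  qed
qed

subsection \<open>Replacing a control by a feedback\<close>

text \<open>The inclusion in \<open>Gam s\<close> is required at every state: changing an earlier
  control leads to states that \<open>traj u\<close> never visits, and the later feedbacks must
  remain admissible there.\<close>

definition feedback_from :: "nat \<Rightarrow> (nat \<Rightarrow> 'a \<Rightarrow> 'e) \<Rightarrow> (nat \<Rightarrow> 'e \<Rightarrow> 'e) \<Rightarrow> bool" where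
  "feedback_from t u \<phi> \<longleftrightarrow> solution P u (traj u) \<and>
     (\<forall>s. t \<le> s \<and> s < T \<longrightarrow> \<phi> s \<in> borel_measurable borel \<and> range (\<phi> s) \<subseteq> Gam s \<and>
        (\<forall>\<omega>\<in>space M. u s \<omega> = \<phi> s (traj u s \<omega>)))"

definition tail_cost :: "(nat \<Rightarrow> 'e \<Rightarrow> 'e) \<Rightarrow> nat \<Rightarrow> 'e \<times> 'e \<Rightarrow> (nat \<Rightarrow> 'e) \<Rightarrow> real" where
  "tail_cost \<phi> t p z = pcost t (fst p) (snd p) (z (Suc t))
     + cost_to_go pcost pfinal \<phi> z (Suc t) (pdyn t (fst p) (snd p) (z (Suc t)))"

text \<open>As a stage cost in \<open>cost_to_go\<close> it sums the squared norms of the controls,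
  so costs and norms share one recursion.\<close>

abbreviation "sq_cost \<equiv> (\<lambda>(s::nat) (x::'e) (v::'e) (z::'e). (norm v)\<^sup>2)"

definition tail_sq :: "(nat \<Rightarrow> 'e \<Rightarrow> 'e) \<Rightarrow> nat \<Rightarrow> 'e \<times> 'e \<Rightarrow> (nat \<Rightarrow> 'e) \<Rightarrow> real" where
  "tail_sq \<phi> t p z = (norm (snd p))\<^sup>2
     + cost_to_go sq_cost (\<lambda>_. 0) \<phi> z (Suc t) (pdyn t (fst p) (snd p) (z (Suc t)))"

text \<open>\<open>mean_cost\<close> has the junk value \<open>0\<close> where \<open>tail_cost\<close> is not integrable; almost every pair that
  comes from an admissible control avoids this. Finiteness of \<open>mean_sq\<close> keeps the later feedbacks in \<open>L\<^sup>2\<close>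
  after the control at time \<open>t\<close> has been changed.\<close>

definition mean_cost :: "(nat \<Rightarrow> 'e \<Rightarrow> 'e) \<Rightarrow> nat \<Rightarrow> 'e \<times> 'e \<Rightarrow> real" where
  "mean_cost \<phi> t p = (\<integral>z. tail_cost \<phi> t p z \<partial>future_law t)"

definition mean_sq :: "(nat \<Rightarrow> 'e \<Rightarrow> 'e) \<Rightarrow> nat \<Rightarrow> 'e \<times> 'e \<Rightarrow> ennreal" where
  "mean_sq \<phi> t p = (\<integral>\<^sup>+z. ennreal (tail_sq \<phi> t p z) \<partial>future_law t)"

text \<open>After \<open>t\<close> the controls react to the changed state through
  \<open>\<phi>\<close> instead of repeating \<open>u\<close>. The tail is then a function of the
  state and control at \<open>t\<close> and of the future noise alone.\<close>

definition switch_policy :: "(nat \<Rightarrow> 'a \<Rightarrow> 'e) \<Rightarrow> (nat \<Rightarrow> 'e \<Rightarrow> 'e) \<Rightarrow> nat \<Rightarrow> ('a \<Rightarrow> 'e) \<Rightarrow> 'a \<Rightarrow> nat \<Rightarrow> 'e \<Rightarrow> 'e" where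
  "switch_policy u \<phi> t v \<omega> s = (if s < t then (\<lambda>_. u s \<omega>) else if s = t then (\<lambda>_. v \<omega>) else \<phi> s)"

definition switch :: "(nat \<Rightarrow> 'a \<Rightarrow> 'e) \<Rightarrow> (nat \<Rightarrow> 'e \<Rightarrow> 'e) \<Rightarrow> nat \<Rightarrow> ('a \<Rightarrow> 'e) \<Rightarrow> nat \<Rightarrow> 'a \<Rightarrow> 'e" where
  "switch u \<phi> t v s \<omega> = switch_policy u \<phi> t v \<omega> s (state_path (switch_policy u \<phi> t v \<omega>) (nz \<omega>) s)"

lemma cost_to_go_nonneg:
  assumes "t \<le> T" "\<And>s x v z. L s x v z \<ge> 0" "\<And>x. K x \<ge> 0"
  shows "cost_to_go L K \<pi> w t x \<ge> 0"
  using assms by (induction arbitrary: x rule: inc_induct) (simp_all add: cost_to_go_step)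

lemma tail_sq_nonneg: "t < T \<Longrightarrow> tail_sq \<phi> t p z \<ge> 0"
  unfolding tail_sq_def by (intro add_nonneg_nonneg cost_to_go_nonneg) auto

context
  fixes t u \<phi>
  assumes t: "t < T" and ff: "feedback_from (Suc t) u \<phi>"
begin

lemma sol: "solution P u (traj u)"
  and phi_measurable: "t < s \<Longrightarrow> s < T \<Longrightarrow> \<phi> s \<in> borel_measurable borel"
  and phi_Gam: "t < s \<Longrightarrow> s < T \<Longrightarrow> \<phi> s y \<in> Gam s"
  and u_phi: "t < s \<Longrightarrow> s < T \<Longrightarrow> \<omega> \<in> space M \<Longrightarrow> u s \<omega> = \<phi> s (traj u s \<omega>)"
  using ff by (auto simp: feedback_from_def Suc_le_eq)

lemma tail_measurable:
  assumes [measurable]: "X \<in> borel_measurable N" "V \<in> borel_measurable N"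
  shows "(\<lambda>(\<omega>, z). tail_cost \<phi> t (X \<omega>, V \<omega>) z) \<in> borel_measurable (N \<Otimes>\<^sub>M future_alg t)"
    and "(\<lambda>(\<omega>, z). tail_sq \<phi> t (X \<omega>, V \<omega>) z) \<in> borel_measurable (N \<Otimes>\<^sub>M future_alg t)"
proof -
  let ?N = "N \<Otimes>\<^sub>M future_alg t"
  have z [measurable]: "(\<lambda>p. snd p s) \<in> borel_measurable ?N" if "t < s" "s \<le> T" for s
    using that by (intro measurable_compose[OF measurable_snd] measurable_component_singleton) auto
  have [measurable]: "(\<lambda>p. snd p (Suc t)) \<in> borel_measurable ?N" using t by (intro z) auto
  have p: "(\<lambda>p. \<phi> s (Y p)) \<in> borel_measurable ?N"
    if "Suc t \<le> s" "s < T" "Y \<in> borel_measurable ?N" for s Y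
    using measurable_compose[OF that(3) phi_measurable] that by simp
  have [measurable]: "(\<lambda>p. pdyn t (X (fst p)) (V (fst p)) (snd p (Suc t))) \<in> borel_measurable ?N"
    by (rule pdyn_measurable[OF t]) measurable
  have "(\<lambda>p. cost_to_go pcost pfinal \<phi> (snd p) (Suc t) (pdyn t (X (fst p)) (V (fst p)) (snd p (Suc t))))
      \<in> borel_measurable ?N"
    by (rule cost_to_go_measurable[where t = "Suc t"]) (use t p z in \<open>auto intro: pcost_measurable\<close>)
  moreover have "(\<lambda>p. pcost t (X (fst p)) (V (fst p)) (snd p (Suc t))) \<in> borel_measurable ?N"
    by (rule pcost_measurable[OF t]) measurable
  ultimately have "(\<lambda>p. tail_cost \<phi> t (X (fst p), V (fst p)) (snd p)) \<in> borel_measurable ?N"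
    unfolding tail_cost_def by simp
  then show "(\<lambda>(\<omega>, z). tail_cost \<phi> t (X \<omega>, V \<omega>) z) \<in> borel_measurable ?N"
    by (simp add: case_prod_beta')
  have "(\<lambda>p. cost_to_go sq_cost (\<lambda>_. 0) \<phi> (snd p) (Suc t) (pdyn t (X (fst p)) (V (fst p)) (snd p (Suc t))))
      \<in> borel_measurable ?N"
    by (rule cost_to_go_measurable[where t = "Suc t"]) (use t p z in auto)
  then have "(\<lambda>p. tail_sq \<phi> t (X (fst p), V (fst p)) (snd p)) \<in> borel_measurable ?N"
    unfolding tail_sq_def by simp
  then show "(\<lambda>(\<omega>, z). tail_sq \<phi> t (X \<omega>, V \<omega>) z) \<in> borel_measurable ?N"
    by (simp add: case_prod_beta')
qed

lemma prob_space_future_law: "prob_space (future_law t)"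
  by (rule prob_space_distr) simp

lemma mean_cost_measurable [measurable]: "mean_cost \<phi> t \<in> borel_measurable borel"
proof -
  interpret Z: prob_space "future_law t" by (rule prob_space_future_law)
  have "(\<lambda>(p, z). tail_cost \<phi> t (fst p, snd p) z) \<in> borel_measurable (borel \<Otimes>\<^sub>M future_alg t)"
    by (rule tail_measurable) (auto simp flip: borel_prod)
  then have "(\<lambda>(p, z). tail_cost \<phi> t p z) \<in> borel_measurable (borel \<Otimes>\<^sub>M future_law t)" by simp
  then show ?thesis unfolding mean_cost_def[abs_def] by (rule Z.borel_measurable_lebesgue_integral)
qed

lemma mean_sq_measurable [measurable]: "mean_sq \<phi> t \<in> borel_measurable borel"
proof -
  interpret Z: prob_space "future_law t" by (rule prob_space_future_law)
  have [measurable]: "(\<lambda>(p, z). tail_sq \<phi> t (fst p, snd p) z) \<in> borel_measurable (borel \<Otimes>\<^sub>M future_alg t)"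
    by (rule tail_measurable) (auto simp flip: borel_prod)
  then have "(\<lambda>(p, z). ennreal (tail_sq \<phi> t p z)) \<in> borel_measurable (borel \<Otimes>\<^sub>M future_law t)"
    by (simp add: case_prod_beta')
  then show ?thesis unfolding mean_sq_def[abs_def] by (rule Z.borel_measurable_nn_integral)
qed

abbreviation "sw v \<equiv> switch u \<phi> t v"
abbreviation "swp v \<equiv> switch_policy u \<phi> t v"
abbreviation "xt \<equiv> traj u t"
abbreviation "Q \<equiv> mean_cost \<phi> t"
abbreviation "N\<^sub>2 \<equiv> mean_sq \<phi> t"
abbreviation "tc \<equiv> tail_cost \<phi> t"
abbreviation "ts \<equiv> tail_sq \<phi> t"

lemma switch_before: "s < t \<Longrightarrow> sw v s = u s"
  and switch_at: "sw v t = v"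
  by (auto simp: switch_def switch_policy_def)

lemma switch_in:
  assumes "\<omega> \<in> space M" "v \<omega> \<in> Usp P t" "s < T"
  shows "sw v s \<omega> \<in> Usp P s"
  using assms controlsD(4)[OF feasibleD(1)[OF solution_feasible[OF sol]], of s \<omega>]
    phi_Gam[of s] Gam_sub[of s] by (auto simp: switch_def switch_policy_def)

lemma traj_switch:
  assumes "\<omega> \<in> space M" "v \<omega> \<in> Usp P t" "s \<le> T"
  shows "traj (sw v) s \<omega> = state_path (swp v \<omega>) (nz \<omega>) s"
proof -
  have "traj (sw v) s \<omega> = state_path (open_loop (ctrl (sw v) \<omega>)) (nz \<omega>) s"
    using assms by (intro trajectory_eq_path switch_in noise_in) auto
  also have "\<dots> = state_path (swp v \<omega>) (nz \<omega>) s"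
    by (rule state_path_cong[symmetric]) (auto simp: switch_def)
  finally show ?thesis .
qed

lemma traj_switch_before:
  assumes "s \<le> t" shows "traj (sw v) s \<omega> = traj u s \<omega>"
  using assms by (induction s) (auto simp: switch_before)

lemma switch_after:
  assumes "\<omega> \<in> space M" "v \<omega> \<in> Usp P t" "t < s" "s < T"
  shows "sw v s \<omega> = \<phi> s (traj (sw v) s \<omega>)"
  using assms traj_switch[where v = v, OF assms(1,2), of s] by (simp add: switch_def switch_policy_def)

text \<open>Holds because \<open>u\<close> already follows \<open>\<phi>\<close> after
  \<open>t\<close>. Thus the tail cost of \<open>u\<close> is also described by \<open>Q\<close>,
  and comparing controls means comparing two values of \<open>Q\<close>.\<close>

lemma switch_self:
  assumes "\<omega> \<in> space M" "s < T"
  shows "sw (u t) s \<omega> = u s \<omega>"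
proof -
  note u = feasibleD(1)[OF solution_feasible[OF sol]]
  have eq: "traj u s \<omega> = state_path (swp (u t) \<omega>) (nz \<omega>) s" if "s \<le> T" for s
  proof -
    have "traj u s \<omega> = state_path (open_loop (ctrl u \<omega>)) (nz \<omega>) s"
      by (rule traj_eq_state_path[OF u assms(1) that])
    also have "\<dots> = state_path (swp (u t) \<omega>) (nz \<omega>) s"
    proof (rule state_path_cong)
      fix r assume "r < s"
      then show "open_loop (ctrl u \<omega>) r (state_path (open_loop (ctrl u \<omega>)) (nz \<omega>) r) =
          swp (u t) \<omega> r (state_path (open_loop (ctrl u \<omega>)) (nz \<omega>) r)"
        using that u_phi[of r \<omega>] assms(1) traj_eq_state_path[OF u assms(1), of r]
        by (auto simp: switch_policy_def)
    qed simp
    finally show ?thesis .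
  qed
  show ?thesis using eq[of s] u_phi[of s \<omega>] assms by (auto simp: switch_def switch_policy_def)
qed

abbreviation "past \<omega> \<equiv> \<Sum>s<t. pcost s (traj u s \<omega>) (u s \<omega>) (noise P (Suc s) \<omega>)"

lemma switch_tail:
  assumes "\<omega> \<in> space M" "v \<omega> \<in> Usp P t"
  shows "reduced_cost P (ctrl (sw v) \<omega>) (nz \<omega>) = past \<omega> + tc (xt \<omega>, v \<omega>) (future t \<omega>)"
    and "(\<Sum>s<T. (norm (sw v s \<omega>))\<^sup>2) = (\<Sum>s<t. (norm (u s \<omega>))\<^sup>2) + ts (xt \<omega>, v \<omega>) (future t \<omega>)"
proof -
  let ?\<pi> = "swp v \<omega>" and ?u = "sw v"
  have p: "state_path ?\<pi> (nz \<omega>) s = traj ?u s \<omega>" if "s \<le> T" for s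
    using traj_switch[where v = v, OF assms that] ..
  have \<pi>: "?\<pi> s (traj ?u s \<omega>) = ?u s \<omega>" if "s \<le> T" for s
    using p[OF that] by (simp add: switch_def)
  have tail: "cost_to_go L K ?\<pi> (nz \<omega>) t x = L t x (v \<omega>) (noise P (Suc t) \<omega>) +
      cost_to_go L K \<phi> (future t \<omega>) (Suc t) (pdyn t x (v \<omega>) (noise P (Suc t) \<omega>))" for L K x
  proof -
    have "cost_to_go L K ?\<pi> (nz \<omega>) (Suc t) y = cost_to_go L K \<phi> (future t \<omega>) (Suc t) y" for y
      using t by (intro cost_to_go_cong) (auto simp: switch_policy_def)
    then show ?thesis by (simp add: cost_to_go_step[OF t] switch_policy_def)
  qed
  \<comment> \<open>Stated for arbitrary stage and final costs, since the two claims are the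
    instances for the costs of the problem and for the squared norms.\<close>
  have sum: "(\<Sum>s<T. L s (traj ?u s \<omega>) (?u s \<omega>) (noise P (Suc s) \<omega>)) + K (traj ?u T \<omega>) =
      (\<Sum>s<t. L s (traj u s \<omega>) (u s \<omega>) (noise P (Suc s) \<omega>))
      + (L t (xt \<omega>) (v \<omega>) (noise P (Suc t) \<omega>) +
      cost_to_go L K \<phi> (future t \<omega>) (Suc t) (pdyn t (xt \<omega>) (v \<omega>) (noise P (Suc t) \<omega>)))" for L K
  proof -
    have "(\<Sum>s<T. L s (traj ?u s \<omega>) (?u s \<omega>) (noise P (Suc s) \<omega>)) + K (traj ?u T \<omega>) =
        (\<Sum>s<T. L s (state_path ?\<pi> (nz \<omega>) s) (?\<pi> s (state_path ?\<pi> (nz \<omega>) s)) (nz \<omega> (Suc s))) + K (state_path ?\<pi> (nz \<omega>) T)"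
      by (simp add: p \<pi>)
    also have "\<dots> = (\<Sum>s<t. L s (state_path ?\<pi> (nz \<omega>) s) (?\<pi> s (state_path ?\<pi> (nz \<omega>) s)) (nz \<omega> (Suc s)))
        + cost_to_go L K ?\<pi> (nz \<omega>) t (state_path ?\<pi> (nz \<omega>) t)"
      using t by (intro cost_to_go_state_path) simp
    also have "(\<Sum>s<t. L s (state_path ?\<pi> (nz \<omega>) s) (?\<pi> s (state_path ?\<pi> (nz \<omega>) s)) (nz \<omega> (Suc s)))
        = (\<Sum>s<t. L s (traj u s \<omega>) (u s \<omega>) (noise P (Suc s) \<omega>))"
      using t by (intro sum.cong) (auto simp: p traj_switch_before switch_policy_def)
    also have "state_path ?\<pi> (nz \<omega>) t = xt \<omega>"
      using t by (simp add: p traj_switch_before)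
    finally show ?thesis unfolding tail .
  qed
  have "traj ?u s \<omega> \<in> Xsp P s" if "s \<le> T" for s
    unfolding p[OF that, symmetric]
    by (rule state_path_in[where w = "nz \<omega>", OF that noise_in[OF _ assms(1)]]) simp
  then have "reduced_cost P (ctrl ?u \<omega>) (nz \<omega>) =
      (\<Sum>s<T. pcost s (traj ?u s \<omega>) (?u s \<omega>) (noise P (Suc s) \<omega>)) + pfinal (traj ?u T \<omega>)"
    using switch_in[where v = v, OF assms] noise_in[OF _ assms(1)]
    by (simp add: reduced_cost_def pcost_eq pfinal_def pX_id)
  then show "reduced_cost P (ctrl ?u \<omega>) (nz \<omega>) = past \<omega> + tc (xt \<omega>, v \<omega>) (future t \<omega>)"
    using sum[of pcost pfinal] t by (simp add: tail_cost_def)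
  show "(\<Sum>s<T. (norm (?u s \<omega>))\<^sup>2) = (\<Sum>s<t. (norm (u s \<omega>))\<^sup>2) + ts (xt \<omega>, v \<omega>) (future t \<omega>)"
    using sum[of sq_cost "\<lambda>_. 0"] t by (simp add: tail_sq_def)
qed

lemma traj_t [measurable]: "xt \<in> borel_measurable (noise_alg P t)" "xt \<in> borel_measurable M"
  and u_t [measurable]: "u t \<in> borel_measurable (noise_alg P t)" "u t \<in> borel_measurable M"
  and u_t_in: "\<omega> \<in> space M \<Longrightarrow> u t \<omega> \<in> Usp P t"
proof -
  note f = feasibleD[OF solution_feasible[OF sol]]
  show "xt \<in> borel_measurable (noise_alg P t)" using t by (intro traj_noise_alg[OF solution_feasible[OF sol]]) simp
  show "xt \<in> borel_measurable M" using statesD(1)[OF f(2)] t by simp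
  show "u t \<in> borel_measurable (noise_alg P t)" "u t \<in> borel_measurable M" "\<omega> \<in> space M \<Longrightarrow> u t \<omega> \<in> Usp P t"
    using f(6)[OF t] controlsD[OF f(1) t] by auto
qed

lemma indep_t: "indep_pair M (noise_alg P t) (\<lambda>\<omega>. \<omega>) (future_alg t) (future t)"
  using t by (intro indep_future) simp

lemma from_noise_alg: "f \<in> borel_measurable (noise_alg P t) \<Longrightarrow> f \<in> borel_measurable M"
  using measurable_from_subalg[OF subalgebra_noise_alg[of t]] t by simp

lemma nn_integral_mean_sq:
  assumes "v \<in> borel_measurable (noise_alg P t)"
  shows "(\<integral>\<^sup>+\<omega>. N\<^sub>2 (xt \<omega>, v \<omega>) \<partial>M) = (\<integral>\<^sup>+\<omega>. ennreal (ts (xt \<omega>, v \<omega>) (future t \<omega>)) \<partial>M)"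
proof -
  have "(\<lambda>(\<omega>, z). ennreal (ts (xt \<omega>, v \<omega>) z)) \<in> borel_measurable (noise_alg P t \<Otimes>\<^sub>M future_alg t)"
    using tail_measurable(2)[OF traj_t(1) assms] by (simp add: case_prod_beta')
  from freezing_nn_integral[OF indep_t this] show ?thesis by (simp add: mean_sq_def)
qed

text \<open>Admissibility after \<open>t\<close> is built into \<open>\<phi>\<close>. What may fail
  is square integrability of the later feedbacks along the new trajectory; their squared norms are
  bounded by past norms plus \<open>ts\<close>, whose expectation is the finite quantity
  assumed.\<close>

lemma switch_feasible:
  assumes v: "v \<in> borel_measurable (noise_alg P t)" "\<And>\<omega>. \<omega> \<in> space M \<Longrightarrow> v \<omega> \<in> Usp P t" "AE \<omega> in M. v \<omega> \<in> Gam t"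
    and fin: "(\<integral>\<^sup>+\<omega>. N\<^sub>2 (xt \<omega>, v \<omega>) \<partial>M) < \<infinity>"
  shows "feasible P (sw v) (traj (sw v))"
proof -
  let ?u = "sw v"
  note f = feasibleD[OF solution_feasible[OF sol]]
  have adapted: "?u s \<in> borel_measurable (noise_alg P s)" if s: "s < T" for s
  proof -
    have pol: "(\<lambda>\<omega>. swp v \<omega> r (Y \<omega>)) \<in> borel_measurable (noise_alg P s)"
      if "r \<le> s" "Y \<in> borel_measurable (noise_alg P s)" for r Y
    proof -
      consider "r < t" | "r = t" | "t < r" by linarith
      then show ?thesis
      proof cases
        case 1
        then show ?thesis using that s noise_alg_mono[OF f(6)[of r], of s] by (simp add: switch_policy_def)
      next
        case 2
        then show ?thesis using that noise_alg_mono[OF v(1), of s] by (simp add: switch_policy_def)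
      next
        case 3
        then show ?thesis using that s measurable_compose[OF that(2) phi_measurable[of r]]
          by (simp add: switch_policy_def)
      qed
    qed
    have "(\<lambda>\<omega>. state_path (swp v \<omega>) (nz \<omega>) s) \<in> borel_measurable (noise_alg P s)"
      by (rule state_path_measurable) (use s pol in \<open>auto intro: noise_measurable_noise_alg\<close>)
    then show ?thesis unfolding switch_def[abs_def] by (intro pol) auto
  qed
  have [measurable]: "?u s \<in> borel_measurable M" if "s < T" for s
    using adapted[OF that] that by (intro measurable_from_subalg[OF subalgebra_noise_alg]) auto
  have tailfin: "(\<integral>\<^sup>+\<omega>. ennreal (ts (xt \<omega>, v \<omega>) (future t \<omega>)) \<partial>M) < \<infinity>"
    using fin nn_integral_mean_sq[OF v(1)] by simp
  have tailm: "(\<lambda>\<omega>. ts (xt \<omega>, v \<omega>) (future t \<omega>)) \<in> borel_measurable M"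
  proof -
    have "(\<lambda>\<omega>. (\<omega>, future t \<omega>)) \<in> M \<rightarrow>\<^sub>M noise_alg P t \<Otimes>\<^sub>M future_alg t"
      using indep_pairD_distr(1)[OF indep_t] by measurable
    from measurable_compose[OF this tail_measurable(2)[OF traj_t(1) v(1)]] show ?thesis by simp
  qed
  have tailint: "integrable M (\<lambda>\<omega>. ts (xt \<omega>, v \<omega>) (future t \<omega>))"
    using tailfin tailm tail_sq_nonneg[OF t] by (intro integrableI_nonneg) auto
  have L2: "?u s \<in> L2 M (Usp P s)" if s: "s < T" for s
  proof -
    have "integrable M (\<lambda>\<omega>. (\<Sum>s<t. (norm (u s \<omega>))\<^sup>2) + ts (xt \<omega>, v \<omega>) (future t \<omega>))"
      using controlsD(3)[OF f(1)] t tailint by (intro Bochner_Integration.integrable_add Bochner_Integration.integrable_sum)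
        (auto simp: sq_integrable_def)
    then have "integrable M (\<lambda>\<omega>. (norm (?u s \<omega>))\<^sup>2)"
    proof (rule Bochner_Integration.integrable_bound)
      show "(\<lambda>\<omega>. (norm (?u s \<omega>))\<^sup>2) \<in> borel_measurable M" using s by measurable
      show "AE \<omega> in M. norm ((norm (?u s \<omega>))\<^sup>2) \<le> norm ((\<Sum>s<t. (norm (u s \<omega>))\<^sup>2) + ts (xt \<omega>, v \<omega>) (future t \<omega>))"
      proof (rule AE_I2)
        fix \<omega> assume \<omega>: "\<omega> \<in> space M"
        have "(norm (?u s \<omega>))\<^sup>2 \<le> (\<Sum>s<T. (norm (?u s \<omega>))\<^sup>2)"
          using s by (intro member_le_sum) auto
        then show "norm ((norm (?u s \<omega>))\<^sup>2) \<le> norm ((\<Sum>s<t. (norm (u s \<omega>))\<^sup>2) + ts (xt \<omega>, v \<omega>) (future t \<omega>))"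
          using switch_tail(2)[OF \<omega>, of v] v(2)[OF \<omega>] by simp
      qed
    qed
    then show ?thesis using s switch_in v(2) by (auto simp: L2_def rv_def sq_integrable_def)
  qed
  then have u': "?u \<in> controls P" by (simp add: controls_def)
  show ?thesis
  proof (rule feasibleI[OF traj_states[OF u'] traj_state_eqs L2 _ adapted])
    fix s assume s: "s < T"
    consider "s < t" | "s = t" | "t < s" by linarith
    then show "AE \<omega> in M. ?u s \<omega> \<in> Gam s"
    proof cases
      case 3
      then show ?thesis using s phi_Gam by (auto simp: switch_def switch_policy_def)
    qed (use f(5)[OF s] v(3) in \<open>simp_all add: switch_before switch_at\<close>)
  qed
qed

text \<open>Only the total cost is known to be integrable, not its parts, hence the integral of the difference.\<close>

lemma switch_cost:
  assumes v: "v \<in> borel_measurable (noise_alg P t)" "\<And>\<omega>. \<omega> \<in> space M \<Longrightarrow> v \<omega> \<in> Usp P t"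
    and u': "sw v \<in> controls P"
  shows "integrable M (\<lambda>\<omega>. Q (xt \<omega>, v \<omega>) - Q (xt \<omega>, u t \<omega>))"
    and "(\<integral>\<omega>. Q (xt \<omega>, v \<omega>) - Q (xt \<omega>, u t \<omega>) \<partial>M) =
      expected_cost P (sw v) (traj (sw v)) - expected_cost P u (traj u)"
proof -
  let ?F = "noise_alg P t \<Otimes>\<^sub>M future_alg t"
  note f = feasibleD[OF solution_feasible[OF sol]]
  have past [measurable]: "past \<in> borel_measurable (noise_alg P t)"
    using t by (intro borel_measurable_sum pcost_measurable)
      (auto intro: noise_alg_mono[OF traj_noise_alg[OF solution_feasible[OF sol]]] noise_alg_mono[OF f(6)] noise_measurable_noise_alg)
  let ?R = "\<lambda>v (\<omega>, z). tc (xt \<omega>, v \<omega>) z"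
  let ?J = "\<lambda>v (\<omega>, z). past \<omega> + tc (xt \<omega>, v \<omega>) z"
  have R [measurable]: "?R v \<in> borel_measurable ?F" "?R (u t) \<in> borel_measurable ?F"
    using tail_measurable(1)[OF traj_t(1) v(1)] tail_measurable(1)[OF traj_t(1) u_t(1)] by simp_all
  then have J [measurable]: "?J v \<in> borel_measurable ?F" "?J (u t) \<in> borel_measurable ?F"
    by (simp_all add: case_prod_beta')
  have i1: "integrable M (\<lambda>\<omega>. ?J v (\<omega>, future t \<omega>))"
    using integrable_reduced_cost[OF u'] switch_tail(1)[of _ v] v(2) by (simp cong: Bochner_Integration.integrable_cong)
  have self: "reduced_cost P (ctrl u \<omega>) (nz \<omega>) = past \<omega> + tc (xt \<omega>, u t \<omega>) (future t \<omega>)"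
    if \<omega>: "\<omega> \<in> space M" for \<omega>
  proof -
    have "trajectory P (ctrl (sw (u t)) \<omega>) (nz \<omega>) s = traj u s \<omega>" if "s \<le> T" for s
      using that by (induction s) (auto simp: switch_self[OF \<omega>])
    then have "reduced_cost P (ctrl u \<omega>) (nz \<omega>) = reduced_cost P (ctrl (sw (u t)) \<omega>) (nz \<omega>)"
      by (simp add: reduced_cost_def switch_self[OF \<omega>])
    then show ?thesis using switch_tail(1)[OF \<omega>, of "u t"] u_t_in[OF \<omega>] by simp
  qed
  have i2: "integrable M (\<lambda>\<omega>. ?J (u t) (\<omega>, future t \<omega>))"
    using integrable_reduced_cost[OF f(1)] self by (simp cong: Bochner_Integration.integrable_cong)
  let ?D = "\<lambda>p. ?J v p - ?J (u t) p"
  have D [measurable]: "?D \<in> borel_measurable ?F" using J by (rule borel_measurable_diff)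
  have iD: "integrable M (\<lambda>\<omega>. ?D (\<omega>, future t \<omega>))" using i1 i2 by (rule Bochner_Integration.integrable_diff)
  have AEeq: "AE \<omega> in M. (\<integral>z. ?D (\<omega>, z) \<partial>future_law t) = Q (xt \<omega>, v \<omega>) - Q (xt \<omega>, u t \<omega>)"
    using freezing_integral(1)[OF indep_t J(1) i1] freezing_integral(1)[OF indep_t J(2) i2]
  proof eventually_elim
    case (elim \<omega>)
    interpret Z: prob_space "future_law t" by (rule prob_space_future_law)
    \<comment> \<open>For frozen \<open>\<omega>\<close> the past cost is a constant, so subtracting
      it turns integrability of the total cost into integrability of the tail.\<close>
    have c: "integrable (future_law t) (\<lambda>z. past \<omega>)" by simp
    have "integrable (future_law t) (\<lambda>z. ?J v (\<omega>, z) - past \<omega>)" "integrable (future_law t) (\<lambda>z. ?J (u t) (\<omega>, z) - past \<omega>)"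
      using Bochner_Integration.integrable_diff[OF elim(1) c] Bochner_Integration.integrable_diff[OF elim(2) c] by blast+
    then have *: "integrable (future_law t) (tc (xt \<omega>, v \<omega>))"
      "integrable (future_law t) (tc (xt \<omega>, u t \<omega>))" by simp_all
    have "(\<integral>z. ?D (\<omega>, z) \<partial>future_law t) = (\<integral>z. tc (xt \<omega>, v \<omega>) z - tc (xt \<omega>, u t \<omega>) z \<partial>future_law t)"
      by simp
    then show ?case using Bochner_Integration.integral_diff[OF *] by (simp add: mean_cost_def)
  qed
  have vM [measurable]: "v \<in> borel_measurable M" using v(1) by (rule from_noise_alg)
  have m: "(\<lambda>\<omega>. Q (xt \<omega>, v \<omega>) - Q (xt \<omega>, u t \<omega>)) \<in> borel_measurable M"
    unfolding borel_prod[symmetric] by measurable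
  note DI = freezing_integral(2,3)[OF indep_t D iD]
  show "integrable M (\<lambda>\<omega>. Q (xt \<omega>, v \<omega>) - Q (xt \<omega>, u t \<omega>))"
    by (rule integrable_cong_AE[THEN iffD1, OF borel_measurable_integrable[OF DI(1)] m AEeq DI(1)])
  have "(\<integral>\<omega>. Q (xt \<omega>, v \<omega>) - Q (xt \<omega>, u t \<omega>) \<partial>M) =
      (\<integral>\<omega>. (\<integral>z. ?D (\<omega>, z) \<partial>future_law t) \<partial>M)"
    by (rule integral_cong_AE[symmetric, OF borel_measurable_integrable[OF DI(1)] m AEeq])
  also have "\<dots> = (\<integral>\<omega>. ?J v (\<omega>, future t \<omega>) \<partial>M) - (\<integral>\<omega>. ?J (u t) (\<omega>, future t \<omega>) \<partial>M)"
    unfolding DI(2)[symmetric] by (rule Bochner_Integration.integral_diff[OF i1 i2])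
  also have "(\<integral>\<omega>. ?J v (\<omega>, future t \<omega>) \<partial>M) = expected_cost P (sw v) (traj (sw v))"
    unfolding expected_cost_eq[OF u' traj_states[OF u'] traj_state_eqs]
    using switch_tail(1)[of _ v] v(2) by (intro Bochner_Integration.integral_cong) auto
  also have "(\<integral>\<omega>. ?J (u t) (\<omega>, future t \<omega>) \<partial>M) = expected_cost P u (traj u)"
    unfolding expected_cost_eq[OF f(1-3)] using self by (intro Bochner_Integration.integral_cong) auto
  finally show "(\<integral>\<omega>. Q (xt \<omega>, v \<omega>) - Q (xt \<omega>, u t \<omega>) \<partial>M) =
      expected_cost P (sw v) (traj (sw v)) - expected_cost P u (traj u)" .
qed

lemma mean_sq_finite: "(\<integral>\<^sup>+\<omega>. N\<^sub>2 (xt \<omega>, u t \<omega>) \<partial>M) < \<infinity>"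
proof -
  note f = feasibleD[OF solution_feasible[OF sol]]
  have int: "integrable M (\<lambda>\<omega>. \<Sum>s<T. (norm (u s \<omega>))\<^sup>2)"
    using controlsD(3)[OF f(1)] by (intro Bochner_Integration.integrable_sum) (auto simp: sq_integrable_def)
  have "(\<integral>\<^sup>+\<omega>. ennreal (ts (xt \<omega>, u t \<omega>) (future t \<omega>)) \<partial>M) \<le> (\<integral>\<^sup>+\<omega>. ennreal (\<Sum>s<T. (norm (u s \<omega>))\<^sup>2) \<partial>M)"
  proof (rule nn_integral_mono)
    fix \<omega> assume \<omega>: "\<omega> \<in> space M"
    have "(\<Sum>s<T. (norm (sw (u t) s \<omega>))\<^sup>2) = (\<Sum>s<T. (norm (u s \<omega>))\<^sup>2)"
      by (intro sum.cong) (auto simp: switch_self[OF \<omega>])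
    then show "ennreal (ts (xt \<omega>, u t \<omega>) (future t \<omega>)) \<le> ennreal (\<Sum>s<T. (norm (u s \<omega>))\<^sup>2)"
      using switch_tail(2)[OF \<omega>, of "u t"] u_t_in[OF \<omega>]
      by (intro ennreal_leI) (smt (verit) sum_nonneg zero_le_power2)
  qed
  also have "\<dots> < \<infinity>" using int by (auto simp: integrable_iff_bounded sum_nonneg)
  finally show ?thesis using nn_integral_mean_sq[OF u_t(1)] by simp
qed


text \<open>Switch to \<open>\<psi>\<close> exactly where it is strictly better. The change of mean
  cost is nonpositive pointwise and has nonnegative integral by optimality, so it vanishes almost
  surely. The bound \<open>k\<close> keeps the later controls square integrable, which makes the
  competitor feasible.\<close>

lemma mean_cost_optimal:
  assumes \<psi> [measurable]: "\<psi> \<in> borel_measurable borel" and B [measurable]: "B \<in> sets borel"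
    and \<psi>B: "\<And>x. x \<in> B \<Longrightarrow> \<psi> x \<in> Gam t" "\<And>x. x \<in> B \<Longrightarrow> N\<^sub>2 (x, \<psi> x) \<le> of_nat k"
  shows "AE \<omega> in M. xt \<omega> \<in> B \<longrightarrow>
    Q (xt \<omega>, u t \<omega>) \<le> Q (xt \<omega>, \<psi> (xt \<omega>))"
proof -
  note f = feasibleD[OF solution_feasible[OF sol]]
  let ?A = "\<lambda>\<omega>. xt \<omega> \<in> B \<and> Q (xt \<omega>, \<psi> (xt \<omega>)) < Q (xt \<omega>, u t \<omega>)"
  define v where "v \<omega> = (if ?A \<omega> then \<psi> (xt \<omega>) else u t \<omega>)" for \<omega>
  have [measurable]: "Q \<in> borel_measurable (borel \<Otimes>\<^sub>M borel)" "N\<^sub>2 \<in> borel_measurable (borel \<Otimes>\<^sub>M borel)"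
    by (simp_all add: borel_prod)
  have v [measurable]: "v \<in> borel_measurable (noise_alg P t)" unfolding v_def by measurable
  have vM [measurable]: "v \<in> borel_measurable M" using v by (rule from_noise_alg)
  have vU: "v \<omega> \<in> Usp P t" if "\<omega> \<in> space M" for \<omega>
    using \<psi>B(1) Gam_sub[OF t] u_t_in[OF that] by (auto simp: v_def)
  have vG: "AE \<omega> in M. v \<omega> \<in> Gam t"
    using f(5)[OF t] by eventually_elim (use \<psi>B(1) in \<open>auto simp: v_def\<close>)
  have "(\<integral>\<^sup>+\<omega>. N\<^sub>2 (xt \<omega>, v \<omega>) \<partial>M) \<le> (\<integral>\<^sup>+\<omega>. of_nat k + N\<^sub>2 (xt \<omega>, u t \<omega>) \<partial>M)"
    by (intro nn_integral_mono) (auto simp: v_def intro: add_increasing2 add_increasing \<psi>B(2))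
  also have "\<dots> = of_nat k + (\<integral>\<^sup>+\<omega>. N\<^sub>2 (xt \<omega>, u t \<omega>) \<partial>M)"
    by (subst nn_integral_add) (auto simp: emeasure_space_1)
  also have "\<dots> < \<infinity>" using mean_sq_finite by (simp add: of_nat_less_top)
  finally have feas: "feasible P (sw v) (traj (sw v))"
    by (intro switch_feasible v vU vG)
  note D = switch_cost[OF v vU feasibleD(1)[OF feas]]
  let ?d = "\<lambda>\<omega>. Q (xt \<omega>, v \<omega>) - Q (xt \<omega>, u t \<omega>)"
  have "expected_cost P u (traj u) \<le> expected_cost P (sw v) (traj (sw v))"
    using sol feas by (simp add: solution_def)
  then have "0 \<le> (\<integral>\<omega>. ?d \<omega> \<partial>M)" using D(2) by simp
  moreover have "(\<integral>\<omega>. - ?d \<omega> \<partial>M) = - (\<integral>\<omega>. ?d \<omega> \<partial>M)" by (rule Bochner_Integration.integral_minus)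
  moreover have "0 \<le> (\<integral>\<omega>. - ?d \<omega> \<partial>M)" by (intro Bochner_Integration.integral_nonneg) (auto simp: v_def)
  ultimately have "(\<integral>\<omega>. - ?d \<omega> \<partial>M) = 0" by linarith
  moreover have "integrable M (\<lambda>\<omega>. - ?d \<omega>)" using D(1) by (rule Bochner_Integration.integrable_minus)
  ultimately have "AE \<omega> in M. - ?d \<omega> = 0"
    by (intro integral_nonneg_eq_0_iff_AE[THEN iffD1] AE_I2) (auto simp: v_def)
  then show ?thesis
  proof eventually_elim
    case (elim \<omega>)
    show ?case
    proof (rule impI, rule ccontr)
      assume "xt \<omega> \<in> B" "\<not> Q (xt \<omega>, u t \<omega>) \<le> Q (xt \<omega>, \<psi> (xt \<omega>))"
      then show False using elim by (simp add: v_def)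
    qed
  qed
qed

text \<open>At almost every sample point \<open>u t\<close> itself is a control with the required
  properties at the state reached. So existence of a good choice is free, and only its measurability
  as a function of the state has to be arranged.\<close>

lemma optimal_feedback_exists:
  obtains \<psi> where "\<psi> \<in> borel_measurable borel" "range \<psi> \<subseteq> Gam t"
    "AE \<omega> in M. Q (xt \<omega>, \<psi> (xt \<omega>)) \<le> Q (xt \<omega>, u t \<omega>)"
    "AE \<omega> in M. N\<^sub>2 (xt \<omega>, \<psi> (xt \<omega>)) \<le> N\<^sub>2 (xt \<omega>, u t \<omega>) + 1"
proof -
  note f = feasibleD[OF solution_feasible[OF sol]]
  let ?p = "\<lambda>\<omega>. (xt \<omega>, u t \<omega>)"
  have pm: "?p \<in> borel_measurable M" unfolding borel_prod[symmetric] by measurable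
  define \<mu> where "\<mu> = distr M borel ?p"
  have \<mu>: "finite_measure \<mu>" "sets \<mu> = sets borel"
    unfolding \<mu>_def using prob_space_distr[OF pm] by (auto intro: prob_space.axioms(1)[OF prob_space_distr])
  have AE\<mu>: "AE \<omega> in M. R (?p \<omega>)" if "AE p in \<mu>. R p" for R
    using that unfolding \<mu>_def by (rule AE_distrD[OF pm])
  have snd_Gam [measurable]: "{p. snd p \<in> Gam t} \<in> sets (borel :: ('e \<times> 'e) measure)"
    using Gam_closed[OF t] by (intro borel_closed closed_vimage_snd[unfolded vimage_def]) simp
  \<comment> \<open>\<open>B r k\<close> consists of the states with an admissible control of mean cost below \<open>r\<close> and tail norm at
    most \<open>k\<close>; there optimality forces the mean cost of \<open>u\<close> to be at most \<open>r\<close>, which is recorded in \<open>G\<close>.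
    A selection from \<open>G\<close> is therefore as good as \<open>u\<close>, and taking the least bound \<open>k\<close> on the tail norm
    loses at most \<open>1\<close>.\<close>
  define S where "S r k = {p. Q p < real_of_rat r} \<inter> {p. N\<^sub>2 p \<le> of_nat k} \<inter> {p. snd p \<in> Gam t}" for r :: rat and k :: nat
  have "{p\<in>space borel. Q p < real_of_rat r} \<in> sets borel" "{p\<in>space borel. N\<^sub>2 p \<le> of_nat k} \<in> sets borel" for r and k :: nat
    by measurable
  then have QN [measurable]: "{p. Q p < real_of_rat r} \<in> sets borel" "{p. N\<^sub>2 p \<le> of_nat k} \<in> sets borel" for r and k :: nat
    by simp_all
  define sel where "sel S' B \<psi> \<longleftrightarrow> B \<in> sets borel \<and> \<psi> \<in> borel_measurable borel \<and> (\<forall>x\<in>B. (x, \<psi> x) \<in> S') \<and>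
      (AE p in \<mu>. p \<in> S' \<longrightarrow> fst p \<in> B)" for S' :: "('e \<times> 'e) set" and B :: "'e set" and \<psi> :: "'e \<Rightarrow> 'e"
  have sel: "\<exists>B \<psi>. sel S' B \<psi>" if S': "S' \<in> sets borel" for S'
  proof (rule measurable_selection_AE[OF \<mu> S'])
    fix B \<psi> assume "B \<in> sets borel" "\<psi> \<in> borel_measurable borel" "\<And>x. x \<in> B \<Longrightarrow> (x, \<psi> x) \<in> S'"
      "AE p in \<mu>. p \<in> S' \<longrightarrow> fst p \<in> B"
    then have "sel S' B \<psi>" unfolding sel_def by blast
    then show ?thesis by blast
  qed
  have "\<exists>B \<psi>. sel (S r k) B \<psi>" for r k
    unfolding S_def by (intro sel sets.Int QN snd_Gam)
  then obtain B \<psi> where "\<And>r k. sel (S r k) (B r k) (\<psi> r k)" by metis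
  then have B: "\<And>r k. B r k \<in> sets borel" "\<And>r k. \<psi> r k \<in> borel_measurable borel"
    "\<And>r k x. x \<in> B r k \<Longrightarrow> (x, \<psi> r k x) \<in> S r k" "\<And>r k. AE p in \<mu>. p \<in> S r k \<longrightarrow> fst p \<in> B r k"
    unfolding sel_def by blast+
  define G where "G = {p. snd p \<in> Gam t} \<inter> (\<Inter>r. \<Inter>k. {p. fst p \<in> B r k \<longrightarrow> Q p \<le> real_of_rat r})"
  have "{p. fst p \<in> B r k \<longrightarrow> Q p \<le> real_of_rat r} \<in> sets borel" for r k
  proof -
    note B(1)[measurable]
    have [measurable]: "fst \<in> (borel :: ('e \<times> 'e) measure) \<rightarrow>\<^sub>M borel" unfolding borel_prod[symmetric] by measurable
    have "{p\<in>space borel. fst p \<in> B r k \<longrightarrow> Q p \<le> real_of_rat r} \<in> sets borel" by measurable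
    then show ?thesis by simp
  qed
  then have GB [measurable]: "G \<in> sets borel"
    unfolding G_def by (intro sets.Int snd_Gam sets.countable_INT'') auto
  have AEG: "AE \<omega> in M. ?p \<omega> \<in> G"
  proof -
    have "AE \<omega> in M. xt \<omega> \<in> B r k \<longrightarrow> Q (?p \<omega>) \<le> real_of_rat r" for r k
    proof -
      have "AE \<omega> in M. xt \<omega> \<in> B r k \<longrightarrow> Q (?p \<omega>) \<le> Q (xt \<omega>, \<psi> r k (xt \<omega>))"
        by (rule mean_cost_optimal[OF B(2,1), where k = k]) (use B(3) in \<open>auto simp: S_def\<close>)
      then show ?thesis
      proof eventually_elim
        case (elim \<omega>)
        then show ?case using B(3)[of "xt \<omega>" r k] by (auto simp: S_def)
      qed
    qed
    then have "AE \<omega> in M. \<forall>r k. xt \<omega> \<in> B r k \<longrightarrow> Q (?p \<omega>) \<le> real_of_rat r"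
      unfolding AE_all_countable by blast
    then show ?thesis using f(5)[OF t] by eventually_elim (simp add: G_def)
  qed
  have "\<exists>B \<psi>. sel (G \<inter> {p. N\<^sub>2 p \<le> of_nat k}) B \<psi>" for k :: nat
    by (intro sel sets.Int GB QN)
  then obtain B' \<psi>' where "\<And>k. sel (G \<inter> {p. N\<^sub>2 p \<le> of_nat k}) (B' k) (\<psi>' k)" by metis
  then have B': "\<And>k. B' k \<in> sets borel" "\<And>k. \<psi>' k \<in> borel_measurable borel"
    "\<And>k x. x \<in> B' k \<Longrightarrow> (x, \<psi>' k x) \<in> G \<inter> {p. N\<^sub>2 p \<le> of_nat k}"
    "\<And>k. AE p in \<mu>. p \<in> G \<inter> {p. N\<^sub>2 p \<le> of_nat k} \<longrightarrow> fst p \<in> B' k"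
    unfolding sel_def by blast+
  note B'(1,2)[measurable]
  \<comment> \<open>Default value at the states outside all \<open>B' k\<close>, which are almost
    surely not reached; admissibility is claimed at every state.\<close>
  obtain c where c: "c \<in> Gam t" using AE_exists[OF f(5)[OF t]] by blast
  define K where "K x = (LEAST k. x \<in> B' k)" for x
  define \<phi>' where "\<phi>' x = (if \<exists>k. x \<in> B' k then \<psi>' (K x) x else c)" for x
  have [measurable]: "K \<in> measurable borel (count_space UNIV)" unfolding K_def by measurable
  have AE1: "AE \<omega> in M. \<forall>r k. ?p \<omega> \<in> S r k \<longrightarrow> xt \<omega> \<in> B r k"
    using AE\<mu>[OF B(4)] by (simp add: AE_all_countable)
  have AE2: "AE \<omega> in M. \<forall>k. ?p \<omega> \<in> G \<inter> {p. N\<^sub>2 p \<le> of_nat k} \<longrightarrow> xt \<omega> \<in> B' k"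
    using AE\<mu>[OF B'(4)] by (simp add: AE_all_countable)
  have AE3: "AE \<omega> in M. N\<^sub>2 (?p \<omega>) \<noteq> \<infinity>"
    using mean_sq_finite measurable_compose[OF pm mean_sq_measurable] by (intro nn_integral_PInf_AE) auto
  have key: "AE \<omega> in M. xt \<omega> \<in> B' (K (xt \<omega>)) \<and> of_nat (K (xt \<omega>)) \<le> N\<^sub>2 (?p \<omega>) + 1 \<and> (\<exists>k. xt \<omega> \<in> B' k)"
    using AE2 AE3 AEG
  proof eventually_elim
    case (elim \<omega>)
    obtain k :: nat where "N\<^sub>2 (?p \<omega>) \<le> of_nat k"
      using elim(2) by (metis ennreal_Ex_less_of_nat infinity_ennreal_def less_imp_le top.not_eq_extremum)
    then have ex: "\<exists>k. xt \<omega> \<in> B' k" using elim by blast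
    then have in_K: "xt \<omega> \<in> B' (K (xt \<omega>))" unfolding K_def by (rule LeastI_ex)
    have "of_nat (K (xt \<omega>)) \<le> N\<^sub>2 (?p \<omega>) + 1"
    proof (cases "K (xt \<omega>)")
      \<comment> \<open>By minimality the state misses \<open>B' j\<close>, so the pair of
        \<open>u\<close> violates the bound \<open>j\<close>; hence \<open>j\<close> is at most
        \<open>N\<^sub>2\<close>, and the least index exceeds it by \<open>1\<close>.\<close>
      case (Suc j)
      then have "xt \<omega> \<notin> B' j" unfolding K_def using not_less_Least[of j "\<lambda>k. xt \<omega> \<in> B' k"] by simp
      then have "of_nat j \<le> N\<^sub>2 (?p \<omega>)" using elim by force
      then show ?thesis unfolding Suc by (simp add: add.commute add_mono)
    qed simp
    then show ?case using in_K ex by blast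
  qed
  show thesis
  proof (rule that)
    show "\<phi>' \<in> borel_measurable borel" unfolding \<phi>'_def by measurable
    show "range \<phi>' \<subseteq> Gam t"
    proof clarify
      fix x
      have "x \<in> B' (K x)" if "\<exists>k. x \<in> B' k" unfolding K_def using that by (rule LeastI_ex)
      then show "\<phi>' x \<in> Gam t" using B'(3)[of x "K x"] c by (auto simp: \<phi>'_def G_def)
    qed
    show "AE \<omega> in M. N\<^sub>2 (xt \<omega>, \<phi>' (xt \<omega>)) \<le> N\<^sub>2 (xt \<omega>, u t \<omega>) + 1"
      using key
    proof eventually_elim
      case (elim \<omega>)
      then have "N\<^sub>2 (xt \<omega>, \<phi>' (xt \<omega>)) \<le> of_nat (K (xt \<omega>))"
        using B'(3)[of "xt \<omega>" "K (xt \<omega>)"] by (simp add: \<phi>'_def)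
      then show ?case using elim order_trans by blast
    qed
    show "AE \<omega> in M. Q (xt \<omega>, \<phi>' (xt \<omega>)) \<le> Q (xt \<omega>, u t \<omega>)"
      using key AE1 AE3 AEG
    proof eventually_elim
      case (elim \<omega>)
      have G: "(xt \<omega>, \<phi>' (xt \<omega>)) \<in> G"
        using elim(1) B'(3)[of "xt \<omega>" "K (xt \<omega>)"] by (simp add: \<phi>'_def)
      obtain k :: nat where k: "N\<^sub>2 (?p \<omega>) \<le> of_nat k"
        using elim(3) by (metis ennreal_Ex_less_of_nat infinity_ennreal_def less_imp_le top.not_eq_extremum)
      \<comment> \<open>If \<open>u\<close> stays below level \<open>r\<close>, its pair lies in
        \<open>S r k\<close> and the state in \<open>B r k\<close>; membership in \<open>G\<close>
        then bounds the selected pair by \<open>r\<close>. A rational strictly between the two costs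
        would contradict this.\<close>
      have le: "Q (xt \<omega>, \<phi>' (xt \<omega>)) \<le> real_of_rat r" if "Q (?p \<omega>) < real_of_rat r" for r
      proof -
        have "?p \<omega> \<in> S r k" using that k elim(4) by (simp add: S_def G_def)
        then have "xt \<omega> \<in> B r k" using elim(2) by blast
        then show ?thesis using G by (auto simp: G_def)
      qed
      show ?case
      proof (rule ccontr)
        assume "\<not> ?case"
        then obtain r where "Q (?p \<omega>) < real_of_rat r" "real_of_rat r < Q (xt \<omega>, \<phi>' (xt \<omega>))"
          using of_rat_dense[of "Q (?p \<omega>)" "Q (xt \<omega>, \<phi>' (xt \<omega>))"] by auto
        with le show False by fastforce
      qed
    qed
  qed
qed

lemma feedback_from_step: "\<exists>u' \<phi>'. feedback_from t u' \<phi>'"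
proof -
  obtain \<psi> where \<psi> [measurable]: "\<psi> \<in> borel_measurable borel" and \<psi>G: "range \<psi> \<subseteq> Gam t"
    and Q: "AE \<omega> in M. Q (xt \<omega>, \<psi> (xt \<omega>)) \<le> Q (xt \<omega>, u t \<omega>)"
    and N: "AE \<omega> in M. N\<^sub>2 (xt \<omega>, \<psi> (xt \<omega>)) \<le> N\<^sub>2 (xt \<omega>, u t \<omega>) + 1"
    by (rule optimal_feedback_exists)
  let ?v = "\<lambda>\<omega>. \<psi> (xt \<omega>)"
  let ?u = "sw ?v" and ?\<phi> = "\<phi>(t := \<psi>)"
  have v: "?v \<in> borel_measurable (noise_alg P t)" by measurable
  have vU: "?v \<omega> \<in> Usp P t" for \<omega> using \<psi>G Gam_sub[OF t] by blast
  have [measurable]: "N\<^sub>2 \<in> borel_measurable (borel \<Otimes>\<^sub>M borel)" by (simp add: borel_prod)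
  \<comment> \<open>The loss of \<open>1\<close> in the norm bound adds only \<open>1\<close> to a
    finite expectation, so the switched control stays feasible.\<close>
  have "(\<integral>\<^sup>+\<omega>. N\<^sub>2 (xt \<omega>, ?v \<omega>) \<partial>M) \<le> (\<integral>\<^sup>+\<omega>. N\<^sub>2 (xt \<omega>, u t \<omega>) + 1 \<partial>M)"
    using N by (rule nn_integral_mono_AE)
  also have "\<dots> = (\<integral>\<^sup>+\<omega>. N\<^sub>2 (xt \<omega>, u t \<omega>) \<partial>M) + 1"
    by (subst nn_integral_add) (auto simp: emeasure_space_1)
  also have "\<dots> < \<infinity>" using mean_sq_finite by simp
  finally have feas: "feasible P ?u (traj ?u)"
    using \<psi>G by (intro switch_feasible v vU) auto
  note D = switch_cost[OF v vU feasibleD(1)[OF feas]]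
  have "(\<integral>\<omega>. Q (xt \<omega>, ?v \<omega>) - Q (xt \<omega>, u t \<omega>) \<partial>M) \<le> (\<integral>\<omega>. 0 \<partial>M)"
    using Q D(1) by (intro integral_mono_AE) auto
  then have "expected_cost P ?u (traj ?u) \<le> expected_cost P u (traj u)" using D(2) by simp
  then have "solution P ?u (traj ?u)"
    using sol feas unfolding solution_def by (meson order_trans)
  moreover have "?\<phi> s \<in> borel_measurable borel \<and> range (?\<phi> s) \<subseteq> Gam s \<and> (\<forall>\<omega>\<in>space M. ?u s \<omega> = ?\<phi> s (traj ?u s \<omega>))"
    if "t \<le> s" "s < T" for s
  proof (cases "s = t")
    case True
    then show ?thesis using \<psi> \<psi>G by (auto simp: switch_at traj_switch_before)
  next
    case False
    then have "t < s" using that by simp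
    then show ?thesis using that phi_measurable[of s] phi_Gam[of s] switch_after[where v = ?v, OF _ vU, of _ s] by auto
  qed
  ultimately have "feedback_from t ?u ?\<phi>" by (simp add: feedback_from_def)
  then show ?thesis by blast
qed

end

section \<open>Backward induction over time and choice of the co-state\<close>

lemma feedback_solution_exists:
  assumes "solution P u x"
  shows "\<exists>u' \<phi>. feedback_from 0 u' \<phi>"
proof -
  note f = feasibleD[OF solution_feasible[OF assms]]
  have "feasible P u (traj u)"
    by (rule feasibleI[OF traj_states[OF f(1)] traj_state_eqs f(4-6)])
  moreover have "expected_cost P u (traj u) = expected_cost P u x"
    unfolding expected_cost_eq[OF f(1-3)] expected_cost_eq[OF f(1) traj_states[OF f(1)] traj_state_eqs] ..
  ultimately have "solution P u (traj u)" using assms by (simp add: solution_def)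
  \<comment> \<open>At the horizon the feedback requirement is vacuous, so any solution starts the
    induction once its state is replaced by \<open>traj u\<close>.\<close>
  moreover have "\<not> (T \<le> s \<and> s < T)" for s by simp
  ultimately have "feedback_from T u (\<lambda>_ _. 0)" unfolding feedback_from_def by blast
  then have base: "\<exists>u' \<phi>. feedback_from T u' \<phi>" by blast
  show ?thesis
    using le0[of T] base
  proof (induction rule: inc_induct)
    case base
    then show ?case .
  next
    case (step t)
    then show ?case using feedback_from_step by blast
  qed
qed

text \<open>If every control is measurable with respect to its state, factorization supplies the
  feedbacks and the co-state is built along them. Otherwise the conditional claim is void and the
  open-loop co-state suffices.\<close>

lemma costate_exists:
  assumes sol: "solution P u x"
  shows "\<exists>l\<in>states P. optimality_conditions P u x l \<and>
    ((\<forall>t<T. precedes M borel (u t) (x t)) \<longrightarrow>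
     (\<forall>t<T. costate_measurability P x l t \<and> markov_cond_exp P u x l t))"
proof (cases "\<forall>t<T. precedes M borel (u t) (x t)")
  case False
  note f = feasibleD[OF solution_feasible[OF sol]]
  have l: "(\<lambda>t \<omega>. costate (open_loop (ctrl u \<omega>)) (nz \<omega>) t (x t \<omega>)) \<in> states P"
    "costate_eqs P u x (\<lambda>t \<omega>. costate (open_loop (ctrl u \<omega>)) (nz \<omega>) t (x t \<omega>))"
    by (rule costate_process[OF f(1-3)]; use controlsD(2)[OF f(1)] in simp)+
  show ?thesis using solution_optimality_conditions[OF sol l] l(1) False by blast
next
  case True
  note f = feasibleD[OF solution_feasible[OF sol]]
  have "\<exists>\<phi>. \<phi> \<in> borel_measurable borel \<and> (\<forall>\<omega>\<in>space M. u t \<omega> = \<phi> (x t \<omega>))" if "t < T" for t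
  proof -
    have "u t \<in> borel_measurable (vimage_algebra (space M) (x t) borel)"
      using True that by (simp add: precedes_def sigma_gen_def)
    then show ?thesis by (rule factor_through) auto
  qed
  then obtain \<phi> where \<phi>: "\<And>t. t < T \<Longrightarrow> \<phi> t \<in> borel_measurable borel"
    "\<And>t \<omega>. t < T \<Longrightarrow> \<omega> \<in> space M \<Longrightarrow> \<phi> t (x t \<omega>) = u t \<omega>" by metis
  have l: "(\<lambda>t \<omega>. costate \<phi> (nz \<omega>) t (x t \<omega>)) \<in> states P"
    "costate_eqs P u x (\<lambda>t \<omega>. costate \<phi> (nz \<omega>) t (x t \<omega>))"
    by (rule costate_process[OF f(1-3)]; use \<phi> in \<open>auto intro: measurable_compose\<close>)+
  show ?thesis
    using solution_optimality_conditions[OF sol l] l(1)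
      feedback_costate_properties[OF solution_feasible[OF sol] \<phi>] by blast
qed

end

theorem theorem2p5:
  fixes P :: "('a, 'e::euclidean_space) control_problem"
    and u x :: "nat \<Rightarrow> 'a \<Rightarrow> 'e"
  assumes "control_setting P"
    and "closed_convex_constraints P"
    and "smooth_data P" and "sq_integrable_derivatives P"
    and "markovian P"
    and "solution P u x"
  shows "(\<exists>l\<in>states P. optimality_conditions P u x l \<and>
            ((\<forall>t<horizon P. precedes (prob P) borel (u t) (x t)) \<longrightarrow>
             (\<forall>t<horizon P. costate_measurability P x l t \<and> markov_cond_exp P u x l t)))
       \<and> (\<exists>u' x'. solution P u' x' \<and>
            (\<exists>l\<in>states P. optimality_conditions P u' x' l \<and>
               (\<forall>t<horizon P.
                  costate_measurability P x' l t \<and>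
                  precedes (prob P) borel (u' t) (x' t) \<and>
                  markov_cond_exp P u' x' l t)))"
proof -
  interpret markov_control P
    using assms by (simp add: markov_control_def smooth_control_def markov_control_axioms_def)
  obtain u' \<phi> where "feedback_from 0 u' \<phi>" using feedback_solution_exists[OF assms(6)] by blast
  then have u': "solution P u' (traj u')" and \<phi>: "\<And>s. s < T \<Longrightarrow> \<phi> s \<in> borel_measurable borel"
    "\<And>s \<omega>. s < T \<Longrightarrow> \<omega> \<in> space M \<Longrightarrow> u' s \<omega> = \<phi> s (traj u' s \<omega>)"
    by (simp_all add: feedback_from_def)
  have prec: "precedes M borel (u' s) (traj u' s)" if "s < T" for s
  proof -
    have "traj u' s \<in> borel_measurable (sigma_gen M borel (traj u' s))"
      unfolding sigma_gen_def by (rule measurable_vimage_algebra1) simp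
    then have "(\<lambda>\<omega>. \<phi> s (traj u' s \<omega>)) \<in> borel_measurable (sigma_gen M borel (traj u' s))"
      using \<phi>(1)[OF that] by (rule measurable_compose)
    then show ?thesis
      unfolding precedes_def
      by (rule measurable_cong[THEN iffD2, rotated]) (simp add: sigma_gen_def \<phi>(2)[OF that])
  qed
  show ?thesis
    using costate_exists[OF assms(6)] costate_exists[OF u'] u' prec by blast
qed

end
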